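(* Let $\Lambda_{(\phi,\psi)}=\begin{pmatrix} A & N\\ M & B\end{pmatrix}$ be a Morita ring which is an Artin algebra. Then the indecomposable injective $\Lambda_{(\phi,\psi)}$-modules are, up to isomorphism, the objects of the form $$\mathsf H_A(I)=(I,\ \mathrm{Hom}_A(N,I),\ \mu_I,\ \epsilon'_I)\qquad\text{and}\qquad \mathsf H_B(J)=(\mathrm{Hom}_B(M,J),\ J,\ \epsilon_J,\ \nu_J),$$ where $I$ is an indecomposable injective $A$-module and $J$ is an indecomposable injective $B$-module. Here $\mu_I$ is the composite $M\otimes_AI\to\mathrm{Hom}_A(N,N\otimes_BM\otimes_AI)\to\mathrm{Hom}_A(N,I)$ of the unit $\delta'_{M\otimes_A I}$ with $\mathrm{Hom}_A(N,\Psi_I)$, and $\nu_J$ is the composite $N\otimes_BJ\to\mathrm{Hom}_B(M,M\otimes_AN\otimes_BJ)\to\mathrm{Hom}_B(M,J)$ of the unit $\delta_{N\otimes_B J}$ with $\mathrm{Hom}_B(M,\Phi_J)$.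
   Context: $A,B$ are unital associative rings, $N$ is an $A$-$B$-bimodule, $M$ is a $B$-$A$-bimodule, $\phi:M\otimes_AN\to B$ is a $B$-$B$-bimodule homomorphism and $\psi:N\otimes_BM\to A$ is an $A$-$A$-bimodule homomorphism such that $\phi(m\otimes n)m'=m\psi(n\otimes m')$ and $n\phi(m\otimes n')=\psi(n\otimes m)n'$ for all $m,m'\in M$, $n,n'\in N$. The Morita ring $\Lambda_{(\phi,\psi)}$ is the set of matrices $\begin{pmatrix} a & n\\ m & b\end{pmatrix}$ with componentwise addition and multiplication $\begin{pmatrix} a & n\\ m & b\end{pmatrix}\begin{pmatrix} a' & n'\\ m' & b'\end{pmatrix}=\begin{pmatrix} aa'+\psi(n\otimes m') & an'+nb'\\ ma'+bm' & bb'+\phi(m\otimes n')\end{pmatrix}$. Modules are finitely generated left modules. For an $A$-module $X$ and a $B$-module $Y$, $\Psi_X:N\otimes_BM\otimes_AX\to X$ is $n\otimes m\otimes x\mapsto\psi(n\otimes m)x$ and $\Phi_Y:M\otimes_AN\otimes_BY\to Y$ is $m\otimes n\otimes y\mapsto\phi(m\otimes n)y$. $\Lambda_{(\phi,\psi)}$-modules are identified with tuples $(X,Y,f,g)$, where $X$ is an $A$-module, $Y$ a $B$-module, $f:M\otimes_AX\to Y$ is $B$-linear, $g:N\otimes_BY\to X$ is $A$-linear, and $g(n\otimes f(m\otimes x))=\psi(n\otimes m)x$, $f(m\otimes g(n\otimes y))=\phi(m\otimes n)y$; the corresponding module is $X\oplus Y$ with $\begin{pmatrix} a & n\\ m & b\end{pmatrix}(x,y)=(ax+g(n\otimes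 y),by+f(m\otimes x))$. $\delta:\mathrm{Id}\to\mathrm{Hom}_B(M,M\otimes_A-)$ and $\epsilon:M\otimes_A\mathrm{Hom}_B(M,-)\to\mathrm{Id}$ are the unit and counit of the adjoint pair $(M\otimes_A-,\mathrm{Hom}_B(M,-))$; $\delta':\mathrm{Id}\to\mathrm{Hom}_A(N,N\otimes_B-)$ and $\epsilon':N\otimes_B\mathrm{Hom}_A(N,-)\to\mathrm{Id}$ are the unit and counit of $(N\otimes_B-,\mathrm{Hom}_A(N,-))$. *)

theory Defs
  imports "HOL-Algebra.Free_Abelian_Groups" "HOL-Algebra.Module" "HOL-Algebra.RingHom"
    "HOL-Algebra.Generated_Groups"
begin

section \<open>Modules over noncommutative rings\<close>

text \<open>The library locale \<open>module\<close> requires a commutative ring of scalars. The record type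
  \<open>module\<close> and the locale \<open>submodule\<close> do not, and are reused here. The ring fields
  \<open>mult\<close> and \<open>one\<close> of a module record carry no information.\<close>

locale left_module = R?: ring R + M?: abelian_group M
  for R :: "('r, 'c) ring_scheme" (structure) and M :: "('r, 'x, 'd) module_scheme" (structure) +
  assumes smult_closed [simp, intro]:
      "\<lbrakk>a \<in> carrier R; x \<in> carrier M\<rbrakk> \<Longrightarrow> a \<odot>\<^bsub>M\<^esub> x \<in> carrier M"
    and smult_l_distr:
      "\<lbrakk>a \<in> carrier R; b \<in> carrier R; x \<in> carrier M\<rbrakk> \<Longrightarrow>
        (a \<oplus> b) \<odot>\<^bsub>M\<^esub> x = a \<odot>\<^bsub>M\<^esub> x \<oplus>\<^bsub>M\<^esub> b \<odot>\<^bsub>M\<^esub> x"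
    and smult_r_distr:
      "\<lbrakk>a \<in> carrier R; x \<in> carrier M; y \<in> carrier M\<rbrakk> \<Longrightarrow>
        a \<odot>\<^bsub>M\<^esub> (x \<oplus>\<^bsub>M\<^esub> y) = a \<odot>\<^bsub>M\<^esub> x \<oplus>\<^bsub>M\<^esub> a \<odot>\<^bsub>M\<^esub> y"
    and smult_assoc1:
      "\<lbrakk>a \<in> carrier R; b \<in> carrier R; x \<in> carrier M\<rbrakk> \<Longrightarrow>
        (a \<otimes> b) \<odot>\<^bsub>M\<^esub> x = a \<odot>\<^bsub>M\<^esub> (b \<odot>\<^bsub>M\<^esub> x)"
    and smult_one [simp]: "x \<in> carrier M \<Longrightarrow> \<one> \<odot>\<^bsub>M\<^esub> x = x"

definition module_hom ::
  "('r, 'c) ring_scheme \<Rightarrow> ('r, 'x, 'd) module_scheme \<Rightarrow> ('r, 'y, 'e) module_scheme \<Rightarrow> ('x \<Rightarrow> 'y) set"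
  where "module_hom R X Y =
    {h. h \<in> carrier X \<rightarrow> carrier Y
      \<and> (\<forall>x\<in>carrier X. \<forall>y\<in>carrier X. h (x \<oplus>\<^bsub>X\<^esub> y) = h x \<oplus>\<^bsub>Y\<^esub> h y)
      \<and> (\<forall>r\<in>carrier R. \<forall>x\<in>carrier X. h (r \<odot>\<^bsub>X\<^esub> x) = r \<odot>\<^bsub>Y\<^esub> h x)}"

definition module_isomorphic ::
  "('r, 'c) ring_scheme \<Rightarrow> ('r, 'x, 'd) module_scheme \<Rightarrow> ('r, 'y, 'e) module_scheme \<Rightarrow> bool"
  where "module_isomorphic R X Y \<longleftrightarrow> (\<exists>h\<in>module_hom R X Y. bij_betw h (carrier X) (carrier Y))"

definition finitely_generated :: "('r, 'c) ring_scheme \<Rightarrow> ('r, 'x, 'd) module_scheme \<Rightarrow> bool"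
  where "finitely_generated R X \<longleftrightarrow>
    (\<exists>S. finite S \<and> S \<subseteq> carrier X \<and>
      (\<forall>x\<in>carrier X. \<exists>c\<in>S \<rightarrow> carrier R. x = finsum X (\<lambda>s. c s \<odot>\<^bsub>X\<^esub> s) S))"

definition fg_module :: "('r, 'c) ring_scheme \<Rightarrow> ('r, 'x, 'd) module_scheme \<Rightarrow> bool"
  where "fg_module R X \<longleftrightarrow> left_module R X \<and> finitely_generated R X"

definition indecomposable :: "('r, 'c) ring_scheme \<Rightarrow> ('r, 'x) module \<Rightarrow> bool"
  where "indecomposable R X \<longleftrightarrow> carrier X \<noteq> {\<zero>\<^bsub>X\<^esub>} \<and>
    (\<forall>U V. submodule U R X \<and> submodule V R X \<and> U <+>\<^bsub>X\<^esub> V = carrier X \<and> U \<inter> V = {\<zero>\<^bsub>X\<^esub>}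
      \<longrightarrow> U = {\<zero>\<^bsub>X\<^esub>} \<or> V = {\<zero>\<^bsub>X\<^esub>})"

text \<open>Injective object of the category of finitely generated left \<open>R\<close>-modules. A definition cannot
  quantify over types, so the test modules have carrier in the type \<open>(nat \<Rightarrow> 'r) set\<close>. This is
  no restriction: every finitely generated module is isomorphic to such a module
  (\<open>fg_module_model\<close> below), hence an injective module in this sense has the extension
  property for finitely generated modules over arbitrary types
  (\<open>injective_extension\<close> below).\<close>

definition injective :: "('r, 'c) ring_scheme \<Rightarrow> ('r, 'x, 'd) module_scheme \<Rightarrow> bool"
  where "injective R E \<longleftrightarrow>
    (\<forall>(U :: ('r, (nat \<Rightarrow> 'r) set) module) (V :: ('r, (nat \<Rightarrow> 'r) set) module) i f.
      fg_module R U \<and> fg_module R V \<and> i \<in> module_hom R U V \<and> inj_on i (carrier U)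
        \<and> f \<in> module_hom R U E
      \<longrightarrow> (\<exists>g\<in>module_hom R V E. \<forall>u\<in>carrier U. g (i u) = f u))"

lemma module_hom_finsum:
  assumes X: "left_module R X" and Y: "left_module R Y" and h: "h \<in> module_hom R X Y"
    and f: "f \<in> S \<rightarrow> carrier X" and S: "finite S"
  shows "h (finsum X f S) = finsum Y (\<lambda>s. h (f s)) S"
proof -
  interpret X: left_module R X by fact
  interpret Y: left_module R Y by fact
  have h': "\<And>x. x \<in> carrier X \<Longrightarrow> h x \<in> carrier Y"
    "\<And>x y. \<lbrakk>x \<in> carrier X; y \<in> carrier X\<rbrakk> \<Longrightarrow> h (x \<oplus>\<^bsub>X\<^esub> y) = h x \<oplus>\<^bsub>Y\<^esub> h y"
    using h by (auto simp: module_hom_def)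
  have h0: "h \<zero>\<^bsub>X\<^esub> = \<zero>\<^bsub>Y\<^esub>"
    using h'(2)[of "\<zero>\<^bsub>X\<^esub>" "\<zero>\<^bsub>X\<^esub>"] h'(1)[of "\<zero>\<^bsub>X\<^esub>"] by simp
  from S f show ?thesis
  proof (induction S)
    case empty
    then show ?case by (simp add: h0)
  next
    case (insert s S)
    then show ?case
      using h' by (simp add: Pi_def)
  qed
qed

lemma fg_module_transport:
  fixes R :: "('r, 'c) ring_scheme" and X :: "('r, 'x, 'd) module_scheme" and h :: "'x \<Rightarrow> 'u"
  assumes X: "fg_module R X" and h: "inj_on h (carrier X)"
  shows "\<exists>U :: ('r, 'u) module.
    fg_module R U \<and> h \<in> module_hom R X U \<and> bij_betw h (carrier X) (carrier U)"
proof -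
  interpret X: left_module R X using X by (simp add: fg_module_def)
  define k where "k = inv_into (carrier X) h"
  define U :: "('r, 'u) module" where "U =
    \<lparr>carrier = h ` carrier X, mult = undefined, one = undefined, zero = h \<zero>\<^bsub>X\<^esub>,
     add = (\<lambda>u v. h (k u \<oplus>\<^bsub>X\<^esub> k v)), smult = (\<lambda>r u. h (r \<odot>\<^bsub>X\<^esub> k u))\<rparr>"
  have kh: "k (h x) = x" if "x \<in> carrier X" for x
    using that h by (simp add: k_def)
  have "abelian_group U"
  proof (rule abelian_groupI)
    fix u assume "u \<in> carrier U"
    then obtain x where x: "x \<in> carrier X" "u = h x" by (auto simp: U_def)
    then show "\<exists>v\<in>carrier U. v \<oplus>\<^bsub>U\<^esub> u = \<zero>\<^bsub>U\<^esub>"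
      by (intro bexI[of _ "h (\<ominus>\<^bsub>X\<^esub> x)"]) (auto simp: U_def kh X.l_neg)
  qed (auto simp: U_def kh X.a_ac)
  then have U: "left_module R U"
    by (intro left_module.intro X.ring_axioms left_module_axioms.intro)
      (auto simp: U_def kh X.smult_l_distr X.smult_r_distr X.smult_assoc1)
  have hom: "h \<in> module_hom R X U" by (auto simp: module_hom_def U_def kh)
  obtain S where S: "finite S" "S \<subseteq> carrier X"
    and gen: "\<And>x. x \<in> carrier X \<Longrightarrow> \<exists>c\<in>S \<rightarrow> carrier R. x = finsum X (\<lambda>s. c s \<odot>\<^bsub>X\<^esub> s) S"
    using X by (auto simp: fg_module_def finitely_generated_def)
  interpret U: left_module R U by fact
  have "finitely_generated R U"
    unfolding finitely_generated_def
  proof (intro exI[of _ "h ` S"] conjI ballI)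
    show "finite (h ` S)" using S by simp
    show hS: "h ` S \<subseteq> carrier U" using S by (auto simp: U_def)
    fix u assume "u \<in> carrier U"
    then obtain x where x: "x \<in> carrier X" "u = h x" by (auto simp: U_def)
    obtain c where c: "c \<in> S \<rightarrow> carrier R" "x = finsum X (\<lambda>s. c s \<odot>\<^bsub>X\<^esub> s) S"
      using gen[OF x(1)] by blast
    have ck: "(\<lambda>t. c (k t)) \<in> h ` S \<rightarrow> carrier R" using c S kh by (auto simp: subset_iff Pi_def)
    have "u = finsum U (\<lambda>s. h (c s \<odot>\<^bsub>X\<^esub> s)) S"
      unfolding x c(2) using c S
      by (intro module_hom_finsum[OF X.left_module_axioms U hom]) auto
    also have "\<dots> = finsum U (\<lambda>s. c (k (h s)) \<odot>\<^bsub>U\<^esub> h s) S"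
      using c S by (intro U.finsum_cong') (auto simp: U_def kh subset_iff Pi_def)
    also have "\<dots> = finsum U (\<lambda>t. c (k t) \<odot>\<^bsub>U\<^esub> t) (h ` S)"
      using ck hS S h inj_on_subset[OF h S(2)] by (intro U.finsum_reindex[symmetric]) auto
    finally show "\<exists>c\<in>h ` S \<rightarrow> carrier R. u = finsum U (\<lambda>t. c t \<odot>\<^bsub>U\<^esub> t) (h ` S)"
      using ck by (intro bexI[of _ "\<lambda>t. c (k t)"]) simp_all
  qed
  moreover have "bij_betw h (carrier X) (carrier U)"
    using h by (simp add: bij_betw_def U_def)
  ultimately show ?thesis using U hom by (auto simp: fg_module_def)
qed

lemma fg_module_model:
  fixes R :: "('r, 'c) ring_scheme" and X :: "('r, 'x, 'd) module_scheme"
  assumes "fg_module R X"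
  shows "\<exists>(U :: ('r, (nat \<Rightarrow> 'r) set) module) h.
    fg_module R U \<and> h \<in> module_hom R X U \<and> bij_betw h (carrier X) (carrier U)"
proof -
  obtain S where S: "finite S" "S \<subseteq> carrier X"
    and gen: "\<And>x. x \<in> carrier X \<Longrightarrow> \<exists>c\<in>S \<rightarrow> carrier R. x = finsum X (\<lambda>s. c s \<odot>\<^bsub>X\<^esub> s) S"
    using assms by (auto simp: fg_module_def finitely_generated_def)
  interpret X: left_module R X using assms by (simp add: fg_module_def)
  obtain idx :: "'x \<Rightarrow> nat" where idx: "inj_on idx S"
    using finite_imp_inj_to_nat_seg[OF S(1)] by blast
  define h where "h x = {d. (\<lambda>t. d (idx t)) \<in> S \<rightarrow> carrier R
    \<and> x = finsum X (\<lambda>t. d (idx t) \<odot>\<^bsub>X\<^esub> t) S}" for x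
  have "\<exists>d. d \<in> h x" if x: "x \<in> carrier X" for x
  proof -
    obtain c where c: "c \<in> S \<rightarrow> carrier R" "x = finsum X (\<lambda>s. c s \<odot>\<^bsub>X\<^esub> s) S"
      using gen[OF x] by blast
    have "finsum X (\<lambda>s. c s \<odot>\<^bsub>X\<^esub> s) S
        = finsum X (\<lambda>t. (c \<circ> inv_into S idx) (idx t) \<odot>\<^bsub>X\<^esub> t) S"
      using c S idx by (intro X.finsum_cong') (auto simp: Pi_def subset_iff)
    then have "c \<circ> inv_into S idx \<in> h x" using c idx by (auto simp: h_def)
    then show ?thesis by blast
  qed
  then have "inj_on h (carrier X)"
    by (intro inj_onI) (metis (mono_tags, lifting) h_def mem_Collect_eq)
  from fg_module_transport[OF assms this] show ?thesis by blast
qed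

lemma module_hom_inverse:
  assumes X: "left_module R X" and h: "h \<in> module_hom R X Y" "bij_betw h (carrier X) (carrier Y)"
  shows "inv_into (carrier X) h \<in> module_hom R Y X"
proof -
  interpret X: left_module R X by fact
  let ?k = "inv_into (carrier X) h"
  have k: "?k y \<in> carrier X" "h (?k y) = y" if "y \<in> carrier Y" for y
    using that h(2) by (auto simp: bij_betw_def inv_into_into f_inv_into_f)
  have kh: "?k (h x) = x" if "x \<in> carrier X" for x
    using that h(2) by (simp add: bij_betw_def)
  show ?thesis
    unfolding module_hom_def
  proof (intro CollectI conjI ballI funcsetI)
    fix x y assume "x \<in> carrier Y" "y \<in> carrier Y"
    then show "?k (x \<oplus>\<^bsub>Y\<^esub> y) = ?k x \<oplus>\<^bsub>X\<^esub> ?k y"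
      using k[of x] k[of y] kh[of "?k x \<oplus>\<^bsub>X\<^esub> ?k y"] h(1) by (simp add: module_hom_def)
  next
    fix r y assume "r \<in> carrier R" "y \<in> carrier Y"
    then show "?k (r \<odot>\<^bsub>Y\<^esub> y) = r \<odot>\<^bsub>X\<^esub> ?k y"
      using k[of y] kh[of "r \<odot>\<^bsub>X\<^esub> ?k y"] h(1) by (simp add: module_hom_def)
  qed (use k in auto)
qed

lemma module_hom_comp:
  assumes "h \<in> module_hom R X Y" "k \<in> module_hom R Y Z"
  shows "k \<circ> h \<in> module_hom R X Z"
  using assms by (auto simp: module_hom_def Pi_def)

lemma injective_extension:
  fixes R :: "('r, 'c) ring_scheme" and E :: "('r, 'e, 'f) module_scheme"
    and U :: "('r, 'u, 'g) module_scheme" and V :: "('r, 'v, 'h) module_scheme"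
  assumes E: "injective R E" and U: "fg_module R U" and V: "fg_module R V"
    and i: "i \<in> module_hom R U V" "inj_on i (carrier U)" and f: "f \<in> module_hom R U E"
  shows "\<exists>g\<in>module_hom R V E. \<forall>u\<in>carrier U. g (i u) = f u"
proof -
  obtain U' :: "('r, (nat \<Rightarrow> 'r) set) module" and a
    where U': "fg_module R U'" "a \<in> module_hom R U U'" "bij_betw a (carrier U) (carrier U')"
    using fg_module_model[OF U] by blast
  obtain V' :: "('r, (nat \<Rightarrow> 'r) set) module" and b
    where V': "fg_module R V'" "b \<in> module_hom R V V'" "bij_betw b (carrier V) (carrier V')"
    using fg_module_model[OF V] by blast
  let ?a = "inv_into (carrier U) a"
  have a: "?a \<in> module_hom R U' U"
    using module_hom_inverse U U' by (auto simp: fg_module_def)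
  have ia: "inj_on ?a (carrier U')" "?a ` carrier U' \<subseteq> carrier U"
    using U'(3) bij_betw_inv_into[OF U'(3)] by (auto simp: bij_betw_def)
  have "i ` carrier U \<subseteq> carrier V" using i by (auto simp: module_hom_def)
  then have "(i \<circ> ?a) ` carrier U' \<subseteq> carrier V" using ia by auto
  then have "inj_on (b \<circ> (i \<circ> ?a)) (carrier U')"
    using ia i V'(3) by (intro comp_inj_on) (auto simp: bij_betw_def intro: inj_on_subset simp del: o_apply)
  then have "\<exists>g\<in>module_hom R V' E. \<forall>u\<in>carrier U'. g ((b \<circ> (i \<circ> ?a)) u) = (f \<circ> ?a) u"
    by (intro E[unfolded injective_def, rule_format, of U' V'] conjI U'(1) V'(1)
        module_hom_comp[OF module_hom_comp[OF a i(1)] V'(2)] module_hom_comp[OF a f])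
  then obtain g where g: "g \<in> module_hom R V' E" "\<And>u. u \<in> carrier U' \<Longrightarrow> g ((b \<circ> (i \<circ> ?a)) u) = (f \<circ> ?a) u"
    by blast
  have "(g \<circ> b) (i u) = f u" if "u \<in> carrier U" for u
    using g(2)[of "a u"] U'(3) that by (auto simp: bij_betw_def)
  then show ?thesis using module_hom_comp[OF V'(2) g(1)] by blast
qed

definition indecomposable_injective :: "('r, 'c) ring_scheme \<Rightarrow> ('r, 'x) module \<Rightarrow> bool"
  where "indecomposable_injective R X \<longleftrightarrow>
    fg_module R X \<and> injective R X \<and> indecomposable R X"

section \<open>Artin algebras\<close>

definition artinian_cring :: "('k, 'c) ring_scheme \<Rightarrow> bool"
  where "artinian_cring K \<longleftrightarrow> cring K \<and>
    (\<forall>J :: nat \<Rightarrow> 'k set. (\<forall>n. ideal (J n) K \<and> J (Suc n) \<subseteq> J n) \<longrightarrow> (\<exists>n. \<forall>m\<ge>n. J m = J n))"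

text \<open>\<open>\<eta>\<close> is the structure map of the \<open>K\<close>-algebra \<open>L\<close>.\<close>

definition artin_algebra ::
  "('k, 'c) ring_scheme \<Rightarrow> ('k \<Rightarrow> 'l) \<Rightarrow> ('l, 'd) ring_scheme \<Rightarrow> bool"
  where "artin_algebra K \<eta> L \<longleftrightarrow> artinian_cring K \<and> ring L \<and> \<eta> \<in> ring_hom K L \<and>
    (\<forall>k\<in>carrier K. \<forall>x\<in>carrier L. \<eta> k \<otimes>\<^bsub>L\<^esub> x = x \<otimes>\<^bsub>L\<^esub> \<eta> k) \<and>
    finitely_generated K
      \<lparr>carrier = carrier L, mult = mult L, one = one L, zero = zero L, add = add L,
       smult = (\<lambda>k x. \<eta> k \<otimes>\<^bsub>L\<^esub> x)\<rparr>"

section \<open>Bimodules\<close>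

record ('r, 's, 'p) bimodule = "('r, 'p) module" +
  rsmult :: "'p \<Rightarrow> 's \<Rightarrow> 'p"  (infixl \<open>\<boxdot>\<index>\<close> 70)

locale bimodule =
  fixes R :: "('r, 'c) ring_scheme" and S :: "('s, 'd) ring_scheme"
    and P :: "('r, 's, 'p) bimodule"
  assumes left_module: "left_module R P"
    and right_ring: "ring S"
    and rsmult_closed:
      "\<lbrakk>x \<in> carrier P; s \<in> carrier S\<rbrakk> \<Longrightarrow> x \<boxdot>\<^bsub>P\<^esub> s \<in> carrier P"
    and rsmult_r_distr:
      "\<lbrakk>x \<in> carrier P; s \<in> carrier S; t \<in> carrier S\<rbrakk> \<Longrightarrow>
        x \<boxdot>\<^bsub>P\<^esub> (s \<oplus>\<^bsub>S\<^esub> t) = x \<boxdot>\<^bsub>P\<^esub> s \<oplus>\<^bsub>P\<^esub> x \<boxdot>\<^bsub>P\<^esub> t"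
    and rsmult_l_distr:
      "\<lbrakk>x \<in> carrier P; y \<in> carrier P; s \<in> carrier S\<rbrakk> \<Longrightarrow>
        (x \<oplus>\<^bsub>P\<^esub> y) \<boxdot>\<^bsub>P\<^esub> s = x \<boxdot>\<^bsub>P\<^esub> s \<oplus>\<^bsub>P\<^esub> y \<boxdot>\<^bsub>P\<^esub> s"
    and rsmult_assoc:
      "\<lbrakk>x \<in> carrier P; s \<in> carrier S; t \<in> carrier S\<rbrakk> \<Longrightarrow>
        x \<boxdot>\<^bsub>P\<^esub> (s \<otimes>\<^bsub>S\<^esub> t) = (x \<boxdot>\<^bsub>P\<^esub> s) \<boxdot>\<^bsub>P\<^esub> t"
    and rsmult_one: "x \<in> carrier P \<Longrightarrow> x \<boxdot>\<^bsub>P\<^esub> \<one>\<^bsub>S\<^esub> = x"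
    and smult_rsmult:
      "\<lbrakk>r \<in> carrier R; x \<in> carrier P; s \<in> carrier S\<rbrakk> \<Longrightarrow>
        (r \<odot>\<^bsub>P\<^esub> x) \<boxdot>\<^bsub>P\<^esub> s = r \<odot>\<^bsub>P\<^esub> (x \<boxdot>\<^bsub>P\<^esub> s)"

definition regular_bimodule :: "'r ring \<Rightarrow> ('r, 'r, 'r) bimodule"
  where "regular_bimodule R =
    \<lparr>carrier = carrier R, mult = mult R, one = one R, zero = zero R, add = add R,
     smult = mult R, rsmult = mult R\<rparr>"

definition bimodule_hom ::
  "('r, 'c) ring_scheme \<Rightarrow> ('s, 'd) ring_scheme \<Rightarrow> ('r, 's, 'p) bimodule \<Rightarrow> ('r, 's, 'q) bimodule
    \<Rightarrow> ('p \<Rightarrow> 'q) set"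
  where "bimodule_hom R S P Q =
    {h \<in> module_hom R P Q. \<forall>x\<in>carrier P. \<forall>s\<in>carrier S. h (x \<boxdot>\<^bsub>P\<^esub> s) = h x \<boxdot>\<^bsub>Q\<^esub> s}"

section \<open>Tensor products\<close>

text \<open>\<open>P \<otimes>\<^sub>S X\<close> for a right \<open>S\<close>-module \<open>P\<close> and a left \<open>S\<close>-module \<open>X\<close> is the
  quotient of the free abelian group on \<open>P \<times> X\<close> by the subgroup generated by
  the relations of a balanced map.\<close>

definition tensor_relations ::
  "('s, 'c) ring_scheme \<Rightarrow> ('r, 's, 'p) bimodule \<Rightarrow> ('s, 'x, 'e) module_scheme
    \<Rightarrow> (('p \<times> 'x) \<Rightarrow>\<^sub>0 int) set"
  where "tensor_relations S P X =
    {frag_of (p \<oplus>\<^bsub>P\<^esub> q, x) - frag_of (p, x) - frag_of (q, x) | p q x.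
       p \<in> carrier P \<and> q \<in> carrier P \<and> x \<in> carrier X} \<union>
    {frag_of (p, x \<oplus>\<^bsub>X\<^esub> y) - frag_of (p, x) - frag_of (p, y) | p x y.
       p \<in> carrier P \<and> x \<in> carrier X \<and> y \<in> carrier X} \<union>
    {frag_of (p \<boxdot>\<^bsub>P\<^esub> s, x) - frag_of (p, s \<odot>\<^bsub>X\<^esub> x) | p s x.
       p \<in> carrier P \<and> s \<in> carrier S \<and> x \<in> carrier X}"

abbreviation tensor_free ::
  "('r, 's, 'p) bimodule \<Rightarrow> ('s, 'x, 'e) module_scheme \<Rightarrow> (('p \<times> 'x) \<Rightarrow>\<^sub>0 int) monoid"
  where "tensor_free P X \<equiv> free_Abelian_group (carrier P \<times> carrier X)"

definition tensor_subgroup ::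
  "('s, 'c) ring_scheme \<Rightarrow> ('r, 's, 'p) bimodule \<Rightarrow> ('s, 'x, 'e) module_scheme
    \<Rightarrow> (('p \<times> 'x) \<Rightarrow>\<^sub>0 int) set"
  where "tensor_subgroup S P X = generate (tensor_free P X) (tensor_relations S P X)"

definition tensor_elem ::
  "('s, 'c) ring_scheme \<Rightarrow> ('r, 's, 'p) bimodule \<Rightarrow> ('s, 'x, 'e) module_scheme \<Rightarrow> 'p \<Rightarrow> 'x
    \<Rightarrow> (('p \<times> 'x) \<Rightarrow>\<^sub>0 int) set"
  where "tensor_elem S P X p x = tensor_subgroup S P X #>\<^bsub>tensor_free P X\<^esub> frag_of (p, x)"

text \<open>The endomorphism of \<open>P \<otimes>\<^sub>S X\<close> induced by a map of the generators \<open>(p, x)\<close>. The image of a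
  coset is contained in a single coset, which is recovered by adding the subgroup.\<close>

definition tensor_map ::
  "('s, 'c) ring_scheme \<Rightarrow> ('r, 's, 'p) bimodule \<Rightarrow> ('s, 'x, 'e) module_scheme
    \<Rightarrow> ('p \<times> 'x \<Rightarrow> 'p \<times> 'x)
    \<Rightarrow> (('p \<times> 'x) \<Rightarrow>\<^sub>0 int) set \<Rightarrow> (('p \<times> 'x) \<Rightarrow>\<^sub>0 int) set"
  where "tensor_map S P X \<alpha> T =
    tensor_subgroup S P X <#>\<^bsub>tensor_free P X\<^esub> (frag_extend (frag_of \<circ> \<alpha>) ` T)"

definition tensor ::
  "('s, 'c) ring_scheme \<Rightarrow> ('r, 's, 'p) bimodule \<Rightarrow> ('s, 'x, 'e) module_scheme
    \<Rightarrow> ('r, (('p \<times> 'x) \<Rightarrow>\<^sub>0 int) set) module"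
  where "tensor S P X =
    (let Q = tensor_free P X Mod tensor_subgroup S P X in
     \<lparr>carrier = carrier Q, mult = undefined, one = undefined,
      zero = one Q, add = mult Q,
      smult = (\<lambda>r. tensor_map S P X (\<lambda>(p, x). (r \<odot>\<^bsub>P\<^esub> p, x)))\<rparr>)"

definition bitensor ::
  "('s, 'c) ring_scheme \<Rightarrow> ('r, 's, 'p) bimodule \<Rightarrow> ('s, 't, 'q) bimodule
    \<Rightarrow> ('r, 't, (('p \<times> 'q) \<Rightarrow>\<^sub>0 int) set) bimodule"
  where "bitensor S P Q =
    module.extend (tensor S P Q)
      (bimodule.fields (\<lambda>T t. tensor_map S P Q (\<lambda>(p, q). (p, q \<boxdot>\<^bsub>Q\<^esub> t)) T))"

text \<open>The homomorphism \<open>P \<otimes>\<^sub>S X \<rightarrow> W\<close> with \<open>p \<otimes> x \<mapsto> \<beta> (p, x)\<close> induced by a balanced map \<open>\<beta>\<close>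
  (\<open>tensor_lift_elem\<close> below): all representatives of the coset \<open>T\<close> have the same value.\<close>

definition frag_eval :: "('w, 'e) ring_scheme \<Rightarrow> ('g \<Rightarrow> 'w) \<Rightarrow> ('g \<Rightarrow>\<^sub>0 int) \<Rightarrow> 'w"
  where "frag_eval W \<beta> c =
    finsum W (\<lambda>g. [Poly_Mapping.lookup c g] \<cdot>\<^bsub>W\<^esub> \<beta> g) (Poly_Mapping.keys c)"

definition tensor_lift ::
  "('w, 'e) ring_scheme \<Rightarrow> ('p \<times> 'x \<Rightarrow> 'w) \<Rightarrow> (('p \<times> 'x) \<Rightarrow>\<^sub>0 int) set \<Rightarrow> 'w"
  where "tensor_lift W \<beta> T = the_elem (frag_eval W \<beta> ` T)"

definition balanced ::
  "('s, 'c) ring_scheme \<Rightarrow> ('r, 's, 'p) bimodule \<Rightarrow> ('s, 'x, 'd) module_scheme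
    \<Rightarrow> ('w, 'e) ring_scheme \<Rightarrow> ('p \<times> 'x \<Rightarrow> 'w) \<Rightarrow> bool"
  where "balanced S P X W \<beta> \<longleftrightarrow>
    \<beta> \<in> carrier P \<times> carrier X \<rightarrow> carrier W \<and>
    (\<forall>p\<in>carrier P. \<forall>q\<in>carrier P. \<forall>x\<in>carrier X. \<beta> (p \<oplus>\<^bsub>P\<^esub> q, x) = \<beta> (p, x) \<oplus>\<^bsub>W\<^esub> \<beta> (q, x)) \<and>
    (\<forall>p\<in>carrier P. \<forall>x\<in>carrier X. \<forall>y\<in>carrier X. \<beta> (p, x \<oplus>\<^bsub>X\<^esub> y) = \<beta> (p, x) \<oplus>\<^bsub>W\<^esub> \<beta> (p, y)) \<and>
    (\<forall>p\<in>carrier P. \<forall>s\<in>carrier S. \<forall>x\<in>carrier X. \<beta> (p \<boxdot>\<^bsub>P\<^esub> s, x) = \<beta> (p, s \<odot>\<^bsub>X\<^esub> x))"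

lemma frag_eval_superset:
  assumes W: "abelian_group W" and \<beta>: "\<beta> \<in> S \<rightarrow> carrier W"
    and T: "finite T" "Poly_Mapping.keys c \<subseteq> T" "T \<subseteq> S"
  shows "frag_eval W \<beta> c = finsum W (\<lambda>g. [Poly_Mapping.lookup c g] \<cdot>\<^bsub>W\<^esub> \<beta> g) T"
proof -
  interpret abelian_group W by fact
  have closed: "[k] \<cdot>\<^bsub>W\<^esub> \<beta> g \<in> carrier W" if "g \<in> T" for g and k :: int
    using that \<beta> T(3) by (intro add.int_pow_closed) auto
  show ?thesis
    unfolding frag_eval_def
  proof (rule add.finprod_mono_neutral_cong_left)
    show "\<And>g. g \<in> T - Poly_Mapping.keys c \<Longrightarrow> [Poly_Mapping.lookup c g] \<cdot>\<^bsub>W\<^esub> \<beta> g = \<zero>\<^bsub>W\<^esub>"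
      by (simp add: in_keys_iff add_pow_def)
  qed (use T closed in auto)
qed

lemma frag_eval_hom:
  assumes W: "abelian_group W" and \<beta>: "\<beta> \<in> S \<rightarrow> carrier W"
  shows "frag_eval W \<beta> \<in> hom (free_Abelian_group S) (add_monoid W)"
proof (rule homI)
  interpret abelian_group W by fact
  fix c assume c: "c \<in> carrier (free_Abelian_group S)"
  have closed: "[k] \<cdot>\<^bsub>W\<^esub> \<beta> g \<in> carrier W" if "g \<in> S" for g and k :: int
    using that \<beta> by (intro add.int_pow_closed) auto
  show "frag_eval W \<beta> c \<in> carrier (add_monoid W)"
    unfolding frag_eval_def using c closed by (auto intro!: finsum_closed)
  fix d assume d: "d \<in> carrier (free_Abelian_group S)"
  let ?T = "Poly_Mapping.keys c \<union> Poly_Mapping.keys d"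
  have T: "finite ?T" "?T \<subseteq> S" using c d by auto
  have "frag_eval W \<beta> (c + d) = finsum W (\<lambda>g. [Poly_Mapping.lookup (c + d) g] \<cdot>\<^bsub>W\<^esub> \<beta> g) ?T"
    by (rule frag_eval_superset[OF W \<beta>]) (use T keys_add[of c d] in auto)
  also have "\<dots> = finsum W (\<lambda>g. [Poly_Mapping.lookup c g] \<cdot>\<^bsub>W\<^esub> \<beta> g
      \<oplus>\<^bsub>W\<^esub> [Poly_Mapping.lookup d g] \<cdot>\<^bsub>W\<^esub> \<beta> g) ?T"
  proof (rule finsum_cong')
    fix g assume "g \<in> ?T"
    then have "\<beta> g \<in> carrier W" using \<beta> T by auto
    then show "[Poly_Mapping.lookup (c + d) g] \<cdot>\<^bsub>W\<^esub> \<beta> g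
      = [Poly_Mapping.lookup c g] \<cdot>\<^bsub>W\<^esub> \<beta> g \<oplus>\<^bsub>W\<^esub> [Poly_Mapping.lookup d g] \<cdot>\<^bsub>W\<^esub> \<beta> g"
      using add.int_pow_mult by (simp add: Poly_Mapping.lookup_add)
  qed (use T closed in auto)
  also have "\<dots> = finsum W (\<lambda>g. [Poly_Mapping.lookup c g] \<cdot>\<^bsub>W\<^esub> \<beta> g) ?T
      \<oplus>\<^bsub>W\<^esub> finsum W (\<lambda>g. [Poly_Mapping.lookup d g] \<cdot>\<^bsub>W\<^esub> \<beta> g) ?T"
    by (rule finsum_addf) (use T closed in auto)
  also have "\<dots> = frag_eval W \<beta> c \<oplus>\<^bsub>W\<^esub> frag_eval W \<beta> d"
    using frag_eval_superset[OF W \<beta> T(1), of c] frag_eval_superset[OF W \<beta> T(1), of d] T(2) by simp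
  finally show "frag_eval W \<beta> (c \<otimes>\<^bsub>free_Abelian_group S\<^esub> d)
      = frag_eval W \<beta> c \<otimes>\<^bsub>add_monoid W\<^esub> frag_eval W \<beta> d" by simp
qed

lemma frag_eval_of:
  assumes "abelian_group W" "\<beta> g \<in> carrier W"
  shows "frag_eval W \<beta> (frag_of g) = \<beta> g"
proof -
  interpret abelian_group W by fact
  show ?thesis
    using assms(2) add.finprod_singleton[of g "{g}" "\<lambda>g. [(1 :: int)] \<cdot>\<^bsub>W\<^esub> \<beta> g"]
    by (simp add: frag_eval_def add.int_pow_1)
qed

lemma tensor_relations_carrier:
  assumes "bimodule R S P" "left_module S X"
  shows "tensor_relations S P X \<subseteq> carrier (tensor_free P X)"
proof -
  interpret X: left_module S X by fact
  interpret P: left_module R P using assms(1) by (rule bimodule.left_module)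
  have *: "a - b \<in> carrier (tensor_free P X)"
    if "a \<in> carrier (tensor_free P X)" "b \<in> carrier (tensor_free P X)" for a b
    using that keys_diff[of a b] by auto
  have "frag_of (p, x) \<in> carrier (tensor_free P X)" if "p \<in> carrier P" "x \<in> carrier X" for p x
    using that by simp
  then show ?thesis
    unfolding tensor_relations_def using bimodule.rsmult_closed[OF assms(1)]
    by (auto simp del: carrier_free_Abelian_group_iff intro!: *)
qed

lemma tensor_subgroup_subgroup:
  assumes "bimodule R S P" "left_module S X"
  shows "subgroup (tensor_subgroup S P X) (tensor_free P X)"
  unfolding tensor_subgroup_def
  by (rule group.generate_is_subgroup[OF group_free_Abelian_group tensor_relations_carrier[OF assms]])

lemma frag_eval_tensor_subgroup:
  assumes P: "bimodule R S P" and X: "left_module S X" and W: "abelian_group W"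
    and \<beta>: "balanced S P X W \<beta>" and c: "c \<in> tensor_subgroup S P X"
  shows "frag_eval W \<beta> c = \<zero>\<^bsub>W\<^esub>"
proof -
  interpret X: left_module S X by fact
  interpret P: left_module R P using P by (rule bimodule.left_module)
  interpret W: abelian_group W by fact
  let ?F = "tensor_free P X"
  have \<beta>': "\<beta> \<in> carrier P \<times> carrier X \<rightarrow> carrier W" using \<beta> by (simp add: balanced_def)
  interpret h: group_hom ?F "add_monoid W" "frag_eval W \<beta>"
    by (simp add: group_hom_def group_hom_axioms_def frag_eval_hom[OF W \<beta>'] W.a_group)
  have ev: "frag_eval W \<beta> (frag_of (p, x)) = \<beta> (p, x)" "\<beta> (p, x) \<in> carrier W"
    if "p \<in> carrier P" "x \<in> carrier X" for p x
    using that \<beta>' by (auto intro: frag_eval_of[OF W])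
  have minus: "frag_eval W \<beta> (a - b) = frag_eval W \<beta> a \<ominus>\<^bsub>W\<^esub> frag_eval W \<beta> b"
    if "a \<in> carrier ?F" "b \<in> carrier ?F" for a b
  proof -
    have ab: "a - b = a \<otimes>\<^bsub>?F\<^esub> inv\<^bsub>?F\<^esub> b" using that by simp
    have "frag_eval W \<beta> (a \<otimes>\<^bsub>?F\<^esub> inv\<^bsub>?F\<^esub> b)
        = frag_eval W \<beta> a \<otimes>\<^bsub>add_monoid W\<^esub> inv\<^bsub>add_monoid W\<^esub> frag_eval W \<beta> b"
      using h.hom_mult[OF that(1) group.inv_closed[OF group_free_Abelian_group that(2)]]
      by (simp only: h.hom_inv[OF that(2)])
    then show ?thesis unfolding ab a_minus_def a_inv_def by simp
  qed
  have fr: "frag_of (p, x) \<in> carrier ?F" if "p \<in> carrier P" "x \<in> carrier X" for p x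
    using that by simp
  have fd: "a - b \<in> carrier ?F" if "a \<in> carrier ?F" "b \<in> carrier ?F" for a b
    using that keys_diff[of a b] by auto
  have cancel: "u \<oplus>\<^bsub>W\<^esub> v \<ominus>\<^bsub>W\<^esub> u \<ominus>\<^bsub>W\<^esub> v = \<zero>\<^bsub>W\<^esub>" if "u \<in> carrier W" "v \<in> carrier W" for u v
  proof -
    have "u \<oplus>\<^bsub>W\<^esub> v \<ominus>\<^bsub>W\<^esub> u \<ominus>\<^bsub>W\<^esub> v = (u \<oplus>\<^bsub>W\<^esub> v) \<oplus>\<^bsub>W\<^esub> (\<ominus>\<^bsub>W\<^esub> u \<oplus>\<^bsub>W\<^esub> \<ominus>\<^bsub>W\<^esub> v)"
      using that by (simp only: a_minus_def W.a_assoc W.a_closed W.a_inv_closed)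
    also have "\<dots> = \<zero>\<^bsub>W\<^esub>"
      using that by (simp only: W.minus_add[symmetric] W.r_neg W.a_closed)
    finally show ?thesis .
  qed
  have "tensor_relations S P X \<subseteq> kernel ?F (add_monoid W) (frag_eval W \<beta>)"
  proof
    fix r assume r: "r \<in> tensor_relations S P X"
    then have rF: "r \<in> carrier ?F" using tensor_relations_carrier[OF P X] by blast
    from r have "frag_eval W \<beta> r = \<zero>\<^bsub>W\<^esub>"
      unfolding tensor_relations_def
    proof (elim UnE CollectE exE conjE)
      fix p q x assume "r = frag_of (p \<oplus>\<^bsub>P\<^esub> q, x) - frag_of (p, x) - frag_of (q, x)"
        "p \<in> carrier P" "q \<in> carrier P" "x \<in> carrier X"
      then show ?thesis
        using \<beta> ev cancel by (simp add: minus fr fd balanced_def del: carrier_free_Abelian_group_iff)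
    next
      fix p x y assume "r = frag_of (p, x \<oplus>\<^bsub>X\<^esub> y) - frag_of (p, x) - frag_of (p, y)"
        "p \<in> carrier P" "x \<in> carrier X" "y \<in> carrier X"
      then show ?thesis
        using \<beta> ev cancel by (simp add: minus fr fd balanced_def del: carrier_free_Abelian_group_iff)
    next
      fix p s x assume "r = frag_of (p \<boxdot>\<^bsub>P\<^esub> s, x) - frag_of (p, s \<odot>\<^bsub>X\<^esub> x)"
        "p \<in> carrier P" "s \<in> carrier S" "x \<in> carrier X"
      then show ?thesis
        using \<beta> ev bimodule.rsmult_closed[OF P]
        by (simp add: minus fr balanced_def a_minus_def W.r_neg del: carrier_free_Abelian_group_iff)
    qed
    then show "r \<in> kernel ?F (add_monoid W) (frag_eval W \<beta>)"
      using rF by (simp add: kernel_def)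
  qed
  then have "tensor_subgroup S P X \<subseteq> kernel ?F (add_monoid W) (frag_eval W \<beta>)"
    unfolding tensor_subgroup_def by (rule h.generate_subgroup_incl[OF _ h.subgroup_kernel])
  then show ?thesis using c by (auto simp: kernel_def)
qed

lemma tensor_lift_coset:
  assumes P: "bimodule R S P" and X: "left_module S X" and W: "abelian_group W"
    and \<beta>: "balanced S P X W \<beta>" and c: "c \<in> carrier (tensor_free P X)"
  shows "tensor_lift W \<beta> (tensor_subgroup S P X #>\<^bsub>tensor_free P X\<^esub> c) = frag_eval W \<beta> c"
proof -
  interpret W: abelian_group W by fact
  let ?F = "tensor_free P X" and ?K = "tensor_subgroup S P X"
  have \<beta>': "\<beta> \<in> carrier P \<times> carrier X \<rightarrow> carrier W" using \<beta> by (simp add: balanced_def)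
  note hom = frag_eval_hom[OF W \<beta>']
  have K: "subgroup ?K ?F" by (rule tensor_subgroup_subgroup[OF P X])
  have "frag_eval W \<beta> (k \<otimes>\<^bsub>?F\<^esub> c) = frag_eval W \<beta> c" if "k \<in> ?K" for k
    using that hom_mult[OF hom subgroup.mem_carrier[OF K that] c] hom_in_carrier[OF hom c]
    by (simp add: frag_eval_tensor_subgroup[OF P X W \<beta>])
  moreover have "?K \<noteq> {}" using subgroup.one_closed[OF K] by blast
  ultimately have "frag_eval W \<beta> ` (?K #>\<^bsub>?F\<^esub> c) = {frag_eval W \<beta> c}"
    unfolding r_coset_def by (auto simp: image_UN)
  then show ?thesis by (simp add: tensor_lift_def)
qed

lemma tensor_lift_elem:
  assumes "bimodule R S P" "left_module S X" "abelian_group W" "balanced S P X W \<beta>"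
    and "p \<in> carrier P" "x \<in> carrier X"
  shows "tensor_lift W \<beta> (tensor_elem S P X p x) = \<beta> (p, x)"
proof -
  have "\<beta> (p, x) \<in> carrier W" using assms(4-6) by (auto simp: balanced_def)
  then show ?thesis
    unfolding tensor_elem_def using assms
    by (subst tensor_lift_coset) (auto intro: frag_eval_of)
qed

lemma tensor_lift_add:
  assumes P: "bimodule R S P" and X: "left_module S X" and W: "abelian_group W"
    and \<beta>: "balanced S P X W \<beta>"
    and T: "T \<in> carrier (tensor S P X)" and U: "U \<in> carrier (tensor S P X)"
  shows "tensor_lift W \<beta> T \<in> carrier W"
    and "tensor_lift W \<beta> (T \<oplus>\<^bsub>tensor S P X\<^esub> U) = tensor_lift W \<beta> T \<oplus>\<^bsub>W\<^esub> tensor_lift W \<beta> U"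
proof -
  let ?F = "tensor_free P X" and ?K = "tensor_subgroup S P X"
  have \<beta>': "\<beta> \<in> carrier P \<times> carrier X \<rightarrow> carrier W" using \<beta> by (simp add: balanced_def)
  note hom = frag_eval_hom[OF W \<beta>']
  interpret F: comm_group ?F by (rule abelian_free_Abelian_group)
  have K: "normal ?K ?F"
    by (rule F.subgroup_imp_normal[OF tensor_subgroup_subgroup[OF P X]])
  obtain c d where c: "c \<in> carrier ?F" "T = ?K #>\<^bsub>?F\<^esub> c" and d: "d \<in> carrier ?F" "U = ?K #>\<^bsub>?F\<^esub> d"
    using T U by (auto simp: tensor_def Let_def FactGroup_def RCOSETS_def simp del: carrier_free_Abelian_group_iff)
  show "tensor_lift W \<beta> T \<in> carrier W"
    unfolding c(2) tensor_lift_coset[OF P X W \<beta> c(1)] using hom_in_carrier[OF hom c(1)] by simp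
  have "T \<oplus>\<^bsub>tensor S P X\<^esub> U = ?K #>\<^bsub>?F\<^esub> (c \<otimes>\<^bsub>?F\<^esub> d)"
    using normal.rcos_sum[OF K c(1) d(1)] by (simp add: tensor_def Let_def FactGroup_def c d)
  then show "tensor_lift W \<beta> (T \<oplus>\<^bsub>tensor S P X\<^esub> U) = tensor_lift W \<beta> T \<oplus>\<^bsub>W\<^esub> tensor_lift W \<beta> U"
    using hom_mult[OF hom c(1) d(1)] F.m_closed[OF c(1) d(1)] c d
    by (simp add: tensor_lift_coset[OF P X W \<beta>] del: mult_free_Abelian_group carrier_free_Abelian_group_iff)
qed

section \<open>Hom modules and the tensor-hom adjunction\<close>

text \<open>\<open>Hom\<^sub>R(P, W)\<close> for an \<open>R\<close>-\<open>S\<close>-bimodule \<open>P\<close> is a left \<open>S\<close>-module by \<open>(s h)(p) = h (p s)\<close>.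
  Homomorphisms are taken extensional, so that equality of functions is equality on \<open>P\<close>.\<close>

definition hom_module ::
  "('r, 'c) ring_scheme \<Rightarrow> ('r, 's, 'p) bimodule \<Rightarrow> ('r, 'w, 'e) module_scheme
    \<Rightarrow> ('s, 'p \<Rightarrow> 'w) module"
  where "hom_module R P W =
    \<lparr>carrier = module_hom R P W \<inter> extensional (carrier P),
     mult = undefined, one = undefined,
     zero = (\<lambda>p\<in>carrier P. \<zero>\<^bsub>W\<^esub>),
     add = (\<lambda>h k. \<lambda>p\<in>carrier P. h p \<oplus>\<^bsub>W\<^esub> k p),
     smult = (\<lambda>s h. \<lambda>p\<in>carrier P. h (p \<boxdot>\<^bsub>P\<^esub> s))\<rparr>"

text \<open>The unit \<open>Z \<rightarrow> Hom\<^sub>R(P, P \<otimes>\<^sub>S Z)\<close> and the counit \<open>P \<otimes>\<^sub>S Hom\<^sub>R(P, W) \<rightarrow> W\<close> of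
  \<open>(P \<otimes>\<^sub>S -, Hom\<^sub>R(P, -))\<close>, for an \<open>R\<close>-\<open>S\<close>-bimodule \<open>P\<close>.\<close>

definition adj_unit ::
  "('s, 'd) ring_scheme \<Rightarrow> ('r, 's, 'p) bimodule \<Rightarrow> ('s, 'z, 'e) module_scheme
    \<Rightarrow> 'z \<Rightarrow> 'p \<Rightarrow> (('p \<times> 'z) \<Rightarrow>\<^sub>0 int) set"
  where "adj_unit S P Z z = (\<lambda>p\<in>carrier P. tensor_elem S P Z p z)"

definition adj_counit ::
  "('r, 'w, 'e) module_scheme \<Rightarrow> (('p \<times> ('p \<Rightarrow> 'w)) \<Rightarrow>\<^sub>0 int) set \<Rightarrow> 'w"
  where "adj_counit W = tensor_lift W (\<lambda>(p, h). h p)"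

section \<open>Morita rings\<close>

locale morita_context =
  fixes A :: "'a ring" and B :: "'b ring"
    and N :: "('a, 'b, 'n) bimodule" and M :: "('b, 'a, 'm) bimodule"
    and \<phi> :: "(('m \<times> 'n) \<Rightarrow>\<^sub>0 int) set \<Rightarrow> 'b" and \<psi> :: "(('n \<times> 'm) \<Rightarrow>\<^sub>0 int) set \<Rightarrow> 'a"
  assumes bimodule_N: "bimodule A B N"
    and bimodule_M: "bimodule B A M"
    and phi_hom: "\<phi> \<in> bimodule_hom B B (bitensor A M N) (regular_bimodule B)"
    and psi_hom: "\<psi> \<in> bimodule_hom A A (bitensor B N M) (regular_bimodule A)"
    and phi_psi: "\<lbrakk>m \<in> carrier M; n \<in> carrier N; m' \<in> carrier M\<rbrakk> \<Longrightarrow>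
      \<phi> (tensor_elem A M N m n) \<odot>\<^bsub>M\<^esub> m' = m \<boxdot>\<^bsub>M\<^esub> \<psi> (tensor_elem B N M n m')"
    and psi_phi: "\<lbrakk>n \<in> carrier N; m \<in> carrier M; n' \<in> carrier N\<rbrakk> \<Longrightarrow>
      n \<boxdot>\<^bsub>N\<^esub> \<phi> (tensor_elem A M N m n') = \<psi> (tensor_elem B N M n m) \<odot>\<^bsub>N\<^esub> n'"

text \<open>The matrix with rows \<open>(a, n)\<close> and \<open>(m, b)\<close> is encoded as \<open>(a, n, m, b)\<close>.\<close>

definition morita_ring ::
  "'a ring \<Rightarrow> 'b ring \<Rightarrow> ('a, 'b, 'n) bimodule \<Rightarrow> ('b, 'a, 'm) bimodule
    \<Rightarrow> ((('m \<times> 'n) \<Rightarrow>\<^sub>0 int) set \<Rightarrow> 'b) \<Rightarrow> ((('n \<times> 'm) \<Rightarrow>\<^sub>0 int) set \<Rightarrow> 'a)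
    \<Rightarrow> ('a \<times> 'n \<times> 'm \<times> 'b) ring"
  where "morita_ring A B N M \<phi> \<psi> =
    \<lparr>carrier = carrier A \<times> carrier N \<times> carrier M \<times> carrier B,
     mult = (\<lambda>(a, n, m, b) (a', n', m', b').
       (a \<otimes>\<^bsub>A\<^esub> a' \<oplus>\<^bsub>A\<^esub> \<psi> (tensor_elem B N M n m'),
        a \<odot>\<^bsub>N\<^esub> n' \<oplus>\<^bsub>N\<^esub> n \<boxdot>\<^bsub>N\<^esub> b',
        m \<boxdot>\<^bsub>M\<^esub> a' \<oplus>\<^bsub>M\<^esub> b \<odot>\<^bsub>M\<^esub> m',
        b \<otimes>\<^bsub>B\<^esub> b' \<oplus>\<^bsub>B\<^esub> \<phi> (tensor_elem A M N m n'))),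
     one = (\<one>\<^bsub>A\<^esub>, \<zero>\<^bsub>N\<^esub>, \<zero>\<^bsub>M\<^esub>, \<one>\<^bsub>B\<^esub>),
     zero = (\<zero>\<^bsub>A\<^esub>, \<zero>\<^bsub>N\<^esub>, \<zero>\<^bsub>M\<^esub>, \<zero>\<^bsub>B\<^esub>),
     add = (\<lambda>(a, n, m, b) (a', n', m', b').
       (a \<oplus>\<^bsub>A\<^esub> a', n \<oplus>\<^bsub>N\<^esub> n', m \<oplus>\<^bsub>M\<^esub> m', b \<oplus>\<^bsub>B\<^esub> b'))\<rparr>"

section \<open>Modules over Morita rings as tuples\<close>

type_synonym ('a, 'b, 'n, 'm, 'x, 'y) morita_tuple =
  "('a, 'x) module \<times> ('b, 'y) module \<times>
   ((('m \<times> 'x) \<Rightarrow>\<^sub>0 int) set \<Rightarrow> 'y) \<times> ((('n \<times> 'y) \<Rightarrow>\<^sub>0 int) set \<Rightarrow> 'x)"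

definition is_morita_tuple ::
  "'a ring \<Rightarrow> 'b ring \<Rightarrow> ('a, 'b, 'n) bimodule \<Rightarrow> ('b, 'a, 'm) bimodule
    \<Rightarrow> ((('m \<times> 'n) \<Rightarrow>\<^sub>0 int) set \<Rightarrow> 'b) \<Rightarrow> ((('n \<times> 'm) \<Rightarrow>\<^sub>0 int) set \<Rightarrow> 'a)
    \<Rightarrow> ('a, 'b, 'n, 'm, 'x, 'y) morita_tuple \<Rightarrow> bool"
  where "is_morita_tuple A B N M \<phi> \<psi> = (\<lambda>(X, Y, f, g).
    fg_module A X \<and> fg_module B Y \<and>
    f \<in> module_hom B (tensor A M X) Y \<and> g \<in> module_hom A (tensor B N Y) X \<and>
    (\<forall>n\<in>carrier N. \<forall>m\<in>carrier M. \<forall>x\<in>carrier X.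
      g (tensor_elem B N Y n (f (tensor_elem A M X m x))) = \<psi> (tensor_elem B N M n m) \<odot>\<^bsub>X\<^esub> x) \<and>
    (\<forall>m\<in>carrier M. \<forall>n\<in>carrier N. \<forall>y\<in>carrier Y.
      f (tensor_elem A M X m (g (tensor_elem B N Y n y))) = \<phi> (tensor_elem A M N m n) \<odot>\<^bsub>Y\<^esub> y))"

definition tuple_module ::
  "'a ring \<Rightarrow> 'b ring \<Rightarrow> ('a, 'b, 'n) bimodule \<Rightarrow> ('b, 'a, 'm) bimodule
    \<Rightarrow> ('a, 'b, 'n, 'm, 'x, 'y) morita_tuple \<Rightarrow> ('a \<times> 'n \<times> 'm \<times> 'b, 'x \<times> 'y) module"
  where "tuple_module A B N M = (\<lambda>(X, Y, f, g).
    \<lparr>carrier = carrier X \<times> carrier Y, mult = undefined, one = undefined,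
     zero = (\<zero>\<^bsub>X\<^esub>, \<zero>\<^bsub>Y\<^esub>),
     add = (\<lambda>(x, y) (x', y'). (x \<oplus>\<^bsub>X\<^esub> x', y \<oplus>\<^bsub>Y\<^esub> y')),
     smult = (\<lambda>(a, n, m, b) (x, y).
       (a \<odot>\<^bsub>X\<^esub> x \<oplus>\<^bsub>X\<^esub> g (tensor_elem B N Y n y),
        b \<odot>\<^bsub>Y\<^esub> y \<oplus>\<^bsub>Y\<^esub> f (tensor_elem A M X m x)))\<rparr>)"

section \<open>The functors $\mathsf H_A$ and $\mathsf H_B$ on objects\<close>

text \<open>For an \<open>R\<close>-\<open>S\<close>-bimodule \<open>P\<close>, an \<open>S\<close>-\<open>R\<close>-bimodule \<open>Q\<close>, \<open>\<theta> : P \<otimes>\<^sub>S Q \<rightarrow> R\<close> and a left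
  \<open>R\<close>-module \<open>W\<close>, \<open>contraction S P Q \<theta> W\<close> is the map
  \<open>P \<otimes>\<^sub>S (Q \<otimes>\<^sub>R W) \<rightarrow> W\<close>, \<open>p \<otimes> (q \<otimes> w) \<mapsto> \<theta>(p \<otimes> q) w\<close>, and \<open>hom_contraction S R P Q \<theta> W\<close> is its
  adjoint \<open>Q \<otimes>\<^sub>R W \<rightarrow> Hom\<^sub>R(P, P \<otimes>\<^sub>S (Q \<otimes>\<^sub>R W)) \<rightarrow> Hom\<^sub>R(P, W)\<close>. Thus
  \<open>\<Psi>\<^sub>I\<close>, \<open>\<mu>\<^sub>I\<close> are obtained for \<open>R = A\<close>, \<open>S = B\<close>, \<open>P = N\<close>, \<open>Q = M\<close>, \<open>\<theta> = \<psi>\<close>, and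
  \<open>\<Phi>\<^sub>J\<close>, \<open>\<nu>\<^sub>J\<close> for \<open>R = B\<close>, \<open>S = A\<close>, \<open>P = M\<close>, \<open>Q = N\<close>, \<open>\<theta> = \<phi>\<close>.\<close>

definition contraction ::
  "'s ring \<Rightarrow> ('r, 's, 'p) bimodule \<Rightarrow> ('s, 'r, 'q) bimodule
    \<Rightarrow> ((('p \<times> 'q) \<Rightarrow>\<^sub>0 int) set \<Rightarrow> 'r) \<Rightarrow> ('r, 'w) module
    \<Rightarrow> (('p \<times> (('q \<times> 'w) \<Rightarrow>\<^sub>0 int) set) \<Rightarrow>\<^sub>0 int) set \<Rightarrow> 'w"
  where "contraction S P Q \<theta> W =
    tensor_lift W (\<lambda>(p, t). tensor_lift W (\<lambda>(q, w). \<theta> (tensor_elem S P Q p q) \<odot>\<^bsub>W\<^esub> w) t)"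

definition hom_contraction ::
  "'s ring \<Rightarrow> 'r ring \<Rightarrow> ('r, 's, 'p) bimodule \<Rightarrow> ('s, 'r, 'q) bimodule
    \<Rightarrow> ((('p \<times> 'q) \<Rightarrow>\<^sub>0 int) set \<Rightarrow> 'r) \<Rightarrow> ('r, 'w) module
    \<Rightarrow> (('q \<times> 'w) \<Rightarrow>\<^sub>0 int) set \<Rightarrow> 'p \<Rightarrow> 'w"
  where "hom_contraction S R P Q \<theta> W t =
    compose (carrier P) (contraction S P Q \<theta> W) (adj_unit S P (tensor R Q W) t)"

definition H_A ::
  "'a ring \<Rightarrow> 'b ring \<Rightarrow> ('a, 'b, 'n) bimodule \<Rightarrow> ('b, 'a, 'm) bimodule
    \<Rightarrow> ((('m \<times> 'n) \<Rightarrow>\<^sub>0 int) set \<Rightarrow> 'b) \<Rightarrow> ((('n \<times> 'm) \<Rightarrow>\<^sub>0 int) set \<Rightarrow> 'a)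
    \<Rightarrow> ('a, 'x) module \<Rightarrow> ('a, 'b, 'n, 'm, 'x, 'n \<Rightarrow> 'x) morita_tuple"
  where "H_A A B N M \<phi> \<psi> I =
    (I, hom_module A N I, hom_contraction B A N M \<psi> I, adj_counit I)"

definition H_B ::
  "'a ring \<Rightarrow> 'b ring \<Rightarrow> ('a, 'b, 'n) bimodule \<Rightarrow> ('b, 'a, 'm) bimodule
    \<Rightarrow> ((('m \<times> 'n) \<Rightarrow>\<^sub>0 int) set \<Rightarrow> 'b) \<Rightarrow> ((('n \<times> 'm) \<Rightarrow>\<^sub>0 int) set \<Rightarrow> 'a)
    \<Rightarrow> ('b, 'y) module \<Rightarrow> ('a, 'b, 'n, 'm, 'm \<Rightarrow> 'y, 'y) morita_tuple"
  where "H_B A B N M \<phi> \<psi> J =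
    (hom_module B M J, J, adj_counit J, hom_contraction A B M N \<phi> J)"

end

theory Submission
  imports Defs "HOL-Algebra.QuotRing"
begin

text \<open>Write \<open>\<Lambda>\<close> for the Morita ring and \<open>e\<close> for its idempotent with \<open>e\<Lambda>e = A\<close>. An \<open>A\<close>-module \<open>I\<close>
  coinduces the \<open>\<Lambda>\<close>-module \<open>Coind(I) = Hom\<^sub>A(e\<Lambda>, I)\<close>, on which \<open>\<Lambda>\<close> acts by \<open>(l h)(u) = h(u l)\<close>.
  Since \<open>e\<Lambda> = A \<oplus> N\<close>, a map \<open>h\<close> in \<open>Coind(I)\<close> is the same as the pair of \<open>h(e)\<close> and the restriction of
  \<open>h\<close> to \<open>N\<close>, and in these coordinates the action of the off-diagonal entries of \<open>\<Lambda>\<close> is given by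
  \<open>\<mu>\<^sub>I\<close> and \<open>\<epsilon>'\<^sub>I\<close>. Thus \<open>Coind(I)\<close> is \<open>H\<^sub>A(I)\<close> (\<open>HA_of_coind_iso\<close>), and the theorem becomes a
  statement about a ring with an idempotent.

  The functor \<open>Coind\<close> is right adjoint to the exact functor \<open>Z \<mapsto> eZ\<close>, which preserves finite
  generation; hence it preserves injectivity (\<open>injective_coind\<close>). Moreover \<open>e Coind(I)\<close> is
  isomorphic to \<open>I\<close>, and \<open>e\<Lambda>\<close> does not annihilate any nonzero element of \<open>Coind(I)\<close>, so a
  decomposition of \<open>Coind(I)\<close> comes down to one of \<open>I\<close> (\<open>indecomposable_coind\<close>).

  Conversely let \<open>Z\<close> be indecomposable injective. The submodules of elements annihilated by \<open>e\<Lambda>\<close>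
  and by \<open>(1 - e)\<Lambda>\<close> meet in \<open>0\<close>, because \<open>1 = e + (1 - e)\<close>. Any two nonzero submodules of \<open>Z\<close>
  have a nonzero intersection (\<open>indecomposable_injective_uniform\<close>), so one of the two vanishes.
  If it is the first, the unit \<open>Z \<rightarrow> Coind(eZ)\<close>, \<open>z \<mapsto> (u \<mapsto> u z)\<close>, is injective, hence split; as it is
  bijective on the images of \<open>e\<close>, the complement is annihilated by \<open>e\<Lambda>\<close> and is zero. Therefore
  \<open>Z\<close> is isomorphic to \<open>Coind(eZ)\<close>, and \<open>eZ\<close> inherits injectivity and
  indecomposability (\<open>indecomposable_injective_corner\<close>). The second case is the first one with the
  two corners of \<open>\<Lambda>\<close> exchanged, and so is everything about \<open>H\<^sub>B\<close>.

  All of this takes place among finitely generated modules, and here the Artin algebra enters: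
  \<open>Coind(I)\<close>, \<open>Hom\<^sub>A(N, I)\<close> and submodules of \<open>Z\<close> must be finitely generated. Finite generation over
  \<open>\<Lambda>\<close>, \<open>A\<close> or \<open>B\<close> is finite generation over the Artinian ring \<open>K\<close> of scalars
  (\<open>fg_restrict_iff\<close>), where it is equivalent to the descending chain condition
  (\<open>artinian_on_finitely_generated\<close>, \<open>finitely_spanned_if_artinian\<close>), and this
  condition passes to submodules and to modules of homomorphisms.\<close>

section \<open>Submodules and finite generation\<close>

context left_module begin

lemma smult_r_null [simp]: "a \<in> carrier R \<Longrightarrow> a \<odot>\<^bsub>M\<^esub> \<zero>\<^bsub>M\<^esub> = \<zero>\<^bsub>M\<^esub>"
  using smult_r_distr[of a "\<zero>\<^bsub>M\<^esub>" "\<zero>\<^bsub>M\<^esub>"] smult_closed[of a "\<zero>\<^bsub>M\<^esub>"]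
  by (metis M.add.l_cancel_one' M.l_zero M.zero_closed)

lemma smult_l_null [simp]: "x \<in> carrier M \<Longrightarrow> \<zero> \<odot>\<^bsub>M\<^esub> x = \<zero>\<^bsub>M\<^esub>"
  using smult_l_distr[of \<zero> \<zero> x] smult_closed[of \<zero> x]
  by (metis M.add.l_cancel_one' R.l_zero R.zero_closed)

lemma smult_minus_one: "x \<in> carrier M \<Longrightarrow> (\<ominus> \<one>) \<odot>\<^bsub>M\<^esub> x = \<ominus>\<^bsub>M\<^esub> x"
  using smult_l_distr[of "\<ominus> \<one>" \<one> x] by (simp add: R.l_neg M.minus_equality)

lemma smult_r_minus: "a \<in> carrier R \<Longrightarrow> x \<in> carrier M \<Longrightarrow> a \<odot>\<^bsub>M\<^esub> (\<ominus>\<^bsub>M\<^esub> x) = \<ominus>\<^bsub>M\<^esub> (a \<odot>\<^bsub>M\<^esub> x)"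
  using smult_r_distr[of a "\<ominus>\<^bsub>M\<^esub> x" x] by (simp add: M.l_neg M.minus_equality)

lemma smult_r_diff:
  "a \<in> carrier R \<Longrightarrow> x \<in> carrier M \<Longrightarrow> y \<in> carrier M
    \<Longrightarrow> a \<odot>\<^bsub>M\<^esub> (x \<ominus>\<^bsub>M\<^esub> y) = a \<odot>\<^bsub>M\<^esub> x \<ominus>\<^bsub>M\<^esub> a \<odot>\<^bsub>M\<^esub> y"
  by (simp add: a_minus_def smult_r_distr smult_r_minus)

lemma diff_add_cancel [simp]: "x \<in> carrier M \<Longrightarrow> y \<in> carrier M \<Longrightarrow> (x \<ominus>\<^bsub>M\<^esub> y) \<oplus>\<^bsub>M\<^esub> y = x"
  by (simp add: a_minus_def M.a_assoc M.l_neg)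

text \<open>Closure under negation is automatic, since \<open>-x\<close> is the scalar multiple \<open>(-1) x\<close>.\<close>

lemma submodule_iff:
  "submodule U R M \<longleftrightarrow> U \<subseteq> carrier M \<and> \<zero>\<^bsub>M\<^esub> \<in> U \<and> (\<forall>x\<in>U. \<forall>y\<in>U. x \<oplus>\<^bsub>M\<^esub> y \<in> U)
    \<and> (\<forall>r\<in>carrier R. \<forall>x\<in>U. r \<odot>\<^bsub>M\<^esub> x \<in> U)" (is "?l \<longleftrightarrow> ?r")
proof
  assume ?l
  then interpret U: submodule U R M .
  show ?r using U.subset U.one_closed U.m_closed U.smult_closed by auto
next
  assume r: ?r
  have "\<ominus>\<^bsub>M\<^esub> x \<in> U" if "x \<in> U" for x
    using r that smult_minus_one[of x] R.a_inv_closed[OF R.one_closed] by (metis subsetD)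
  with r show ?l
    by (intro submodule.intro subgroup.intro submodule_axioms.intro)
      (auto simp: a_inv_def)
qed

lemma submoduleD:
  assumes "submodule U R M"
  shows "U \<subseteq> carrier M" "\<zero>\<^bsub>M\<^esub> \<in> U" "x \<in> U \<Longrightarrow> x \<in> carrier M"
    "x \<in> U \<Longrightarrow> y \<in> U \<Longrightarrow> x \<oplus>\<^bsub>M\<^esub> y \<in> U" "r \<in> carrier R \<Longrightarrow> x \<in> U \<Longrightarrow> r \<odot>\<^bsub>M\<^esub> x \<in> U"
    "x \<in> U \<Longrightarrow> \<ominus>\<^bsub>M\<^esub> x \<in> U" "x \<in> U \<Longrightarrow> y \<in> U \<Longrightarrow> x \<ominus>\<^bsub>M\<^esub> y \<in> U"
proof -
  note s = assms[unfolded submodule_iff]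
  show "U \<subseteq> carrier M" "\<zero>\<^bsub>M\<^esub> \<in> U" "x \<in> U \<Longrightarrow> x \<in> carrier M"
    "x \<in> U \<Longrightarrow> y \<in> U \<Longrightarrow> x \<oplus>\<^bsub>M\<^esub> y \<in> U" "r \<in> carrier R \<Longrightarrow> x \<in> U \<Longrightarrow> r \<odot>\<^bsub>M\<^esub> x \<in> U"
    using s by auto
  show m: "z \<in> U \<Longrightarrow> \<ominus>\<^bsub>M\<^esub> z \<in> U" for z
    using s smult_minus_one[of z] R.a_inv_closed[OF R.one_closed] by (metis subsetD)
  show "x \<in> U \<Longrightarrow> y \<in> U \<Longrightarrow> x \<ominus>\<^bsub>M\<^esub> y \<in> U"
    using m[of y] s by (auto simp: a_minus_def)
qed

lemma submodule_carrier: "submodule (carrier M) R M"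
  and submodule_zero: "submodule {\<zero>\<^bsub>M\<^esub>} R M"
  and submodule_Int: "submodule U R M \<Longrightarrow> submodule V R M \<Longrightarrow> submodule (U \<inter> V) R M"
  by (auto simp: submodule_iff)

lemma submodule_set_add:
  assumes U: "submodule U R M" and V: "submodule V R M"
  shows "submodule (U <+>\<^bsub>M\<^esub> V) R M" "U \<subseteq> U <+>\<^bsub>M\<^esub> V" "V \<subseteq> U <+>\<^bsub>M\<^esub> V"
proof -
  note D = submoduleD[OF U] submoduleD[OF V]
  show "submodule (U <+>\<^bsub>M\<^esub> V) R M"
    unfolding submodule_iff
  proof (intro conjI ballI)
    show "\<zero>\<^bsub>M\<^esub> \<in> U <+>\<^bsub>M\<^esub> V" using D(2,9) by (force simp: set_add_def')
    fix x y assume "x \<in> U <+>\<^bsub>M\<^esub> V" "y \<in> U <+>\<^bsub>M\<^esub> V"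
    then obtain u v u' v' where *: "u \<in> U" "u' \<in> U" "v \<in> V" "v' \<in> V" "x = u \<oplus>\<^bsub>M\<^esub> v" "y = u' \<oplus>\<^bsub>M\<^esub> v'"
      by (auto simp: set_add_def')
    then have "x \<oplus>\<^bsub>M\<^esub> y = (u \<oplus>\<^bsub>M\<^esub> u') \<oplus>\<^bsub>M\<^esub> (v \<oplus>\<^bsub>M\<^esub> v')"
      using D by (simp add: M.a_ac)
    moreover have "u \<oplus>\<^bsub>M\<^esub> u' \<in> U" "v \<oplus>\<^bsub>M\<^esub> v' \<in> V" using * D by auto
    ultimately show "x \<oplus>\<^bsub>M\<^esub> y \<in> U <+>\<^bsub>M\<^esub> V" unfolding set_add_def' by blast
  next
    fix r x assume "r \<in> carrier R" "x \<in> U <+>\<^bsub>M\<^esub> V"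
    then obtain u v where *: "u \<in> U" "v \<in> V" "x = u \<oplus>\<^bsub>M\<^esub> v" by (auto simp: set_add_def')
    then have "r \<odot>\<^bsub>M\<^esub> x = r \<odot>\<^bsub>M\<^esub> u \<oplus>\<^bsub>M\<^esub> r \<odot>\<^bsub>M\<^esub> v"
      using D(3)[of u] D(10)[of v] \<open>r \<in> carrier R\<close> by (simp add: smult_r_distr)
    then show "r \<odot>\<^bsub>M\<^esub> x \<in> U <+>\<^bsub>M\<^esub> V"
      using D(5)[of r u] D(12)[of r v] * \<open>r \<in> carrier R\<close> unfolding set_add_def' by blast
  next
    show "U <+>\<^bsub>M\<^esub> V \<subseteq> carrier M" using D(1,8) by (auto simp: set_add_def')
  qed
  show "U \<subseteq> U <+>\<^bsub>M\<^esub> V"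
  proof
    fix u assume "u \<in> U"
    then have "u = u \<oplus>\<^bsub>M\<^esub> \<zero>\<^bsub>M\<^esub>" using D(3) by simp
    then show "u \<in> U <+>\<^bsub>M\<^esub> V" using \<open>u \<in> U\<close> D(9) unfolding set_add_def' by blast
  qed
  show "V \<subseteq> U <+>\<^bsub>M\<^esub> V"
  proof
    fix v assume "v \<in> V"
    then have "v = \<zero>\<^bsub>M\<^esub> \<oplus>\<^bsub>M\<^esub> v" using D(10) by simp
    then show "v \<in> U <+>\<^bsub>M\<^esub> V" using \<open>v \<in> V\<close> D(2) unfolding set_add_def' by blast
  qed
qed

lemma left_module_submodule:
  assumes "submodule U R M"
  shows "left_module R (M\<lparr>carrier := U\<rparr>)"
proof -
  note D = submoduleD[OF assms]
  have "abelian_group (M\<lparr>carrier := U\<rparr>)"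
  proof (rule abelian_groupI)
    fix x assume "x \<in> carrier (M\<lparr>carrier := U\<rparr>)"
    then show "\<exists>y\<in>carrier (M\<lparr>carrier := U\<rparr>). y \<oplus>\<^bsub>M\<lparr>carrier := U\<rparr>\<^esub> x = \<zero>\<^bsub>M\<lparr>carrier := U\<rparr>\<^esub>"
      using D by (auto intro!: bexI[of _ "\<ominus>\<^bsub>M\<^esub> x"] simp: M.l_neg)
  qed (use D in \<open>auto simp: M.a_ac\<close>)
  then show ?thesis
    using D by (intro left_module.intro R.ring_axioms left_module_axioms.intro)
      (auto simp: smult_l_distr smult_r_distr smult_assoc1)
qed

lemma submodule_submodule_iff:
  assumes "submodule U R M"
  shows "submodule W R (M\<lparr>carrier := U\<rparr>) \<longleftrightarrow> submodule W R M \<and> W \<subseteq> U"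
  using left_module.submodule_iff[OF left_module_submodule[OF assms], of W] submoduleD(1)[OF assms]
  by (auto simp: submodule_iff)

lemma smult_finsum:
  assumes "finite S" "f \<in> S \<rightarrow> carrier M" "r \<in> carrier R"
  shows "r \<odot>\<^bsub>M\<^esub> finsum M f S = finsum M (\<lambda>s. r \<odot>\<^bsub>M\<^esub> f s) S"
  using assms by (induction S) (auto simp: smult_r_distr Pi_def)

end

text \<open>\<open>U\<close> is generated by a finite subset, expressed through the submodules containing that subset: this
  makes generation insensitive to the scalars and replaces the manipulation of linear combinations
  by checks that sets are submodules.\<close>

definition finitely_spanned :: "('r, 'c) ring_scheme \<Rightarrow> ('r, 'x, 'd) module_scheme \<Rightarrow> 'x set \<Rightarrow> bool"
  where "finitely_spanned R X U \<longleftrightarrow>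
    (\<exists>S. finite S \<and> S \<subseteq> U \<and> (\<forall>W. submodule W R X \<and> S \<subseteq> W \<longrightarrow> U \<subseteq> W))"

lemma finitely_spannedE:
  assumes "finitely_spanned R X U"
  obtains S where "finite S" "S \<subseteq> U" "\<And>W. submodule W R X \<Longrightarrow> S \<subseteq> W \<Longrightarrow> U \<subseteq> W"
  using assms by (auto simp: finitely_spanned_def)

lemma finitely_spannedI:
  assumes "finite S" "S \<subseteq> U" "\<And>W. submodule W R X \<Longrightarrow> S \<subseteq> W \<Longrightarrow> U \<subseteq> W"
  shows "finitely_spanned R X U"
  unfolding finitely_spanned_def using assms by (intro exI[of _ S]) simp

lemma (in left_module) finitely_generated_iff:
  "finitely_generated R M \<longleftrightarrow> finitely_spanned R M (carrier M)"
proof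
  assume "finitely_generated R M"
  then obtain S where S: "finite S" "S \<subseteq> carrier M"
    "\<And>x. x \<in> carrier M \<Longrightarrow> \<exists>c\<in>S \<rightarrow> carrier R. x = finsum M (\<lambda>s. c s \<odot>\<^bsub>M\<^esub> s) S"
    by (auto simp: finitely_generated_def)
  have "carrier M \<subseteq> W" if W: "submodule W R M" "S \<subseteq> W" for W
  proof
    note D = submoduleD[OF W(1)]
    fix x assume "x \<in> carrier M"
    then obtain c where c: "c \<in> S \<rightarrow> carrier R" "x = finsum M (\<lambda>s. c s \<odot>\<^bsub>M\<^esub> s) S"
      using S(3) by blast
    have "finsum M (\<lambda>s. c s \<odot>\<^bsub>M\<^esub> s) T \<in> W" if "T \<subseteq> S" for T
      using finite_subset[OF that S(1)] that
    proof (induction T)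
      case (insert t T)
      then have "c t \<odot>\<^bsub>M\<^esub> t \<in> W" using c W D(5) by auto
      moreover have "(\<lambda>s. c s \<odot>\<^bsub>M\<^esub> s) \<in> T \<rightarrow> carrier M" using insert.prems c S(2) by auto
      ultimately show ?case using insert D by auto
    qed (use D in simp)
    then show "x \<in> W" using c by blast
  qed
  then show "finitely_spanned R M (carrier M)"
    using S(1,2) by (auto simp: finitely_spanned_def)
next
  assume "finitely_spanned R M (carrier M)"
  then obtain S where S: "finite S" "S \<subseteq> carrier M"
    "\<And>W. submodule W R M \<Longrightarrow> S \<subseteq> W \<Longrightarrow> carrier M \<subseteq> W"
    by (auto simp: finitely_spanned_def)
  define G where "G = {finsum M (\<lambda>s. c s \<odot>\<^bsub>M\<^esub> s) S | c. c \<in> S \<rightarrow> carrier R}"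
  have cl: "(\<lambda>s. c s \<odot>\<^bsub>M\<^esub> s) \<in> S \<rightarrow> carrier M" if "c \<in> S \<rightarrow> carrier R" for c
    using that S(2) by auto
  have "submodule G R M"
    unfolding submodule_iff
  proof (intro conjI ballI subsetI)
    fix x assume "x \<in> G"
    then show "x \<in> carrier M" using cl by (auto simp: G_def intro!: M.finsum_closed)
  next
    have "finsum M (\<lambda>s. \<zero> \<odot>\<^bsub>M\<^esub> s) S = finsum M (\<lambda>s. \<zero>\<^bsub>M\<^esub>) S"
      using S by (intro M.finsum_cong') auto
    then have "\<zero>\<^bsub>M\<^esub> = finsum M (\<lambda>s. (\<lambda>_. \<zero>) s \<odot>\<^bsub>M\<^esub> s) S" by simp
    then show "\<zero>\<^bsub>M\<^esub> \<in> G" unfolding G_def by (intro CollectI exI[of _ "\<lambda>_. \<zero>"]) auto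
  next
    fix x y assume "x \<in> G" "y \<in> G"
    then obtain c d where c: "c \<in> S \<rightarrow> carrier R" "x = finsum M (\<lambda>s. c s \<odot>\<^bsub>M\<^esub> s) S"
      and d: "d \<in> S \<rightarrow> carrier R" "y = finsum M (\<lambda>s. d s \<odot>\<^bsub>M\<^esub> s) S"
      by (auto simp: G_def)
    have "x \<oplus>\<^bsub>M\<^esub> y = finsum M (\<lambda>s. c s \<odot>\<^bsub>M\<^esub> s \<oplus>\<^bsub>M\<^esub> d s \<odot>\<^bsub>M\<^esub> s) S"
      unfolding c(2) d(2) by (rule M.finsum_addf[symmetric]) (use cl c d in auto)
    also have "\<dots> = finsum M (\<lambda>s. (\<lambda>s. c s \<oplus> d s) s \<odot>\<^bsub>M\<^esub> s) S"
      using S(2) c(1) d(1) by (intro M.finsum_cong') (auto simp: smult_l_distr Pi_def subset_iff)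
    finally show "x \<oplus>\<^bsub>M\<^esub> y \<in> G"
      unfolding G_def using c(1) d(1) by (intro CollectI exI[of _ "\<lambda>s. c s \<oplus> d s"]) auto
  next
    fix r x assume r: "r \<in> carrier R" and "x \<in> G"
    then obtain c where c: "c \<in> S \<rightarrow> carrier R" "x = finsum M (\<lambda>s. c s \<odot>\<^bsub>M\<^esub> s) S"
      by (auto simp: G_def)
    have "r \<odot>\<^bsub>M\<^esub> x = finsum M (\<lambda>s. r \<odot>\<^bsub>M\<^esub> (c s \<odot>\<^bsub>M\<^esub> s)) S"
      unfolding c(2) by (rule smult_finsum[OF S(1) cl[OF c(1)] r])
    also have "\<dots> = finsum M (\<lambda>s. (\<lambda>s. r \<otimes> c s) s \<odot>\<^bsub>M\<^esub> s) S"
      using S(2) c(1) r by (intro M.finsum_cong') (auto simp: smult_assoc1 Pi_def subset_iff)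
    finally show "r \<odot>\<^bsub>M\<^esub> x \<in> G"
      unfolding G_def using c(1) r by (intro CollectI exI[of _ "\<lambda>s. r \<otimes> c s"]) auto
  qed
  moreover have "S \<subseteq> G"
  proof
    fix s assume s: "s \<in> S"
    have "finsum M (\<lambda>t. (if s = t then \<one> else \<zero>) \<odot>\<^bsub>M\<^esub> t) S
        = finsum M (\<lambda>t. if s = t then (\<lambda>t. t) t else \<zero>\<^bsub>M\<^esub>) S"
      using S(2) by (intro M.finsum_cong') auto
    also have "\<dots> = s" using S s by (intro M.finsum_singleton) auto
    finally show "s \<in> G"
      unfolding G_def by (intro CollectI exI[of _ "\<lambda>t. if s = t then \<one> else \<zero>"]) auto
  qed
  ultimately have "carrier M \<subseteq> G" by (rule S(3))
  then show "finitely_generated R M"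
    using S(1,2) unfolding finitely_generated_def G_def by blast
qed

lemma fg_module_iff: "fg_module R X \<longleftrightarrow> left_module R X \<and> finitely_spanned R X (carrier X)"
  using left_module.finitely_generated_iff[of R X] by (auto simp: fg_module_def)

lemma (in left_module) fg_submodule:
  assumes "submodule U R M" "finitely_spanned R M U"
  shows "fg_module R (M\<lparr>carrier := U\<rparr>)"
proof -
  obtain S where "finite S" "S \<subseteq> U" "\<forall>W. submodule W R M \<and> S \<subseteq> W \<longrightarrow> U \<subseteq> W"
    using assms(2) by (auto simp: finitely_spanned_def)
  then have "finitely_spanned R (M\<lparr>carrier := U\<rparr>) U"
    unfolding finitely_spanned_def submodule_submodule_iff[OF assms(1)]
    by (intro exI[of _ S]) simp
  then show ?thesis using left_module_submodule[OF assms(1)] by (simp add: fg_module_iff)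
qed

lemma module_homD:
  assumes "h \<in> module_hom R X Y"
  shows "x \<in> carrier X \<Longrightarrow> h x \<in> carrier Y"
    "x \<in> carrier X \<Longrightarrow> y \<in> carrier X \<Longrightarrow> h (x \<oplus>\<^bsub>X\<^esub> y) = h x \<oplus>\<^bsub>Y\<^esub> h y"
    "r \<in> carrier R \<Longrightarrow> x \<in> carrier X \<Longrightarrow> h (r \<odot>\<^bsub>X\<^esub> x) = r \<odot>\<^bsub>Y\<^esub> h x"
  using assms by (auto simp: module_hom_def)

lemma module_homI:
  assumes "\<And>x. x \<in> carrier X \<Longrightarrow> h x \<in> carrier Y"
    "\<And>x y. x \<in> carrier X \<Longrightarrow> y \<in> carrier X \<Longrightarrow> h (x \<oplus>\<^bsub>X\<^esub> y) = h x \<oplus>\<^bsub>Y\<^esub> h y"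
    "\<And>r x. r \<in> carrier R \<Longrightarrow> x \<in> carrier X \<Longrightarrow> h (r \<odot>\<^bsub>X\<^esub> x) = r \<odot>\<^bsub>Y\<^esub> h x"
  shows "h \<in> module_hom R X Y"
  using assms by (auto simp: module_hom_def)

locale module_map = X: left_module R X + Y: left_module R Y
  for R :: "('r, 'c) ring_scheme" and X :: "('r, 'x, 'd) module_scheme"
    and Y :: "('r, 'y, 'e) module_scheme" +
  fixes h :: "'x \<Rightarrow> 'y"
  assumes hom: "h \<in> module_hom R X Y"
begin

lemmas closed = module_homD(1)[OF hom] and add = module_homD(2)[OF hom]
  and smult = module_homD(3)[OF hom]

lemma zero: "h \<zero>\<^bsub>X\<^esub> = \<zero>\<^bsub>Y\<^esub>"
  using smult[of "\<zero>\<^bsub>R\<^esub>" "\<zero>\<^bsub>X\<^esub>"] closed[of "\<zero>\<^bsub>X\<^esub>"] by simp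

lemma minus: "x \<in> carrier X \<Longrightarrow> h (\<ominus>\<^bsub>X\<^esub> x) = \<ominus>\<^bsub>Y\<^esub> h x"
  using smult[of "\<ominus>\<^bsub>R\<^esub> \<one>\<^bsub>R\<^esub>" x] closed[of x] by (simp add: X.smult_minus_one Y.smult_minus_one)

lemma diff: "x \<in> carrier X \<Longrightarrow> y \<in> carrier X \<Longrightarrow> h (x \<ominus>\<^bsub>X\<^esub> y) = h x \<ominus>\<^bsub>Y\<^esub> h y"
  by (simp add: a_minus_def add minus)

lemma submodule_preimage:
  assumes "submodule V R Y" shows "submodule {x \<in> carrier X. h x \<in> V} R X"
  using Y.submoduleD[OF assms] by (auto simp: X.submodule_iff zero add smult)

lemma submodule_image:
  assumes "submodule U R X" shows "submodule (h ` U) R Y"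
  unfolding Y.submodule_iff
proof (intro conjI ballI)
  note D = X.submoduleD[OF assms]
  show "h ` U \<subseteq> carrier Y" using D(1) closed by auto
  show "\<zero>\<^bsub>Y\<^esub> \<in> h ` U" using D(2) zero by force
  fix y z assume "y \<in> h ` U" "z \<in> h ` U"
  then obtain u v where "u \<in> U" "v \<in> U" "y = h u" "z = h v" by blast
  then show "y \<oplus>\<^bsub>Y\<^esub> z \<in> h ` U" using D(3,4) add by (metis imageI)
next
  note D = X.submoduleD[OF assms]
  fix r y assume "r \<in> carrier R" "y \<in> h ` U"
  then obtain u where u: "u \<in> U" "y = h u" by blast
  then have "h (r \<odot>\<^bsub>X\<^esub> u) = r \<odot>\<^bsub>Y\<^esub> y" using D(3)[OF u(1)] \<open>r \<in> carrier R\<close> by (simp add: smult)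
  then show "r \<odot>\<^bsub>Y\<^esub> y \<in> h ` U" using D(5)[OF \<open>r \<in> carrier R\<close> u(1)] by (metis imageI)
qed

lemma inj_iff: "inj_on h (carrier X) \<longleftrightarrow> (\<forall>x\<in>carrier X. h x = \<zero>\<^bsub>Y\<^esub> \<longrightarrow> x = \<zero>\<^bsub>X\<^esub>)"
proof
  assume r: "\<forall>x\<in>carrier X. h x = \<zero>\<^bsub>Y\<^esub> \<longrightarrow> x = \<zero>\<^bsub>X\<^esub>"
  show "inj_on h (carrier X)"
  proof (rule inj_onI)
    fix x y assume *: "x \<in> carrier X" "y \<in> carrier X" "h x = h y"
    then have "h (x \<ominus>\<^bsub>X\<^esub> y) = \<zero>\<^bsub>Y\<^esub>" by (simp add: diff closed) (simp add: a_minus_def closed Y.M.r_neg)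
    then have "x \<ominus>\<^bsub>X\<^esub> y = \<zero>\<^bsub>X\<^esub>" using r * by simp
    then show "x = y" using X.diff_add_cancel[OF *(1,2)] * by simp
  qed
qed (use zero in \<open>auto simp: inj_on_def\<close>)

lemma fg_image:
  assumes "fg_module R X" "h ` carrier X = carrier Y"
  shows "fg_module R Y"
proof -
  obtain S where S: "finite S" "S \<subseteq> carrier X"
    "\<And>W. submodule W R X \<Longrightarrow> S \<subseteq> W \<Longrightarrow> carrier X \<subseteq> W"
    using assms(1) by (auto simp: fg_module_iff finitely_spanned_def)
  have "carrier Y \<subseteq> W" if W: "submodule W R Y" "h ` S \<subseteq> W" for W
  proof -
    have "S \<subseteq> {x \<in> carrier X. h x \<in> W}" using W(2) S(2) by auto
    then have "carrier X \<subseteq> {x \<in> carrier X. h x \<in> W}"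
      by (rule S(3)[OF submodule_preimage[OF W(1)]])
    then show ?thesis unfolding assms(2)[symmetric] by auto
  qed
  then have "finitely_spanned R Y (carrier Y)"
    unfolding finitely_spanned_def using S(1,2) closed by (intro exI[of _ "h ` S"] conjI) auto
  then show ?thesis using Y.left_module_axioms by (simp add: fg_module_iff)
qed

end

section \<open>Artinian modules over a commutative Artinian ring\<close>

text \<open>Zorn's lemma: the union of a chain of submodules avoiding \<open>D\<close> is a submodule avoiding \<open>D\<close>.\<close>

lemma (in left_module) maximal_submodule_avoiding:
  assumes "submodule V R M" "V \<inter> D = {}"
  shows "\<exists>W. submodule W R M \<and> V \<subseteq> W \<and> W \<inter> D = {} \<and>
    (\<forall>W'. submodule W' R M \<and> W \<subseteq> W' \<and> W' \<inter> D = {} \<longrightarrow> W' = W)"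
proof -
  let ?F = "{W. submodule W R M \<and> V \<subseteq> W \<and> W \<inter> D = {}}"
  have "\<exists>W\<in>?F. \<forall>W'\<in>?F. W \<subseteq> W' \<longrightarrow> W' = W"
  proof (rule subset_Zorn_nonempty)
    show "?F \<noteq> {}" using assms by blast
    fix C assume C: "C \<noteq> {}" "subset.chain ?F C"
    then have sub: "\<And>W. W \<in> C \<Longrightarrow> submodule W R M \<and> V \<subseteq> W \<and> W \<inter> D = {}"
      and lin: "\<And>W W'. W \<in> C \<Longrightarrow> W' \<in> C \<Longrightarrow> W \<subseteq> W' \<or> W' \<subseteq> W"
      by (auto simp: subset_chain_def)
    have "submodule (\<Union>C) R M"
      unfolding submodule_iff
    proof (intro conjI ballI)
      show "\<Union>C \<subseteq> carrier M" using sub submoduleD(1) by blast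
      show "\<zero>\<^bsub>M\<^esub> \<in> \<Union>C" using sub submoduleD(2) C(1) by blast
      fix x y assume "x \<in> \<Union>C" "y \<in> \<Union>C"
      then obtain W W' where W: "x \<in> W" "y \<in> W'" "W \<in> C" "W' \<in> C" by blast
      then obtain W'' where "W'' \<in> C" "x \<in> W''" "y \<in> W''" using lin[OF W(3,4)] by blast
      then show "x \<oplus>\<^bsub>M\<^esub> y \<in> \<Union>C" using sub submoduleD(4) by blast
    next
      fix r x assume "r \<in> carrier R" "x \<in> \<Union>C"
      then show "r \<odot>\<^bsub>M\<^esub> x \<in> \<Union>C" using sub submoduleD(5) by blast
    qed
    then show "\<Union>C \<in> ?F" using sub C(1) by blast
  qed
  then obtain W where W: "W \<in> ?F" "\<forall>W'\<in>?F. W \<subseteq> W' \<longrightarrow> W' = W" by (rule bexE)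
  show ?thesis
  proof (intro exI[of _ W] conjI allI impI)
    fix W' assume "submodule W' R M \<and> W \<subseteq> W' \<and> W' \<inter> D = {}"
    then show "W' = W" using W by (intro W(2)[rule_format]) auto
  qed (use W(1) in auto)
qed

definition artinian_on :: "('r, 'c) ring_scheme \<Rightarrow> ('r, 'x, 'd) module_scheme \<Rightarrow> 'x set \<Rightarrow> bool"
  where "artinian_on R X U \<longleftrightarrow>
    (\<forall>J :: nat \<Rightarrow> 'x set. (\<forall>n. submodule (J n) R X \<and> J n \<subseteq> U \<and> J (Suc n) \<subseteq> J n)
      \<longrightarrow> (\<exists>n. \<forall>m\<ge>n. J m = J n))"

context left_module begin

text \<open>The descending chain condition for extensions. The sets \<open>D n\<close> stand for the images of \<open>J n\<close>
  modulo \<open>V\<close>; they need not be formed in a quotient module, as long as an element of \<open>J n\<close> can be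
  corrected by an element of \<open>V\<close> to lie in \<open>J m\<close> once \<open>D m = D n\<close>.\<close>

lemma chain_stabilizes_by_extension:
  assumes J: "\<And>n. submodule (J n) R M" "\<And>n. J (Suc n) \<subseteq> J n"
    and V: "submodule V R M" "artinian_on R M V"
    and D: "\<exists>n. \<forall>m\<ge>n. D m = D n"
    and step: "\<And>n m x. \<lbrakk>n \<le> m; D m = D n; x \<in> J n\<rbrakk> \<Longrightarrow> \<exists>x'\<in>J m. x \<ominus>\<^bsub>M\<^esub> x' \<in> V"
  shows "\<exists>n::nat. \<forall>m\<ge>n. J m = J n"
proof -
  have "\<exists>n. \<forall>m\<ge>n. J m \<inter> V = J n \<inter> V"
    using V(2)[unfolded artinian_on_def, rule_format, of "\<lambda>n. J n \<inter> V"] J V(1) submodule_Int by blast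
  then obtain n1 where n1: "\<And>m. m \<ge> n1 \<Longrightarrow> J m \<inter> V = J n1 \<inter> V" by blast
  obtain n2 where n2: "\<And>m. m \<ge> n2 \<Longrightarrow> D m = D n2" using D by blast
  let ?n = "max n1 n2"
  have "J m = J ?n" if m: "m \<ge> ?n" for m
  proof
    show mn: "J m \<subseteq> J ?n" by (rule lift_Suc_antimono_le[of J, OF J(2) m])
    show "J ?n \<subseteq> J m"
    proof
      fix x assume x: "x \<in> J ?n"
      have "D m = D ?n" using n2[of m] n2[of ?n] m by simp
      then obtain x' where x': "x' \<in> J m" "x \<ominus>\<^bsub>M\<^esub> x' \<in> V" using step[OF m _ x] by blast
      have "x \<ominus>\<^bsub>M\<^esub> x' \<in> J ?n" using x x' mn submoduleD(7)[OF J(1)] by blast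
      then have "x \<ominus>\<^bsub>M\<^esub> x' \<in> J m" using x'(2) n1[of m] n1[of ?n] m by auto
      then have "(x \<ominus>\<^bsub>M\<^esub> x') \<oplus>\<^bsub>M\<^esub> x' \<in> J m" using x' submoduleD(4)[OF J(1)] by blast
      then show "x \<in> J m"
        using submoduleD(3)[OF J(1) x] submoduleD(3)[OF J(1) x'(1)] by simp
    qed
  qed
  then show ?thesis by blast
qed

lemma submodule_cyclic:
  assumes "s \<in> carrier M" shows "submodule ((\<lambda>k. k \<odot>\<^bsub>M\<^esub> s) ` carrier R) R M"
  unfolding submodule_iff
proof (intro conjI ballI)
  show "\<zero>\<^bsub>M\<^esub> \<in> (\<lambda>k. k \<odot>\<^bsub>M\<^esub> s) ` carrier R" using assms by (intro image_eqI[of _ _ \<zero>]) auto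
  fix x y assume "x \<in> (\<lambda>k. k \<odot>\<^bsub>M\<^esub> s) ` carrier R" "y \<in> (\<lambda>k. k \<odot>\<^bsub>M\<^esub> s) ` carrier R"
  then obtain k l where "k \<in> carrier R" "l \<in> carrier R" "x = k \<odot>\<^bsub>M\<^esub> s" "y = l \<odot>\<^bsub>M\<^esub> s" by blast
  then show "x \<oplus>\<^bsub>M\<^esub> y \<in> (\<lambda>k. k \<odot>\<^bsub>M\<^esub> s) ` carrier R"
    using assms by (intro image_eqI[of _ _ "k \<oplus> l"]) (auto simp: smult_l_distr)
next
  fix r x assume "r \<in> carrier R" "x \<in> (\<lambda>k. k \<odot>\<^bsub>M\<^esub> s) ` carrier R"
  then obtain k where "k \<in> carrier R" "x = k \<odot>\<^bsub>M\<^esub> s" by blast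
  then show "r \<odot>\<^bsub>M\<^esub> x \<in> (\<lambda>k. k \<odot>\<^bsub>M\<^esub> s) ` carrier R"
    using assms \<open>r \<in> carrier R\<close> by (intro image_eqI[of _ _ "r \<otimes> k"]) (auto simp: smult_assoc1)
qed (use assms in auto)

end

definition regular_module :: "('r, 'c) ring_scheme \<Rightarrow> ('r, 'r) module"
  where "regular_module R = \<lparr>carrier = carrier R, mult = undefined, one = undefined,
    zero = \<zero>\<^bsub>R\<^esub>, add = add R, smult = mult R\<rparr>"

lemma regular_module_simps [simp]:
  "carrier (regular_module R) = carrier R" "\<zero>\<^bsub>regular_module R\<^esub> = \<zero>\<^bsub>R\<^esub>"
  "x \<oplus>\<^bsub>regular_module R\<^esub> y = x \<oplus>\<^bsub>R\<^esub> y" "x \<odot>\<^bsub>regular_module R\<^esub> y = x \<otimes>\<^bsub>R\<^esub> y"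
  by (simp_all add: regular_module_def)

lemma left_module_regular:
  assumes "ring R" shows "left_module R (regular_module R)"
proof -
  interpret ring R by fact
  have "abelian_group (regular_module R)"
    by (rule abelian_groupI) (auto simp: regular_module_def a_ac intro: bexI[of _ "\<ominus>\<^bsub>R\<^esub> x" for x] l_neg)
  then show ?thesis
    by (intro left_module.intro ring_axioms left_module_axioms.intro)
      (auto simp: regular_module_def l_distr r_distr m_assoc)
qed

lemma ideal_of_submodule:
  assumes "cring K" "submodule J K (regular_module K)"
  shows "ideal J K"
proof -
  interpret cring K by fact
  interpret S: left_module K "regular_module K" by (rule left_module_regular[OF ring_axioms])
  note D = S.submoduleD[OF assms(2)]
  have sub: "J \<subseteq> carrier K" using D(1) by (simp add: regular_module_def)
  have minus: "\<ominus>\<^bsub>K\<^esub> x \<in> J" if "x \<in> J" for x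
  proof -
    have "(\<ominus>\<^bsub>K\<^esub> \<one>\<^bsub>K\<^esub>) \<otimes>\<^bsub>K\<^esub> x \<in> J" using D(5)[of "\<ominus>\<^bsub>K\<^esub> \<one>\<^bsub>K\<^esub>" x] that by (simp add: regular_module_def)
    then show ?thesis using that sub by (simp add: l_minus subset_iff)
  qed
  have mult: "a \<otimes>\<^bsub>K\<^esub> x \<in> J" "x \<otimes>\<^bsub>K\<^esub> a \<in> J" if "a \<in> J" "x \<in> carrier K" for a x
    using D(5)[OF that(2,1)] m_comm[of a x] that sub by (auto simp: regular_module_def)
  have "subgroup J (add_monoid K)"
    using D(2,4) minus sub by (intro add.subgroupI) (auto simp: regular_module_def a_inv_def[symmetric])
  then show ?thesis
    using mult by (intro idealI ring_axioms)
qed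

locale artinian_scalars = left_module +
  assumes artinian: "artinian_cring R"
begin

sublocale R: cring R using artinian by (simp add: artinian_cring_def)

lemma ideal_chain_stabilizes:
  assumes "\<And>n. submodule (D n) R (regular_module R)" "\<And>n. D (Suc n) \<subseteq> D n"
  shows "\<exists>n::nat. \<forall>m\<ge>n. D m = D n"
  using artinian assms ideal_of_submodule[OF R.is_cring] unfolding artinian_cring_def by blast

lemma artinian_on_zero: "artinian_on R M {\<zero>\<^bsub>M\<^esub>}"
  unfolding artinian_on_def
proof (intro allI impI exI[of _ 0])
  fix J :: "nat \<Rightarrow> 'c set" and m :: nat
  assume J: "\<forall>n. submodule (J n) R M \<and> J n \<subseteq> {\<zero>\<^bsub>M\<^esub>} \<and> J (Suc n) \<subseteq> J n"
  then have "J n = {\<zero>\<^bsub>M\<^esub>}" for n using submoduleD(2)[of "J n"] by blast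
  then show "J m = J 0" by simp
qed

text \<open>Adding one generator \<open>s\<close> to an Artinian submodule \<open>U\<close> is an extension: a chain in \<open>R s + U\<close> is
  controlled by its trace on \<open>U\<close> and by the ideals of those \<open>k\<close> for which some \<open>k s + u\<close> lies in the
  chain, and the latter stabilize because the ring is Artinian.\<close>

lemma artinian_on_finite_span:
  assumes "finite S" "S \<subseteq> carrier M"
  shows "\<exists>U. submodule U R M \<and> S \<subseteq> U \<and> artinian_on R M U"
  using assms
proof (induction S)
  case empty
  then show ?case using submodule_zero artinian_on_zero by blast
next
  case (insert s S)
  then obtain U where U: "submodule U R M" "S \<subseteq> U" "artinian_on R M U" by auto
  have s: "s \<in> carrier M" using insert.prems by simp
  let ?C = "(\<lambda>k. k \<odot>\<^bsub>M\<^esub> s) ` carrier R"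
  note C = submodule_cyclic[OF s]
  note sum = submodule_set_add[OF C U(1)]
  have "\<one> \<odot>\<^bsub>M\<^esub> s \<in> ?C" by blast
  then have "s \<in> ?C" using s by simp
  interpret S: left_module R "regular_module R" by (rule left_module_regular[OF R.ring_axioms])
  note UD = submoduleD[OF U(1)]
  have "artinian_on R M (?C <+>\<^bsub>M\<^esub> U)"
    unfolding artinian_on_def
  proof (intro allI impI)
    fix J :: "nat \<Rightarrow> 'c set"
    assume "\<forall>n. submodule (J n) R M \<and> J n \<subseteq> ?C <+>\<^bsub>M\<^esub> U \<and> J (Suc n) \<subseteq> J n"
    then have J: "\<And>n. submodule (J n) R M" "\<And>n. J n \<subseteq> ?C <+>\<^bsub>M\<^esub> U" "\<And>n. J (Suc n) \<subseteq> J n" by auto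
    note JD = submoduleD[OF J(1)]
    define D where "D n = {k \<in> carrier R. \<exists>u\<in>U. k \<odot>\<^bsub>M\<^esub> s \<oplus>\<^bsub>M\<^esub> u \<in> J n}" for n
    have D: "submodule (D n) R (regular_module R)" for n
      unfolding S.submodule_iff
    proof (intro conjI ballI)
      show "D n \<subseteq> carrier (regular_module R)" by (auto simp: D_def regular_module_def)
      have "\<zero> \<odot>\<^bsub>M\<^esub> s \<oplus>\<^bsub>M\<^esub> \<zero>\<^bsub>M\<^esub> \<in> J n" using JD(2) s by simp
      then show "\<zero>\<^bsub>regular_module R\<^esub> \<in> D n"
        using UD(2) unfolding D_def regular_module_def by auto
      fix k l assume "k \<in> D n" "l \<in> D n"
      then obtain u v where *: "k \<in> carrier R" "l \<in> carrier R" "u \<in> U" "v \<in> U"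
        "k \<odot>\<^bsub>M\<^esub> s \<oplus>\<^bsub>M\<^esub> u \<in> J n" "l \<odot>\<^bsub>M\<^esub> s \<oplus>\<^bsub>M\<^esub> v \<in> J n" by (auto simp: D_def)
      have "(k \<oplus> l) \<odot>\<^bsub>M\<^esub> s \<oplus>\<^bsub>M\<^esub> (u \<oplus>\<^bsub>M\<^esub> v) = (k \<odot>\<^bsub>M\<^esub> s \<oplus>\<^bsub>M\<^esub> u) \<oplus>\<^bsub>M\<^esub> (l \<odot>\<^bsub>M\<^esub> s \<oplus>\<^bsub>M\<^esub> v)"
        using * s UD(3) by (simp add: smult_l_distr M.a_ac)
      then have "(k \<oplus> l) \<odot>\<^bsub>M\<^esub> s \<oplus>\<^bsub>M\<^esub> (u \<oplus>\<^bsub>M\<^esub> v) \<in> J n" using *(5,6) JD(4) by simp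
      then show "k \<oplus>\<^bsub>regular_module R\<^esub> l \<in> D n"
        using * UD(4) unfolding D_def regular_module_def by auto
    next
      fix r k assume r: "r \<in> carrier R" and "k \<in> D n"
      then obtain u where *: "k \<in> carrier R" "u \<in> U" "k \<odot>\<^bsub>M\<^esub> s \<oplus>\<^bsub>M\<^esub> u \<in> J n" by (auto simp: D_def)
      have "(r \<otimes> k) \<odot>\<^bsub>M\<^esub> s \<oplus>\<^bsub>M\<^esub> r \<odot>\<^bsub>M\<^esub> u = r \<odot>\<^bsub>M\<^esub> (k \<odot>\<^bsub>M\<^esub> s \<oplus>\<^bsub>M\<^esub> u)"
        using * s UD(3) r by (simp add: smult_r_distr smult_assoc1)
      then have "(r \<otimes> k) \<odot>\<^bsub>M\<^esub> s \<oplus>\<^bsub>M\<^esub> r \<odot>\<^bsub>M\<^esub> u \<in> J n" using *(3) JD(5) r by simp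
      then show "r \<odot>\<^bsub>regular_module R\<^esub> k \<in> D n"
        using * r UD(5)[OF r *(2)] unfolding D_def regular_module_def by auto
    qed
    have "D (Suc n) \<subseteq> D n" for n using J(3)[of n] by (auto simp: D_def)
    note stable = ideal_chain_stabilizes[of D, OF D this]
    show "\<exists>n. \<forall>m\<ge>n. J m = J n"
    proof (rule chain_stabilizes_by_extension[of J, OF J(1) J(3) U(1,3) stable])
      fix n m x assume "n \<le> m" "D m = D n" "x \<in> J n"
      then obtain k u where ku: "k \<in> carrier R" "u \<in> U" "x = k \<odot>\<^bsub>M\<^esub> s \<oplus>\<^bsub>M\<^esub> u"
        using J(2)[of n] by (auto simp: set_add_def')
      then have "k \<in> D m" using \<open>D m = D n\<close> \<open>x \<in> J n\<close> by (auto simp: D_def)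
      then obtain v where v: "v \<in> U" "k \<odot>\<^bsub>M\<^esub> s \<oplus>\<^bsub>M\<^esub> v \<in> J m" by (auto simp: D_def)
      have "x \<ominus>\<^bsub>M\<^esub> (k \<odot>\<^bsub>M\<^esub> s \<oplus>\<^bsub>M\<^esub> v) = (k \<odot>\<^bsub>M\<^esub> s \<oplus>\<^bsub>M\<^esub> \<ominus>\<^bsub>M\<^esub> (k \<odot>\<^bsub>M\<^esub> s)) \<oplus>\<^bsub>M\<^esub> (u \<ominus>\<^bsub>M\<^esub> v)"
        using ku v s UD(3) by (simp add: a_minus_def M.minus_add M.a_ac)
      also have "\<dots> = u \<ominus>\<^bsub>M\<^esub> v" using ku v s UD(3,7) by (simp add: M.r_neg)
      also have "\<dots> \<in> U" using ku v UD(7) by simp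
      finally show "\<exists>x'\<in>J m. x \<ominus>\<^bsub>M\<^esub> x' \<in> U" using v(2) by blast
    qed
  qed
  moreover have "insert s S \<subseteq> ?C <+>\<^bsub>M\<^esub> U" using sum(2,3) \<open>s \<in> ?C\<close> U(2) by blast
  ultimately show ?case using sum(1) by blast
qed

lemma artinian_on_finitely_generated:
  assumes "finitely_generated R M" shows "artinian_on R M (carrier M)"
proof -
  obtain S where S: "finite S" "S \<subseteq> carrier M" "\<And>W. submodule W R M \<Longrightarrow> S \<subseteq> W \<Longrightarrow> carrier M \<subseteq> W"
    using assms unfolding finitely_generated_iff by (rule finitely_spannedE) iprover
  obtain U where U: "submodule U R M" "S \<subseteq> U" "artinian_on R M U"
    using artinian_on_finite_span[OF S(1,2)] by blast
  have "U = carrier M" using S(3)[OF U(1,2)] submoduleD(1)[OF U(1)] by blast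
  then show ?thesis using U(3) by simp
qed

lemma submodule_scale:
  assumes k: "k \<in> carrier R" and U: "submodule U R M"
  shows "submodule ((\<lambda>x. k \<odot>\<^bsub>M\<^esub> x) ` U) R M" "submodule {x \<in> U. k \<odot>\<^bsub>M\<^esub> x = \<zero>\<^bsub>M\<^esub>} R M"
proof -
  interpret module_map R M M "\<lambda>x. k \<odot>\<^bsub>M\<^esub> x"
    using k by unfold_locales (auto intro!: module_homI simp: smult_r_distr smult_assoc1[symmetric] R.m_comm)
  show "submodule ((\<lambda>x. k \<odot>\<^bsub>M\<^esub> x) ` U) R M" by (rule submodule_image[OF U])
  have "{x \<in> U. k \<odot>\<^bsub>M\<^esub> x = \<zero>\<^bsub>M\<^esub>} = U \<inter> {x \<in> carrier M. k \<odot>\<^bsub>M\<^esub> x \<in> {\<zero>\<^bsub>M\<^esub>}}"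
    using submoduleD(1)[OF U] by blast
  then show "submodule {x \<in> U. k \<odot>\<^bsub>M\<^esub> x = \<zero>\<^bsub>M\<^esub>} R M"
    using submodule_Int[OF U submodule_preimage[OF submodule_zero]] by simp
qed

text \<open>Multiplication by \<open>k\<close> exhibits \<open>U\<close> as an extension of \<open>k U\<close> by its kernel.\<close>

lemma finitely_spanned_scale:
  assumes k: "k \<in> carrier R" and U: "submodule U R M"
    and im: "finitely_spanned R M ((\<lambda>x. k \<odot>\<^bsub>M\<^esub> x) ` U)"
    and ker: "finitely_spanned R M {x \<in> U. k \<odot>\<^bsub>M\<^esub> x = \<zero>\<^bsub>M\<^esub>}"
  shows "finitely_spanned R M U"
proof -
  obtain S1 where S1: "finite S1" "S1 \<subseteq> (\<lambda>x. k \<odot>\<^bsub>M\<^esub> x) ` U"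
    "\<And>W. submodule W R M \<Longrightarrow> S1 \<subseteq> W \<Longrightarrow> (\<lambda>x. k \<odot>\<^bsub>M\<^esub> x) ` U \<subseteq> W"
    using im by (rule finitely_spannedE) iprover
  obtain S2 where S2: "finite S2" "S2 \<subseteq> {x \<in> U. k \<odot>\<^bsub>M\<^esub> x = \<zero>\<^bsub>M\<^esub>}"
    "\<And>W. submodule W R M \<Longrightarrow> S2 \<subseteq> W \<Longrightarrow> {x \<in> U. k \<odot>\<^bsub>M\<^esub> x = \<zero>\<^bsub>M\<^esub>} \<subseteq> W"
    using ker by (rule finitely_spannedE) iprover
  obtain T where T: "finite T" "T \<subseteq> U" "S1 = (\<lambda>x. k \<odot>\<^bsub>M\<^esub> x) ` T"
    using finite_subset_image[OF S1(1,2)] by blast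
  note UD = submoduleD[OF U]
  have "U \<subseteq> W" if W: "submodule W R M" "T \<union> S2 \<subseteq> W" for W
  proof
    note WU = submodule_Int[OF W(1) U]
    fix x assume x: "x \<in> U"
    have "S1 \<subseteq> (\<lambda>x. k \<odot>\<^bsub>M\<^esub> x) ` (W \<inter> U)" using T W(2) by blast
    then have "k \<odot>\<^bsub>M\<^esub> x \<in> (\<lambda>x. k \<odot>\<^bsub>M\<^esub> x) ` (W \<inter> U)"
      using S1(3)[OF submodule_scale(1)[OF k WU]] x by blast
    then obtain w where w: "w \<in> W" "w \<in> U" "k \<odot>\<^bsub>M\<^esub> x = k \<odot>\<^bsub>M\<^esub> w" by blast
    then have "k \<odot>\<^bsub>M\<^esub> (x \<ominus>\<^bsub>M\<^esub> w) = \<zero>\<^bsub>M\<^esub>"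
      using x UD(3) k by (simp add: smult_r_diff) (simp add: a_minus_def M.r_neg)
    then have "x \<ominus>\<^bsub>M\<^esub> w \<in> W" using S2(3)[OF W(1)] W(2) UD(7)[OF x w(2)] by blast
    then have "(x \<ominus>\<^bsub>M\<^esub> w) \<oplus>\<^bsub>M\<^esub> w \<in> W" using w(1) submoduleD(4)[OF W(1)] by blast
    then show "x \<in> W" using x w(2) UD(3) by simp
  qed
  moreover have "finite (T \<union> S2)" "T \<union> S2 \<subseteq> U" using T S2 by auto
  ultimately show ?thesis by (intro finitely_spannedI[of "T \<union> S2"])
qed

lemma minimal_submodule:
  assumes "artinian_on R M (carrier M)" "submodule U R M" "P U"
  shows "\<exists>V. submodule V R M \<and> P V \<and> (\<forall>W. submodule W R M \<and> W \<subset> V \<longrightarrow> \<not> P W)"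
proof (rule ccontr)
  assume "\<not> ?thesis"
  then have next': "\<exists>W. (submodule W R M \<and> P W) \<and> W \<subset> V" if "submodule V R M \<and> P V" for V
    using that by blast
  obtain J where J: "\<And>n::nat. submodule (J n) R M \<and> P (J n)" "\<And>n. J (Suc n) \<subset> J n"
  proof (rule exE[OF dependent_nat_choice[of "\<lambda>_ V. submodule V R M \<and> P V" "\<lambda>_ V W. W \<subset> V"]])
    show "\<exists>V. submodule V R M \<and> P V" using assms(2,3) by blast
    show "\<exists>W. (submodule W R M \<and> P W) \<and> W \<subset> V" if "submodule V R M \<and> P V" for V
      by (rule next'[OF that])
  qed blast
  then have "\<exists>n. \<forall>m\<ge>n. J m = J n"
    using assms(1)[unfolded artinian_on_def, rule_format, of J] submoduleD(1) by blast
  then show False using J(2) by (metis le_SucI order_refl psubset_eq)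
qed

text \<open>Suppose not and take a minimal submodule \<open>U\<close> that is not finitely generated. By
  \<open>finitely_spanned_scale\<close> every scalar \<open>k\<close> satisfies \<open>k U = U\<close> or \<open>k U = 0\<close>. As the powers of \<open>k\<close>
  generate a stationary chain of ideals, a scalar with \<open>k U = U\<close> has an inverse on \<open>U\<close>, so \<open>U\<close> behaves
  like a vector space. For \<open>x \<noteq> 0\<close> in \<open>U\<close>, a submodule \<open>V\<close> of \<open>U\<close> that is maximal without \<open>x\<close> then
  has \<open>U = V + R x\<close>. Being proper, \<open>V\<close> is finitely generated, and hence so is \<open>U\<close>.\<close>

lemma finitely_spanned_if_artinian:
  assumes art: "artinian_on R M (carrier M)"
    and "submodule U0 R M"
  shows "finitely_spanned R M U0"
proof (rule ccontr)
  assume "\<not> finitely_spanned R M U0"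
  then obtain U where U: "submodule U R M" "\<not> finitely_spanned R M U"
    and min: "\<And>W. submodule W R M \<Longrightarrow> W \<subset> U \<Longrightarrow> finitely_spanned R M W"
    using minimal_submodule[OF art assms(2), of "\<lambda>U. \<not> finitely_spanned R M U"] by blast
  note UD = submoduleD[OF U(1)]
  have dichotomy: "(\<lambda>x. k \<odot>\<^bsub>M\<^esub> x) ` U = U \<or> (\<forall>x\<in>U. k \<odot>\<^bsub>M\<^esub> x = \<zero>\<^bsub>M\<^esub>)" if k: "k \<in> carrier R" for k
  proof (rule ccontr)
    assume n: "\<not> ?thesis"
    have "(\<lambda>x. k \<odot>\<^bsub>M\<^esub> x) ` U \<subset> U" "{x \<in> U. k \<odot>\<^bsub>M\<^esub> x = \<zero>\<^bsub>M\<^esub>} \<subset> U" using n k UD(5) by auto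
    then show False
      using U(2) finitely_spanned_scale[OF k U(1)] min submodule_scale[OF k U(1)] by blast
  qed
  have nz: "\<exists>x\<in>U. x \<noteq> \<zero>\<^bsub>M\<^esub>"
  proof (rule ccontr)
    assume "\<not> ?thesis"
    then have "U = {\<zero>\<^bsub>M\<^esub>}" using UD(2) by blast
    then show False using U(2) submoduleD(2) finitely_spannedI[of "{}" U] by blast
  qed
  then obtain x where x: "x \<in> U" "x \<noteq> \<zero>\<^bsub>M\<^esub>" by blast
  have invertible: "\<exists>r\<in>carrier R. \<forall>y\<in>U. r \<odot>\<^bsub>M\<^esub> (k \<odot>\<^bsub>M\<^esub> y) = y"
    if k: "k \<in> carrier R" and kU: "\<exists>y\<in>U. k \<odot>\<^bsub>M\<^esub> y \<noteq> \<zero>\<^bsub>M\<^esub>" for k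
  proof -
    interpret S: left_module R "regular_module R" by (rule left_module_regular[OF R.ring_axioms])
    have "\<exists>n::nat. \<forall>m\<ge>n. (\<lambda>l. l \<odot>\<^bsub>regular_module R\<^esub> (k [^] m)) ` carrier R
        = (\<lambda>l. l \<odot>\<^bsub>regular_module R\<^esub> (k [^] n)) ` carrier R"
    proof (rule ideal_chain_stabilizes)
      fix n :: nat
      show "submodule ((\<lambda>l. l \<odot>\<^bsub>regular_module R\<^esub> (k [^] n)) ` carrier R) R (regular_module R)"
        using k by (intro S.submodule_cyclic) (simp add: regular_module_def)
      show "(\<lambda>l. l \<odot>\<^bsub>regular_module R\<^esub> (k [^] Suc n)) ` carrier R
          \<subseteq> (\<lambda>l. l \<odot>\<^bsub>regular_module R\<^esub> (k [^] n)) ` carrier R"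
      proof
        fix y assume "y \<in> (\<lambda>l. l \<odot>\<^bsub>regular_module R\<^esub> (k [^] Suc n)) ` carrier R"
        then obtain l where l: "l \<in> carrier R" "y = l \<otimes> (k [^] Suc n)"
          by (auto simp: regular_module_def)
        then have "y = (l \<otimes> k) \<otimes> (k [^] n)" using k by (simp add: R.m_ac)
        then show "y \<in> (\<lambda>l. l \<odot>\<^bsub>regular_module R\<^esub> (k [^] n)) ` carrier R"
          using l k by (auto simp: regular_module_def)
      qed
    qed
    then have "\<exists>n::nat. \<forall>m\<ge>n. (\<lambda>l. l \<otimes> (k [^] m)) ` carrier R = (\<lambda>l. l \<otimes> (k [^] n)) ` carrier R"
      by (simp add: regular_module_def)
    then obtain n :: nat where
      n: "\<forall>m\<ge>n. (\<lambda>l. l \<otimes> (k [^] m)) ` carrier R = (\<lambda>l. l \<otimes> (k [^] n)) ` carrier R" by (rule exE)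
    have "\<one> \<otimes> k [^] n \<in> (\<lambda>l. l \<otimes> (k [^] Suc n)) ` carrier R" using n[rule_format, of "Suc n"] by auto
    then obtain r where r: "r \<in> carrier R" "k [^] n = r \<otimes> (k [^] n \<otimes> k)" using k by auto
    \<comment> \<open>Since \<open>k\<^sup>n c = 0\<close> and \<open>k\<^sup>n U = U\<close>, the alternative \<open>c U = U\<close> is impossible, so \<open>r k\<close> is the identity on \<open>U\<close>.\<close>
    define c where "c = \<one> \<ominus> r \<otimes> k"
    have c: "c \<in> carrier R" using r k by (simp add: c_def)
    have "(k [^] n) \<otimes> c = (k [^] n) \<ominus> r \<otimes> (k [^] n \<otimes> k)"
      using r(1) k by (simp add: c_def a_minus_def R.r_distr R.r_minus R.m_ac)
    also have "\<dots> = \<zero>" using r(2) k by (simp add: a_minus_def R.r_neg flip: r(2))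
    finally have c0: "(k [^] n) \<otimes> c = \<zero>" .
    have kU': "(\<lambda>x. k \<odot>\<^bsub>M\<^esub> x) ` U = U" using dichotomy[OF k] kU by blast
    have pow: "\<exists>z\<in>U. (k [^] m) \<odot>\<^bsub>M\<^esub> z = y" if "y \<in> U" for m :: nat and y
      using that
    proof (induction m arbitrary: y)
      case (Suc m)
      then obtain z where z: "z \<in> U" "(k [^] m) \<odot>\<^bsub>M\<^esub> z = y" by blast
      then obtain w where "w \<in> U" "z = k \<odot>\<^bsub>M\<^esub> w" using kU' by blast
      then show ?case using z k UD(3) by (auto simp: smult_assoc1)
    qed (use UD(3) in auto)
    have c_kills: "c \<odot>\<^bsub>M\<^esub> y = \<zero>\<^bsub>M\<^esub>" if y: "y \<in> U" for y
    proof (rule ccontr)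
      assume "c \<odot>\<^bsub>M\<^esub> y \<noteq> \<zero>\<^bsub>M\<^esub>"
      then have cU: "(\<lambda>x. c \<odot>\<^bsub>M\<^esub> x) ` U = U" using dichotomy[OF c] y by blast
      obtain z where z: "z \<in> U" "(k [^] n) \<odot>\<^bsub>M\<^esub> z = x" using pow[OF x(1)] by blast
      obtain w where w: "w \<in> U" "z = c \<odot>\<^bsub>M\<^esub> w" using cU z(1) by blast
      have "x = ((k [^] n) \<otimes> c) \<odot>\<^bsub>M\<^esub> w" using z w c k UD(3) by (simp add: smult_assoc1)
      then show False using c0 x(2) w(1) UD(3) by simp
    qed
    have "r \<odot>\<^bsub>M\<^esub> (k \<odot>\<^bsub>M\<^esub> y) = y" if y: "y \<in> U" for y
    proof -
      have "\<one> = c \<oplus> r \<otimes> k" using r k by (simp add: c_def a_minus_def R.a_assoc R.l_neg)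
      then have "\<one> \<odot>\<^bsub>M\<^esub> y = c \<odot>\<^bsub>M\<^esub> y \<oplus>\<^bsub>M\<^esub> (r \<otimes> k) \<odot>\<^bsub>M\<^esub> y"
        using smult_l_distr[of c "r \<otimes> k" y] r k c UD(3)[OF y] by simp
      then show ?thesis using c_kills[OF y] UD(3)[OF y] r k by (simp add: smult_assoc1)
    qed
    then show ?thesis using r by blast
  qed
  \<comment> \<open>Avoiding the complement of \<open>U\<close> as well keeps \<open>V\<close> inside \<open>U\<close>.\<close>
  obtain V where V: "submodule V R M" "V \<inter> ({x} \<union> (carrier M - U)) = {}"
    and max: "\<And>W. \<lbrakk>submodule W R M; V \<subseteq> W; W \<inter> ({x} \<union> (carrier M - U)) = {}\<rbrakk> \<Longrightarrow> W = V"
    using maximal_submodule_avoiding[OF submodule_zero, of "{x} \<union> (carrier M - U)"] x(2) UD(2) by auto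
  have VU: "V \<subset> U" using V(2) submoduleD(1)[OF V(1)] x(1) by blast
  obtain S where S: "finite S" "S \<subseteq> V" "\<And>W. submodule W R M \<Longrightarrow> S \<subseteq> W \<Longrightarrow> V \<subseteq> W"
    using min[OF V(1) VU] by (rule finitely_spannedE) iprover
  have "U \<subseteq> W" if W: "submodule W R M" "insert x S \<subseteq> W" for W
  proof
    note WD = submoduleD[OF W(1)]
    have VW: "V \<subseteq> W" using S(3) W by blast
    fix y assume y: "y \<in> U"
    let ?C = "(\<lambda>k. k \<odot>\<^bsub>M\<^esub> y) ` carrier R"
    have yM: "y \<in> carrier M" using UD(3) y .
    note sum = submodule_set_add[OF V(1) submodule_cyclic[OF yM]]
    have sumU: "V <+>\<^bsub>M\<^esub> ?C \<subseteq> U" using VU UD(4,5) y by (auto simp: set_add_def' subset_iff psubset_eq)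
    show "y \<in> W"
    proof (cases "x \<in> V <+>\<^bsub>M\<^esub> ?C")
      case True
      then obtain v k where vk: "v \<in> V" "k \<in> carrier R" "x = v \<oplus>\<^bsub>M\<^esub> k \<odot>\<^bsub>M\<^esub> y" by (auto simp: set_add_def')
      have vM: "v \<in> carrier M" using submoduleD(3)[OF V(1) vk(1)] .
      have "k \<odot>\<^bsub>M\<^esub> y \<noteq> \<zero>\<^bsub>M\<^esub>" using vk vM V(2) by auto
      then obtain r where r: "r \<in> carrier R" "r \<odot>\<^bsub>M\<^esub> (k \<odot>\<^bsub>M\<^esub> y) = y" using invertible[OF vk(2)] y by blast
      have "k \<odot>\<^bsub>M\<^esub> y = x \<ominus>\<^bsub>M\<^esub> v"
        using vk vM yM by (simp add: a_minus_def M.a_ac M.r_neg2 M.r_neg1)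
      moreover have "x \<ominus>\<^bsub>M\<^esub> v \<in> W" using W(2) VW vk(1) WD(7) by blast
      ultimately show ?thesis using r WD(5) by metis
    next
      case False
      then have "V <+>\<^bsub>M\<^esub> ?C = V" using max[OF sum(1,2)] sumU by blast
      moreover have "\<one> \<odot>\<^bsub>M\<^esub> y \<in> ?C" by blast
      ultimately show ?thesis using sum(3) VW yM by auto
    qed
  qed
  then have "finitely_spanned R M U"
    using S(1,2) VU x(1) by (intro finitely_spannedI[of "insert x S"]) auto
  then show False using U(2) by blast
qed

end

text \<open>Finitely many homomorphisms that are jointly injective embed \<open>X\<close> into a finite power of \<open>W\<close>. Instead
  of forming the power, the maps are added one at a time, each step being an extension of a
  submodule of \<open>W\<close> by the common kernel.\<close>

lemma artinian_on_jointly_injective: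
  assumes X: "left_module R X" and W: "left_module R W" "artinian_on R W (carrier W)"
    and F: "finite F" "F \<subseteq> module_hom R X W"
    and inj: "\<And>x. x \<in> carrier X \<Longrightarrow> (\<And>f. f \<in> F \<Longrightarrow> f x = \<zero>\<^bsub>W\<^esub>) \<Longrightarrow> x = \<zero>\<^bsub>X\<^esub>"
    and art: "artinian_on R X {\<zero>\<^bsub>X\<^esub>}"
  shows "artinian_on R X (carrier X)"
proof -
  interpret X: left_module R X by fact
  interpret W: left_module R W by fact
  let ?N = "\<lambda>G. {x \<in> carrier X. \<forall>f\<in>G. f x = \<zero>\<^bsub>W\<^esub>}"
  have sub: "submodule (?N G) R X" if "G \<subseteq> F" for G
  proof -
    have "module_map R X W f" if "f \<in> G" for f
      using that \<open>G \<subseteq> F\<close> F(2) X W(1) by (auto simp: module_map_def module_map_axioms_def)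
    then have "submodule {x \<in> carrier X. f x \<in> {\<zero>\<^bsub>W\<^esub>}} R X" if "f \<in> G" for f
      using that by (intro module_map.submodule_preimage[of R X W] W.submodule_zero)
    note D = X.submoduleD[OF this]
    show ?thesis
      unfolding X.submodule_iff using D(2,4,5) by blast
  qed
  have N: "?N F = {\<zero>\<^bsub>X\<^esub>}"
    using sub[of F] X.submoduleD(2)[of "?N F"] inj by blast
  have "artinian_on R X (?N G) \<Longrightarrow> artinian_on R X (?N {})" if "finite G" "G \<subseteq> F" for G
    using that
  proof (induction G)
    case (insert f G)
    interpret f: module_map R X W f
      using insert.prems(2) F(2) X W(1) by (auto simp: module_map_def module_map_axioms_def)
    have "artinian_on R X (?N G)"
      unfolding artinian_on_def
    proof (intro allI impI)
      fix J :: "nat \<Rightarrow> 'c set"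
      assume "\<forall>n. submodule (J n) R X \<and> J n \<subseteq> ?N G \<and> J (Suc n) \<subseteq> J n"
      then have J: "\<And>n. submodule (J n) R X" "\<And>n. J n \<subseteq> ?N G" "\<And>n. J (Suc n) \<subseteq> J n" by auto
      have "submodule (f ` J n) R W" "f ` J n \<subseteq> carrier W" "f ` J (Suc n) \<subseteq> f ` J n" for n
        using f.submodule_image[OF J(1)] W.submoduleD(1) J(3) by blast+
      then have stable: "\<exists>n. \<forall>m\<ge>n. f ` J m = f ` J n"
        using W(2)[unfolded artinian_on_def, rule_format, of "\<lambda>n. f ` J n"] by blast
      show "\<exists>n. \<forall>m\<ge>n. J m = J n"
      proof (rule X.chain_stabilizes_by_extension[of J, OF J(1) J(3) sub insert.prems(1) stable])
        fix n m x assume nm: "n \<le> m" "f ` J m = f ` J n" "x \<in> J n"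
        then obtain x' where x': "x' \<in> J m" "f x = f x'" by blast
        have "x' \<in> J n" using x'(1) lift_Suc_antimono_le[of J, OF J(3) nm(1)] by blast
        then have "x \<ominus>\<^bsub>X\<^esub> x' \<in> ?N G"
          using X.submoduleD(7)[OF sub[of G]] insert.prems nm(3) J(2)[of n] by blast
        moreover have "f (x \<ominus>\<^bsub>X\<^esub> x') = \<zero>\<^bsub>W\<^esub>"
          using x' nm(3) X.submoduleD(3)[OF J(1)]
          by (simp add: f.diff) (simp add: a_minus_def f.closed W.M.r_neg)
        ultimately show "\<exists>x'\<in>J m. x \<ominus>\<^bsub>X\<^esub> x' \<in> ?N (insert f G)" using x'(1) by blast
      qed (use insert.prems in auto)
    qed
    then show ?case using insert by auto
  qed simp
  from this[OF F(1) subset_refl] show ?thesis using art unfolding N by simp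
qed

section \<open>Restriction of scalars and finite algebras\<close>

text \<open>Ring homomorphisms that need not preserve the unit, such as the inclusion of a corner \<open>eLe\<close>
  into \<open>L\<close>.\<close>

definition rng_hom :: "('a, 'c) ring_scheme \<Rightarrow> ('l, 'd) ring_scheme \<Rightarrow> ('a \<Rightarrow> 'l) set"
  where "rng_hom A L = {\<iota> \<in> carrier A \<rightarrow> carrier L.
    \<forall>a\<in>carrier A. \<forall>b\<in>carrier A. \<iota> (a \<oplus>\<^bsub>A\<^esub> b) = \<iota> a \<oplus>\<^bsub>L\<^esub> \<iota> b \<and> \<iota> (a \<otimes>\<^bsub>A\<^esub> b) = \<iota> a \<otimes>\<^bsub>L\<^esub> \<iota> b}"

lemma ring_hom_rng_hom: "\<eta> \<in> ring_hom K L \<Longrightarrow> \<eta> \<in> rng_hom K L"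
  by (auto simp: ring_hom_def rng_hom_def)

lemma rng_homD:
  assumes "\<iota> \<in> rng_hom A L"
  shows "a \<in> carrier A \<Longrightarrow> \<iota> a \<in> carrier L"
    "a \<in> carrier A \<Longrightarrow> b \<in> carrier A \<Longrightarrow> \<iota> (a \<oplus>\<^bsub>A\<^esub> b) = \<iota> a \<oplus>\<^bsub>L\<^esub> \<iota> b"
    "a \<in> carrier A \<Longrightarrow> b \<in> carrier A \<Longrightarrow> \<iota> (a \<otimes>\<^bsub>A\<^esub> b) = \<iota> a \<otimes>\<^bsub>L\<^esub> \<iota> b"
  using assms by (auto simp: rng_hom_def)

text \<open>Restriction along \<open>\<iota>\<close>, cut down to the part on which \<open>\<iota> 1\<close> acts as the identity. If \<open>\<iota>\<close> preserves
  the unit this is ordinary restriction of scalars; if \<open>\<iota>\<close> is the inclusion of a corner \<open>eLe\<close> it is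
  the module \<open>eX\<close>.\<close>

definition pullback :: "('a, 'c) ring_scheme \<Rightarrow> ('a \<Rightarrow> 'l) \<Rightarrow> ('l, 'x, 'd) module_scheme \<Rightarrow> ('a, 'x) module"
  where "pullback A \<iota> X =
    \<lparr>carrier = {x \<in> carrier X. \<iota> \<one>\<^bsub>A\<^esub> \<odot>\<^bsub>X\<^esub> x = x}, mult = undefined, one = undefined,
     zero = \<zero>\<^bsub>X\<^esub>, add = add X, smult = (\<lambda>a x. \<iota> a \<odot>\<^bsub>X\<^esub> x)\<rparr>"

lemma pullback_simps [simp]:
  "\<zero>\<^bsub>pullback A \<iota> X\<^esub> = \<zero>\<^bsub>X\<^esub>" "x \<oplus>\<^bsub>pullback A \<iota> X\<^esub> y = x \<oplus>\<^bsub>X\<^esub> y"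
  "a \<odot>\<^bsub>pullback A \<iota> X\<^esub> x = \<iota> a \<odot>\<^bsub>X\<^esub> x"
  by (simp_all add: pullback_def)

lemma carrier_pullback: "carrier (pullback A \<iota> X) = {x \<in> carrier X. \<iota> \<one>\<^bsub>A\<^esub> \<odot>\<^bsub>X\<^esub> x = x}"
  by (simp add: pullback_def)

lemma left_module_pullback:
  assumes "ring A" "left_module L X" "\<iota> \<in> rng_hom A L"
  shows "left_module A (pullback A \<iota> X)"
proof -
  interpret A: ring A by fact
  interpret X: left_module L X by fact
  note h = rng_homD[OF assms(3)]
  have "abelian_group (pullback A \<iota> X)"
  proof (rule abelian_groupI)
    fix x assume "x \<in> carrier (pullback A \<iota> X)"
    then show "\<exists>y\<in>carrier (pullback A \<iota> X). y \<oplus>\<^bsub>pullback A \<iota> X\<^esub> x = \<zero>\<^bsub>pullback A \<iota> X\<^esub>"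
      using h(1)[of "\<one>\<^bsub>A\<^esub>"]
      by (intro bexI[of _ "\<ominus>\<^bsub>X\<^esub> x"]) (auto simp: carrier_pullback X.smult_r_minus X.l_neg)
  qed (use h(1)[of "\<one>\<^bsub>A\<^esub>"] in \<open>auto simp: carrier_pullback X.smult_r_distr X.a_ac\<close>)
  then show ?thesis
    using h by (intro left_module.intro A.ring_axioms left_module_axioms.intro)
      (auto simp: carrier_pullback X.smult_r_distr X.smult_l_distr X.smult_assoc1
        X.smult_assoc1[symmetric] h(3)[symmetric] simp del: X.smult_assoc1)
qed

lemma module_hom_pullback:
  assumes "left_module L X" "left_module L Y" "ring A" "\<iota> \<in> rng_hom A L" "h \<in> module_hom L X Y"
  shows "h \<in> module_hom A (pullback A \<iota> X) (pullback A \<iota> Y)"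
  using module_homD[OF assms(5)] rng_homD(1)[OF assms(4)] ring.ring_simprules(6)[OF assms(3)]
  by (intro module_homI) (auto simp: carrier_pullback, metis)

lemma carrier_restrict_scalars:
  assumes "left_module L X" "\<eta> \<in> ring_hom K L"
  shows "carrier (pullback K \<eta> X) = carrier X"
  using left_module.smult_one[OF assms(1)] ring_hom_one[OF assms(2)] by (auto simp: carrier_pullback)

lemma submodule_restrict_scalars:
  assumes "ring K" "left_module L X" "\<eta> \<in> ring_hom K L" "submodule U L X"
  shows "submodule U K (pullback K \<eta> X)"
  using left_module.submodule_iff[OF assms(2), of U]
    left_module.submodule_iff[OF left_module_pullback[OF assms(1,2) ring_hom_rng_hom[OF assms(3)]], of U]
    assms(4) ring_hom_closed[OF assms(3)]
  by (auto simp: carrier_restrict_scalars[OF assms(2,3)])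

text \<open>What the finiteness arguments use of an Artin algebra. It holds for a Morita ring and for both of its
  corners over the same \<open>K\<close>.\<close>

locale finite_algebra =
  fixes K :: "('k, 'c) ring_scheme" and \<eta> :: "'k \<Rightarrow> 'l" and L :: "('l, 'd) ring_scheme"
  assumes scalars: "artinian_cring K" and ring: "ring L" and structure_map: "\<eta> \<in> ring_hom K L"
    and finite: "fg_module K (pullback K \<eta> (regular_module L))"
begin

sublocale K: cring K using scalars by (simp add: artinian_cring_def)
sublocale L: ring L by (rule ring)

abbreviation restrict :: "('l, 'x, 'f) module_scheme \<Rightarrow> ('k, 'x) module"
  where "restrict X \<equiv> pullback K \<eta> X"

lemmas rng_hom = ring_hom_rng_hom[OF structure_map]

lemma left_module_restrict: "left_module L X \<Longrightarrow> left_module K (restrict X)"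
  by (rule left_module_pullback[OF K.ring_axioms _ rng_hom])

lemma carrier_restrict: "left_module L X \<Longrightarrow> carrier (restrict X) = carrier X"
  by (rule carrier_restrict_scalars[OF _ structure_map])

lemma submodule_restrict: "left_module L X \<Longrightarrow> submodule U L X \<Longrightarrow> submodule U K (restrict X)"
  by (rule submodule_restrict_scalars[OF K.ring_axioms _ structure_map])

lemma artinian_scalars_restrict: "left_module L X \<Longrightarrow> artinian_scalars K (restrict X)"
  by (simp add: artinian_scalars_def artinian_scalars_axioms_def scalars left_module_restrict)

lemma finitely_spanned_restrictD:
  assumes X: "left_module L X" and U: "U \<subseteq> carrier X" and fs: "finitely_spanned K (restrict X) U"
  shows "finitely_spanned L X U"
  using fs
proof (rule finitely_spannedE)
  fix S assume "finite S" "S \<subseteq> U" "\<And>W. submodule W K (restrict X) \<Longrightarrow> S \<subseteq> W \<Longrightarrow> U \<subseteq> W"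
  then show "finitely_spanned L X U"
    by (intro finitely_spannedI[of S]) (auto intro: submodule_restrict[OF X])
qed

text \<open>If \<open>T\<close> generates \<open>L\<close> over \<open>K\<close> and \<open>S\<close> generates \<open>X\<close> over \<open>L\<close>, then the products \<open>t s\<close> generate \<open>X\<close>
  over \<open>K\<close>.\<close>

lemma fg_restrict_iff:
  assumes X: "left_module L X"
  shows "fg_module K (restrict X) \<longleftrightarrow> fg_module L X"
proof
  assume "fg_module K (restrict X)"
  then show "fg_module L X"
    using finitely_spanned_restrictD[OF X subset_refl] X by (simp add: fg_module_iff carrier_restrict)
next
  assume fg: "fg_module L X"
  interpret X: left_module L X by fact
  let ?RL = "pullback K \<eta> (regular_module L)"
  have RL: "left_module L (regular_module L)" by (rule left_module_regular[OF ring])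
  note mK = left_module_restrict[OF X]
  note mRL = left_module_restrict[OF RL]
  have cRL: "carrier ?RL = carrier L" using carrier_restrict[OF RL] by (simp add: regular_module_def)
  have "finitely_spanned L X (carrier X)" using fg by (simp add: fg_module_iff)
  then obtain S where S: "finite S" "S \<subseteq> carrier X" "\<And>W. submodule W L X \<Longrightarrow> S \<subseteq> W \<Longrightarrow> carrier X \<subseteq> W"
    by (rule finitely_spannedE) iprover
  have "finitely_spanned K ?RL (carrier L)" using finite by (simp add: fg_module_iff cRL)
  then obtain T where T: "finite T" "T \<subseteq> carrier L" "\<And>W. submodule W K ?RL \<Longrightarrow> T \<subseteq> W \<Longrightarrow> carrier L \<subseteq> W"
    by (rule finitely_spannedE) iprover
  have "finitely_spanned K (restrict X) (carrier X)"
  proof (rule finitely_spannedI)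
    show "finite ((\<lambda>(t, s). t \<odot>\<^bsub>X\<^esub> s) ` (T \<times> S))" using S(1) T(1) by simp
    show "(\<lambda>(t, s). t \<odot>\<^bsub>X\<^esub> s) ` (T \<times> S) \<subseteq> carrier X" using S(2) T(2) by auto
    fix W assume W: "submodule W K (restrict X)" "(\<lambda>(t, s). t \<odot>\<^bsub>X\<^esub> s) ` (T \<times> S) \<subseteq> W"
    note WD = left_module.submoduleD[OF mK W(1)]
    have WX: "W \<subseteq> carrier X" using WD(1) carrier_restrict[OF X] by simp
    have LS: "l \<odot>\<^bsub>X\<^esub> s \<in> W" if "l \<in> carrier L" "s \<in> S" for l s
    proof -
      have "submodule {l \<in> carrier L. l \<odot>\<^bsub>X\<^esub> s \<in> W} K ?RL"
        unfolding left_module.submodule_iff[OF mRL]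
        using that(2) S(2) WD(2,4,5) ring_hom_closed[OF structure_map]
        by (auto simp: cRL X.smult_l_distr X.smult_assoc1 subset_iff)
      moreover have "T \<subseteq> {l \<in> carrier L. l \<odot>\<^bsub>X\<^esub> s \<in> W}" using T(2) W(2) that(2) by auto
      ultimately show ?thesis using T(3) that(1) by blast
    qed
    have "submodule {x \<in> carrier X. \<forall>l\<in>carrier L. l \<odot>\<^bsub>X\<^esub> x \<in> W} L X"
      unfolding X.submodule_iff using WD(2,4)
      by (auto simp: X.smult_r_distr X.smult_assoc1[symmetric])
    moreover have "S \<subseteq> {x \<in> carrier X. \<forall>l\<in>carrier L. l \<odot>\<^bsub>X\<^esub> x \<in> W}" using LS S(2) by auto
    ultimately have all: "carrier X \<subseteq> {x \<in> carrier X. \<forall>l\<in>carrier L. l \<odot>\<^bsub>X\<^esub> x \<in> W}" by (rule S(3))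
    have "\<one>\<^bsub>L\<^esub> \<odot>\<^bsub>X\<^esub> x \<in> W" if "x \<in> carrier X" for x
      using subsetD[OF all that] L.one_closed by blast
    then show "carrier X \<subseteq> W" using X.smult_one by (metis subsetI)
  qed
  then show "fg_module K (restrict X)" using mK by (simp add: fg_module_iff carrier_restrict[OF X])
qed

lemma fg_module_submodule:
  assumes "fg_module L X" "submodule U L X"
  shows "fg_module L (X\<lparr>carrier := U\<rparr>)"
proof -
  have X: "left_module L X" using assms(1) by (simp add: fg_module_def)
  then interpret X: left_module L X .
  interpret KX: artinian_scalars K "restrict X" by (rule artinian_scalars_restrict[OF X])
  have "finitely_generated K (restrict X)" using assms(1) fg_restrict_iff[OF X] by (simp add: fg_module_def)
  then have "finitely_spanned K (restrict X) U"
    using KX.finitely_spanned_if_artinian[OF KX.artinian_on_finitely_generated submodule_restrict[OF X assms(2)]]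
    by simp
  then show ?thesis
    using X.fg_submodule[OF assms(2)] finitely_spanned_restrictD[OF X X.submoduleD(1)[OF assms(2)]] by simp
qed

text \<open>The role of injective hulls is played by complements. Let \<open>C\<close> be maximal among the submodules that
  contain \<open>U\<close> and meet \<open>V\<close> trivially, and \<open>D\<close> maximal among those that contain \<open>V\<close> and meet \<open>C\<close> trivially.
  The projection of \<open>C + D\<close> onto \<open>D\<close> extends to an endomorphism \<open>h\<close> of the injective module \<open>Z\<close>, and
  maximality forces \<open>h\<close> to be a projection of \<open>Z\<close> onto \<open>D\<close> with kernel \<open>C\<close>. So \<open>Z = C + D\<close>, and
  indecomposability applies.\<close>

lemma indecomposable_injective_uniform:
  assumes Z: "indecomposable_injective L Z"
    and U: "submodule U L Z" and V: "submodule V L Z" and UV: "U \<inter> V = {\<zero>\<^bsub>Z\<^esub>}"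
  shows "U = {\<zero>\<^bsub>Z\<^esub>} \<or> V = {\<zero>\<^bsub>Z\<^esub>}"
proof -
  have fg: "fg_module L Z" and inj: "injective L Z" and ind: "indecomposable L Z"
    using Z by (auto simp: indecomposable_injective_def)
  have mZ: "left_module L Z" using fg by (simp add: fg_module_def)
  then interpret Z: left_module L Z .
  obtain C where C: "submodule C L Z" "U \<subseteq> C" "C \<inter> (V - {\<zero>\<^bsub>Z\<^esub>}) = {}"
    and Cmax: "\<And>W. \<lbrakk>submodule W L Z; C \<subseteq> W; W \<inter> (V - {\<zero>\<^bsub>Z\<^esub>}) = {}\<rbrakk> \<Longrightarrow> W = C"
  proof -
    have "U \<inter> (V - {\<zero>\<^bsub>Z\<^esub>}) = {}" using UV by blast
    from Z.maximal_submodule_avoiding[OF U this] show ?thesis using that by (elim exE conjE) simp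
  qed
  obtain D where D: "submodule D L Z" "V \<subseteq> D" "D \<inter> (C - {\<zero>\<^bsub>Z\<^esub>}) = {}"
    and Dmax: "\<And>W. \<lbrakk>submodule W L Z; D \<subseteq> W; W \<inter> (C - {\<zero>\<^bsub>Z\<^esub>}) = {}\<rbrakk> \<Longrightarrow> W = D"
  proof -
    have "V \<inter> (C - {\<zero>\<^bsub>Z\<^esub>}) = {}" using C(3) by blast
    from Z.maximal_submodule_avoiding[OF V this] show ?thesis using that by (elim exE conjE) simp
  qed
  note CD = Z.submoduleD[OF C(1)] and DD = Z.submoduleD[OF D(1)]
  note sum = Z.submodule_set_add[OF C(1) D(1)]
  have unique: "d = d'" if "c \<in> C" "d \<in> D" "c' \<in> C" "d' \<in> D" "c \<oplus>\<^bsub>Z\<^esub> d = c' \<oplus>\<^bsub>Z\<^esub> d'" for c d c' d'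
  proof -
    have cl: "c \<in> carrier Z" "d \<in> carrier Z" "c' \<in> carrier Z" "d' \<in> carrier Z" using that CD(3) DD(3) by auto
    have "d \<ominus>\<^bsub>Z\<^esub> d' = \<ominus>\<^bsub>Z\<^esub> c \<oplus>\<^bsub>Z\<^esub> (c \<oplus>\<^bsub>Z\<^esub> d) \<ominus>\<^bsub>Z\<^esub> d'" using cl by (simp add: Z.M.r_neg1)
    also have "\<dots> = c' \<ominus>\<^bsub>Z\<^esub> c"
    proof -
      have "\<ominus>\<^bsub>Z\<^esub> c \<oplus>\<^bsub>Z\<^esub> (c' \<oplus>\<^bsub>Z\<^esub> d') \<ominus>\<^bsub>Z\<^esub> d' = (c' \<oplus>\<^bsub>Z\<^esub> \<ominus>\<^bsub>Z\<^esub> c) \<oplus>\<^bsub>Z\<^esub> (d' \<oplus>\<^bsub>Z\<^esub> \<ominus>\<^bsub>Z\<^esub> d')"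
        using cl by (simp add: a_minus_def Z.M.a_ac)
      then show ?thesis unfolding that(5) using cl by (simp add: a_minus_def Z.M.r_neg)
    qed
    finally have "d \<ominus>\<^bsub>Z\<^esub> d' = c' \<ominus>\<^bsub>Z\<^esub> c" .
    moreover have "c' \<ominus>\<^bsub>Z\<^esub> c \<in> C" "d \<ominus>\<^bsub>Z\<^esub> d' \<in> D" using that CD(7) DD(7) by auto
    ultimately have "d \<ominus>\<^bsub>Z\<^esub> d' = \<zero>\<^bsub>Z\<^esub>" using D(3) by auto
    then show "d = d'" using Z.diff_add_cancel[OF cl(2,4)] cl by simp
  qed
  define p where "p z = (THE d. d \<in> D \<and> (\<exists>c\<in>C. z = c \<oplus>\<^bsub>Z\<^esub> d))" for z
  have p: "p (c \<oplus>\<^bsub>Z\<^esub> d) = d" if "c \<in> C" "d \<in> D" for c d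
    unfolding p_def using that unique by (intro the_equality) blast+
  let ?S = "Z\<lparr>carrier := C <+>\<^bsub>Z\<^esub> D\<rparr>"
  have "p \<in> module_hom L ?S Z"
  proof (rule module_homI)
    fix x assume "x \<in> carrier ?S"
    then show "p x \<in> carrier Z" using p DD(3) by (auto simp: set_add_def')
  next
    fix x y assume "x \<in> carrier ?S" "y \<in> carrier ?S"
    then obtain c d c' d' where *: "c \<in> C" "d \<in> D" "c' \<in> C" "d' \<in> D" "x = c \<oplus>\<^bsub>Z\<^esub> d" "y = c' \<oplus>\<^bsub>Z\<^esub> d'"
      by (auto simp: set_add_def')
    have "x \<oplus>\<^bsub>Z\<^esub> y = (c \<oplus>\<^bsub>Z\<^esub> c') \<oplus>\<^bsub>Z\<^esub> (d \<oplus>\<^bsub>Z\<^esub> d')"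
      using * CD(3) DD(3) by (simp add: Z.M.a_ac)
    then show "p (x \<oplus>\<^bsub>?S\<^esub> y) = p x \<oplus>\<^bsub>Z\<^esub> p y" using * CD(4) DD(4) by (simp add: p)
  next
    fix r x assume r: "r \<in> carrier L" and "x \<in> carrier ?S"
    then obtain c d where *: "c \<in> C" "d \<in> D" "x = c \<oplus>\<^bsub>Z\<^esub> d" by (auto simp: set_add_def')
    then have "r \<odot>\<^bsub>Z\<^esub> x = r \<odot>\<^bsub>Z\<^esub> c \<oplus>\<^bsub>Z\<^esub> r \<odot>\<^bsub>Z\<^esub> d"
      using CD(3) DD(3) r by (simp add: Z.smult_r_distr)
    then show "p (r \<odot>\<^bsub>?S\<^esub> x) = r \<odot>\<^bsub>Z\<^esub> p x" using * CD(5) DD(5) r by (simp add: p)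
  qed
  moreover have "id \<in> module_hom L ?S Z" "inj_on id (carrier ?S)"
    using Z.submoduleD(1)[OF sum(1)] by (auto simp: module_hom_def)
  ultimately obtain h where h: "h \<in> module_hom L Z Z" "\<And>z. z \<in> C <+>\<^bsub>Z\<^esub> D \<Longrightarrow> h z = p z"
    using injective_extension[OF inj fg_module_submodule[OF fg sum(1)] fg, of id p] by auto
  interpret h: module_map L Z Z h using h(1) mZ by (simp add: module_map_def module_map_axioms_def)
  have hC: "h c = \<zero>\<^bsub>Z\<^esub>" if "c \<in> C" for c
    using h(2)[of c] p[OF that DD(2)] that CD(3)[OF that] sum(2) by auto
  have hD: "h d = d" if "d \<in> D" for d
    using h(2)[of d] p[OF CD(2) that] that DD(3)[OF that] sum(3) by auto
  \<comment> \<open>The preimage of \<open>C\<close> contains \<open>C\<close> and meets \<open>V\<close> trivially, because \<open>h\<close> fixes \<open>V\<close>.\<close>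
  have "{z \<in> carrier Z. h z \<in> C} = C"
  proof (rule Cmax[OF h.submodule_preimage[OF C(1)]])
    show "C \<subseteq> {z \<in> carrier Z. h z \<in> C}" using hC CD(1,2) by auto
    show "{z \<in> carrier Z. h z \<in> C} \<inter> (V - {\<zero>\<^bsub>Z\<^esub>}) = {}"
    proof -
      have "h v = v" if "v \<in> V" for v using hD D(2) that by blast
      then show ?thesis using C(3) by auto
    qed
  qed
  then have hC': "z \<in> C" if "z \<in> carrier Z" "h z \<in> C" for z using that by blast
  have image: "h ` carrier Z = D"
  proof (rule Dmax[OF h.submodule_image[OF Z.submodule_carrier]])
    show "D \<subseteq> h ` carrier Z"
    proof
      fix d assume "d \<in> D"
      then show "d \<in> h ` carrier Z" using hD DD(3) by (intro image_eqI[of _ _ d]) auto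
    qed
    have "h z = \<zero>\<^bsub>Z\<^esub>" if "z \<in> carrier Z" "h z \<in> C" for z using hC[OF hC'[OF that]] .
    then show "h ` carrier Z \<inter> (C - {\<zero>\<^bsub>Z\<^esub>}) = {}" by blast
  qed
  have "carrier Z \<subseteq> C <+>\<^bsub>Z\<^esub> D"
  proof
    fix z assume z: "z \<in> carrier Z"
    have hz: "h z \<in> D" using image z by blast
    have "h (z \<ominus>\<^bsub>Z\<^esub> h z) = h z \<ominus>\<^bsub>Z\<^esub> h z" using z hD[OF hz] h.diff h.closed by simp
    also have "\<dots> = \<zero>\<^bsub>Z\<^esub>" using h.closed[OF z] by (simp add: a_minus_def Z.M.r_neg)
    finally have "z \<ominus>\<^bsub>Z\<^esub> h z \<in> C" using hC'[of "z \<ominus>\<^bsub>Z\<^esub> h z"] CD(2) z h.closed by simp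
    moreover have "z = (z \<ominus>\<^bsub>Z\<^esub> h z) \<oplus>\<^bsub>Z\<^esub> h z" using z h.closed by simp
    ultimately show "z \<in> C <+>\<^bsub>Z\<^esub> D" using hz unfolding set_add_def' by blast
  qed
  then have "C <+>\<^bsub>Z\<^esub> D = carrier Z" using Z.submoduleD(1)[OF sum(1)] by blast
  moreover have "C \<inter> D = {\<zero>\<^bsub>Z\<^esub>}" using D(3) CD(2) DD(2) by blast
  ultimately have "C = {\<zero>\<^bsub>Z\<^esub>} \<or> D = {\<zero>\<^bsub>Z\<^esub>}" using ind C(1) D(1) by (simp add: indecomposable_def)
  then show ?thesis using C(2) D(2) Z.submoduleD(2)[OF U] Z.submoduleD(2)[OF V] by blast
qed

end

section \<open>Modules of homomorphisms\<close>

text \<open>This moves the module axioms between record types, for instance from a module to a bimodule that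
  extends it.\<close>

lemma left_module_cong:
  assumes "left_module R X" "carrier Y = carrier X" "\<zero>\<^bsub>Y\<^esub> = \<zero>\<^bsub>X\<^esub>" "add Y = add X" "smult Y = smult X"
  shows "left_module R Y"
proof -
  interpret X: left_module R X by fact
  have "abelian_group Y"
  proof (rule abelian_groupI)
    fix x assume "x \<in> carrier Y"
    then show "\<exists>y\<in>carrier Y. y \<oplus>\<^bsub>Y\<^esub> x = \<zero>\<^bsub>Y\<^esub>"
      using assms by (intro bexI[of _ "\<ominus>\<^bsub>X\<^esub> x"]) (auto simp: X.l_neg)
  qed (use assms in \<open>auto simp: X.a_ac\<close>)
  then show ?thesis
    using assms by (intro left_module.intro X.ring_axioms left_module_axioms.intro)
      (auto simp: X.smult_l_distr X.smult_r_distr X.smult_assoc1)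
qed

lemma fg_module_cong:
  assumes "fg_module R X" "carrier Y = carrier X" "\<zero>\<^bsub>Y\<^esub> = \<zero>\<^bsub>X\<^esub>" "add Y = add X" "smult Y = smult X"
  shows "fg_module R Y"
proof -
  have "left_module R X" using assms(1) by (simp add: fg_module_def)
  then interpret module_map R X Y id
    using left_module_cong[of R X Y] assms by (simp add: module_map_def module_map_axioms_def module_hom_def)
  show ?thesis using fg_image[OF assms(1)] assms(2) by simp
qed

lemma hom_module_simps [simp]:
  "carrier (hom_module R P W) = module_hom R P W \<inter> extensional (carrier P)"
  "\<zero>\<^bsub>hom_module R P W\<^esub> = (\<lambda>p\<in>carrier P. \<zero>\<^bsub>W\<^esub>)"
  "h \<oplus>\<^bsub>hom_module R P W\<^esub> k = (\<lambda>p\<in>carrier P. h p \<oplus>\<^bsub>W\<^esub> k p)"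
  "s \<odot>\<^bsub>hom_module R P W\<^esub> h = (\<lambda>p\<in>carrier P. h (p \<boxdot>\<^bsub>P\<^esub> s))"
  by (simp_all add: hom_module_def)

lemma left_module_hom_module:
  fixes P :: "('r, 's, 'p) bimodule"
  assumes P: "bimodule R S P" and W: "left_module R W"
  shows "left_module S (hom_module R P W)"
proof -
  interpret P: bimodule R S P by fact
  interpret PM: left_module R P by (rule P.left_module)
  interpret W: left_module R W by fact
  interpret S: ring S by (rule P.right_ring)
  let ?H = "hom_module R P W"
  note D = module_homD[where R = R and X = P and Y = W]
  have ext: "h = k" if "h \<in> carrier ?H" "k \<in> carrier ?H" "\<And>p. p \<in> carrier P \<Longrightarrow> h p = k p" for h k
    using that by (auto intro: extensionalityI)
  have homI: "(\<lambda>p\<in>carrier P. f p) \<in> carrier ?H"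
    if "\<And>p. p \<in> carrier P \<Longrightarrow> f p \<in> carrier W"
      "\<And>p q. p \<in> carrier P \<Longrightarrow> q \<in> carrier P \<Longrightarrow> f (p \<oplus>\<^bsub>P\<^esub> q) = f p \<oplus>\<^bsub>W\<^esub> f q"
      "\<And>r p. r \<in> carrier R \<Longrightarrow> p \<in> carrier P \<Longrightarrow> f (r \<odot>\<^bsub>P\<^esub> p) = r \<odot>\<^bsub>W\<^esub> f p" for f
    using that by (auto intro!: module_homI)
  have addc: "h \<oplus>\<^bsub>?H\<^esub> k \<in> carrier ?H" if "h \<in> carrier ?H" "k \<in> carrier ?H" for h k
  proof -
    have "h \<in> module_hom R P W" "k \<in> module_hom R P W" using that by auto
    note D = this[THEN module_homD(1)] this[THEN module_homD(2)] this[THEN module_homD(3)]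
    show ?thesis
      unfolding hom_module_simps(3) by (rule homI) (simp_all add: D W.a_ac W.smult_r_distr)
  qed
  have smc: "s \<odot>\<^bsub>?H\<^esub> h \<in> carrier ?H" if "s \<in> carrier S" "h \<in> carrier ?H" for s h
  proof -
    have "h \<in> module_hom R P W" using that by auto
    note D = this[THEN module_homD(1)] this[THEN module_homD(2)] this[THEN module_homD(3)]
    show ?thesis
      unfolding hom_module_simps(4)
      by (rule homI) (simp_all add: D that P.rsmult_closed P.rsmult_l_distr P.smult_rsmult)
  qed
  have zc: "\<zero>\<^bsub>?H\<^esub> \<in> carrier ?H"
    unfolding hom_module_simps(2) by (rule homI) auto
  have "abelian_group ?H"
  proof (rule abelian_groupI)
    fix h assume h: "h \<in> carrier ?H"
    have m: "(\<lambda>p\<in>carrier P. \<ominus>\<^bsub>W\<^esub> h p) \<in> carrier ?H"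
    proof -
      have "h \<in> module_hom R P W" using h by auto
      note D = this[THEN module_homD(1)] this[THEN module_homD(2)] this[THEN module_homD(3)]
      show ?thesis by (rule homI) (simp_all add: D W.minus_add W.smult_r_minus)
    qed
    show "\<exists>k\<in>carrier ?H. k \<oplus>\<^bsub>?H\<^esub> h = \<zero>\<^bsub>?H\<^esub>"
      by (intro bexI[OF _ m] ext addc m h zc) (use h D in \<open>auto simp: W.l_neg\<close>)
  next
    fix h k l assume "h \<in> carrier ?H" "k \<in> carrier ?H" "l \<in> carrier ?H"
    then show "h \<oplus>\<^bsub>?H\<^esub> k \<oplus>\<^bsub>?H\<^esub> l = h \<oplus>\<^bsub>?H\<^esub> (k \<oplus>\<^bsub>?H\<^esub> l)"
      by (intro ext addc) (use D in \<open>auto simp: W.a_ac\<close>)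
  next
    fix h k assume "h \<in> carrier ?H" "k \<in> carrier ?H"
    then show "h \<oplus>\<^bsub>?H\<^esub> k = k \<oplus>\<^bsub>?H\<^esub> h"
      by (intro ext addc) (use D in \<open>auto simp: W.a_ac\<close>)
  next
    fix h assume "h \<in> carrier ?H"
    then show "\<zero>\<^bsub>?H\<^esub> \<oplus>\<^bsub>?H\<^esub> h = h"
      by (intro ext addc zc) (use D in auto)
  qed (use addc zc in blast)+
  then show ?thesis
  proof (intro left_module.intro S.ring_axioms left_module_axioms.intro)
    fix a b h assume "a \<in> carrier S" "b \<in> carrier S" "h \<in> carrier ?H"
    then show "(a \<oplus>\<^bsub>S\<^esub> b) \<odot>\<^bsub>?H\<^esub> h = a \<odot>\<^bsub>?H\<^esub> h \<oplus>\<^bsub>?H\<^esub> b \<odot>\<^bsub>?H\<^esub> h"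
      "(a \<otimes>\<^bsub>S\<^esub> b) \<odot>\<^bsub>?H\<^esub> h = a \<odot>\<^bsub>?H\<^esub> (b \<odot>\<^bsub>?H\<^esub> h)"
      by (intro ext addc smc S.a_closed S.m_closed; use D in \<open>auto simp: P.rsmult_closed P.rsmult_r_distr P.rsmult_assoc\<close>)+
  next
    fix a h k assume "a \<in> carrier S" "h \<in> carrier ?H" "k \<in> carrier ?H"
    then show "a \<odot>\<^bsub>?H\<^esub> (h \<oplus>\<^bsub>?H\<^esub> k) = a \<odot>\<^bsub>?H\<^esub> h \<oplus>\<^bsub>?H\<^esub> a \<odot>\<^bsub>?H\<^esub> k"
      by (intro ext addc smc) (auto simp: P.rsmult_closed)
  next
    fix h assume "h \<in> carrier ?H"
    then show "\<one>\<^bsub>S\<^esub> \<odot>\<^bsub>?H\<^esub> h = h"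
      by (intro ext smc S.one_closed) (auto simp: P.rsmult_one)
  qed (assumption, erule (1) smc)
qed

text \<open>Evaluation at generators of \<open>P\<close> embeds the module of homomorphisms into a finite power of \<open>W\<close>. The
  embedding is only \<open>K\<close>-linear, and it is so because \<open>K\<close> acts on \<open>P\<close> in the same way from both sides.\<close>

lemma fg_hom_module:
  fixes P :: "('r, 's, 'p) bimodule"
  assumes R: "finite_algebra K \<rho> R" and S: "finite_algebra K \<sigma> S" and P: "bimodule R S P"
    and fgP: "fg_module R P" and fgW: "fg_module R W"
    and compat: "\<And>k p. k \<in> carrier K \<Longrightarrow> p \<in> carrier P \<Longrightarrow> \<rho> k \<odot>\<^bsub>P\<^esub> p = p \<boxdot>\<^bsub>P\<^esub> \<sigma> k"
  shows "fg_module S (hom_module R P W)"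
proof -
  interpret R: finite_algebra K \<rho> R by fact
  interpret S: finite_algebra K \<sigma> S by fact
  have W: "left_module R W" using fgW by (simp add: fg_module_def)
  interpret W: left_module R W by fact
  interpret P: bimodule R S P by fact
  interpret PM: left_module R P by (rule P.left_module)
  let ?H = "hom_module R P W"
  have H: "left_module S ?H" by (rule left_module_hom_module[OF P W])
  interpret KW: artinian_scalars K "R.restrict W" by (rule R.artinian_scalars_restrict[OF W])
  interpret KH: artinian_scalars K "S.restrict ?H" by (rule S.artinian_scalars_restrict[OF H])
  have cH: "carrier (S.restrict ?H) = carrier ?H" by (rule S.carrier_restrict[OF H])
  have cW: "carrier (R.restrict W) = carrier W" by (rule R.carrier_restrict[OF W])
  have artW: "artinian_on K (R.restrict W) (carrier (R.restrict W))"
    using R.fg_restrict_iff[OF W] fgW KW.artinian_on_finitely_generated by (simp add: fg_module_def)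
  have "finitely_spanned R P (carrier P)" using fgP by (simp add: fg_module_iff)
  then obtain T where T: "finite T" "T \<subseteq> carrier P" "\<And>V. submodule V R P \<Longrightarrow> T \<subseteq> V \<Longrightarrow> carrier P \<subseteq> V"
    by (rule finitely_spannedE) iprover
  have "artinian_on K (S.restrict ?H) (carrier (S.restrict ?H))"
  proof (rule artinian_on_jointly_injective[OF KH.left_module_axioms KW.left_module_axioms artW])
    show "finite ((\<lambda>p h. h p) ` T)" using T(1) by simp
    have "(\<lambda>h. h p) \<in> module_hom K (S.restrict ?H) (R.restrict W)" if "p \<in> T" for p
    proof (rule module_homI)
      have p: "p \<in> carrier P" using that T(2) by blast
      fix h assume h: "h \<in> carrier (S.restrict ?H)"
      then have h': "h \<in> module_hom R P W" unfolding cH by simp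
      show "h p \<in> carrier (R.restrict W)" unfolding cW by (rule module_homD(1)[OF h' p])
      fix k assume k: "k \<in> carrier K"
      have "h (p \<boxdot>\<^bsub>P\<^esub> \<sigma> k) = \<rho> k \<odot>\<^bsub>W\<^esub> h p"
        using module_homD(3)[OF h' R.rng_hom[THEN rng_homD(1), OF k] p] compat[OF k p] by simp
      then show "(k \<odot>\<^bsub>S.restrict ?H\<^esub> h) p = k \<odot>\<^bsub>R.restrict W\<^esub> h p" using p by simp
    qed (use that T(2) in auto)
    then show "(\<lambda>p h. h p) ` T \<subseteq> module_hom K (S.restrict ?H) (R.restrict W)" by blast
    fix h assume h: "h \<in> carrier (S.restrict ?H)"
      and van: "\<And>f. f \<in> (\<lambda>p h. h p) ` T \<Longrightarrow> f h = \<zero>\<^bsub>R.restrict W\<^esub>"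
    then have h': "h \<in> module_hom R P W" "h \<in> extensional (carrier P)" unfolding cH by auto
    interpret h: module_map R P W h
      using h'(1) W P.left_module by (simp add: module_map_def module_map_axioms_def)
    have "T \<subseteq> {p \<in> carrier P. h p \<in> {\<zero>\<^bsub>W\<^esub>}}" using van T(2) by auto
    from T(3)[OF h.submodule_preimage[OF W.submodule_zero] this]
    show "h = \<zero>\<^bsub>S.restrict ?H\<^esub>" using h'(2) by (auto intro!: extensionalityI)
  qed (rule KH.artinian_on_zero)
  then have "finitely_spanned K (S.restrict ?H) (carrier (S.restrict ?H))"
    by (rule KH.finitely_spanned_if_artinian[OF _ KH.submodule_carrier])
  then show ?thesis
    using S.fg_restrict_iff[OF H] KH.left_module_axioms by (simp add: fg_module_iff)
qed

section \<open>Corners and coinduced modules\<close>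

text \<open>\<open>A\<close> is identified by \<open>\<iota>\<close> with the corner \<open>eLe\<close> of \<open>L\<close>, where \<open>e = \<iota> 1\<close>. An abstract ring
  \<open>A\<close> instead of a subset of \<open>L\<close> allows both corners of a Morita ring to be treated without
  changing their types.\<close>

locale corner_ring = finite_algebra K \<eta> L
  for K :: "('k, 'c) ring_scheme" and \<eta> :: "'k \<Rightarrow> 'l" and L :: "('l, 'd) ring_scheme" +
  fixes A :: "('a, 'f) ring_scheme" and \<iota> :: "'a \<Rightarrow> 'l"
  assumes central: "\<lbrakk>k \<in> carrier K; u \<in> carrier L\<rbrakk> \<Longrightarrow> \<eta> k \<otimes>\<^bsub>L\<^esub> u = u \<otimes>\<^bsub>L\<^esub> \<eta> k"
    and ring_A: "ring A" and embedding: "\<iota> \<in> rng_hom A L" and inj_embedding: "inj_on \<iota> (carrier A)"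
    and full: "\<lbrakk>u \<in> carrier L; \<iota> \<one>\<^bsub>A\<^esub> \<otimes>\<^bsub>L\<^esub> u \<otimes>\<^bsub>L\<^esub> \<iota> \<one>\<^bsub>A\<^esub> = u\<rbrakk> \<Longrightarrow> u \<in> \<iota> ` carrier A"
begin

sublocale A: ring A by (rule ring_A)

definition e where "e = \<iota> \<one>\<^bsub>A\<^esub>"
definition \<kappa> where "\<kappa> = inv_into (carrier A) \<iota>"
text \<open>The structure map of \<open>A\<close> as a \<open>K\<close>-algebra.\<close>

definition \<alpha> where "\<alpha> k = \<kappa> (e \<otimes>\<^bsub>L\<^esub> \<eta> k)"

lemmas iota = rng_homD[OF embedding]

lemma e_closed [simp, intro]: "e \<in> carrier L" and e_idem [simp]: "e \<otimes>\<^bsub>L\<^esub> e = e"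
  using iota(1)[of "\<one>\<^bsub>A\<^esub>"] iota(3)[of "\<one>\<^bsub>A\<^esub>" "\<one>\<^bsub>A\<^esub>"] by (simp_all add: e_def)

lemma e_idem' [simp]: "u \<in> carrier L \<Longrightarrow> e \<otimes>\<^bsub>L\<^esub> (e \<otimes>\<^bsub>L\<^esub> u) = e \<otimes>\<^bsub>L\<^esub> u"
  by (simp add: L.m_assoc[symmetric])

lemma e_iota [simp]: "a \<in> carrier A \<Longrightarrow> e \<otimes>\<^bsub>L\<^esub> \<iota> a = \<iota> a" "a \<in> carrier A \<Longrightarrow> \<iota> a \<otimes>\<^bsub>L\<^esub> e = \<iota> a"
  using iota(3)[of "\<one>\<^bsub>A\<^esub>" a] iota(3)[of a "\<one>\<^bsub>A\<^esub>"] by (simp_all add: e_def)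

lemma kappa:
  assumes "u \<in> carrier L" "e \<otimes>\<^bsub>L\<^esub> u = u" "u \<otimes>\<^bsub>L\<^esub> e = u"
  shows "\<kappa> u \<in> carrier A" "\<iota> (\<kappa> u) = u"
proof -
  have "u \<in> \<iota> ` carrier A" using full[of u] assms by (simp add: e_def)
  then show "\<kappa> u \<in> carrier A" "\<iota> (\<kappa> u) = u"
    by (simp_all add: \<kappa>_def inv_into_into f_inv_into_f)
qed

lemma kappa_iota [simp]: "a \<in> carrier A \<Longrightarrow> \<kappa> (\<iota> a) = a"
  using inj_embedding by (simp add: \<kappa>_def)

lemma kappa_eqI: "a \<in> carrier A \<Longrightarrow> u = \<iota> a \<Longrightarrow> \<kappa> u = a"
  by simp

lemma eta_closed [simp]: "k \<in> carrier K \<Longrightarrow> \<eta> k \<in> carrier L"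
  by (rule ring_hom_closed[OF structure_map])

lemma alpha: assumes k: "k \<in> carrier K" shows "\<alpha> k \<in> carrier A" "\<iota> (\<alpha> k) = e \<otimes>\<^bsub>L\<^esub> \<eta> k"
proof -
  have "e \<otimes>\<^bsub>L\<^esub> \<eta> k \<otimes>\<^bsub>L\<^esub> e = e \<otimes>\<^bsub>L\<^esub> \<eta> k" using central[OF k, of e] k by (simp add: L.m_assoc)
  then show "\<alpha> k \<in> carrier A" "\<iota> (\<alpha> k) = e \<otimes>\<^bsub>L\<^esub> \<eta> k"
    using kappa[of "e \<otimes>\<^bsub>L\<^esub> \<eta> k"] k by (simp_all add: \<alpha>_def)
qed

lemma iota_eqD: "\<iota> a = \<iota> b \<Longrightarrow> a \<in> carrier A \<Longrightarrow> b \<in> carrier A \<Longrightarrow> a = b"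
  using inj_embedding by (auto dest: inj_onD)

lemma alpha_ring_hom: "\<alpha> \<in> ring_hom K A"
proof (rule ring_hom_memI)
  fix k l assume kl: "k \<in> carrier K" "l \<in> carrier K"
  have "e \<otimes>\<^bsub>L\<^esub> (\<eta> k \<otimes>\<^bsub>L\<^esub> \<eta> l) = e \<otimes>\<^bsub>L\<^esub> (\<eta> k \<otimes>\<^bsub>L\<^esub> (e \<otimes>\<^bsub>L\<^esub> \<eta> l))"
    using kl central[OF kl(1), of e] by (simp add: L.m_assoc[symmetric])
  then show "\<alpha> (k \<otimes>\<^bsub>K\<^esub> l) = \<alpha> k \<otimes>\<^bsub>A\<^esub> \<alpha> l"
    using kl alpha by (intro iota_eqD) (auto simp: iota(3) ring_hom_mult[OF structure_map] L.m_assoc)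
  show "\<alpha> (k \<oplus>\<^bsub>K\<^esub> l) = \<alpha> k \<oplus>\<^bsub>A\<^esub> \<alpha> l"
    using kl alpha by (intro iota_eqD) (auto simp: iota(2) ring_hom_add[OF structure_map] L.r_distr)
next
  show "\<alpha> \<one>\<^bsub>K\<^esub> = \<one>\<^bsub>A\<^esub>"
    using alpha by (intro iota_eqD) (auto simp: ring_hom_one[OF structure_map] e_def[symmetric])
qed (rule alpha(1))

abbreviation corner :: "('l, 'x, 'g) module_scheme \<Rightarrow> ('a, 'x) module"
  where "corner X \<equiv> pullback A \<iota> X"

lemma carrier_corner: "carrier (corner X) = {x \<in> carrier X. e \<odot>\<^bsub>X\<^esub> x = x}"
  by (simp add: carrier_pullback e_def)

lemma left_module_corner: "left_module L X \<Longrightarrow> left_module A (corner X)"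
  by (rule left_module_pullback[OF ring_A _ embedding])

text \<open>The map \<open>u \<mapsto> e u e\<close> is a \<open>K\<close>-linear surjection of \<open>L\<close> onto its corner, since \<open>K\<close> is central.\<close>

lemma finite_algebra_corner: "finite_algebra K \<alpha> A"
proof
  let ?X = "restrict (regular_module L)" and ?Y = "pullback K \<alpha> (regular_module A)"
  let ?h = "\<lambda>u. \<kappa> (e \<otimes>\<^bsub>L\<^esub> u \<otimes>\<^bsub>L\<^esub> e)"
  have RL: "left_module L (regular_module L)" and RA: "left_module A (regular_module A)"
    by (simp_all add: left_module_regular ring ring_A)
  have cX: "carrier ?X = carrier L" using carrier_restrict[OF RL] by simp
  have cY: "carrier ?Y = carrier A"
    using carrier_restrict_scalars[OF RA alpha_ring_hom] by simp
  have h: "?h u \<in> carrier A" "\<iota> (?h u) = e \<otimes>\<^bsub>L\<^esub> u \<otimes>\<^bsub>L\<^esub> e" if "u \<in> carrier L" for u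
    using kappa[of "e \<otimes>\<^bsub>L\<^esub> u \<otimes>\<^bsub>L\<^esub> e"] that by (simp_all add: L.m_assoc)
  have hom: "?h \<in> module_hom K ?X ?Y"
  proof (rule module_homI)
    fix u v assume "u \<in> carrier ?X" "v \<in> carrier ?X"
    then have uv: "u \<in> carrier L" "v \<in> carrier L" by (simp_all only: cX)
    have "?h (u \<oplus>\<^bsub>L\<^esub> v) = ?h u \<oplus>\<^bsub>A\<^esub> ?h v"
      using uv h h(1)[OF L.a_closed[OF uv]] h(2)[OF L.a_closed[OF uv]]
      by (intro iota_eqD) (simp_all add: iota(2) L.r_distr L.l_distr)
    then show "?h (u \<oplus>\<^bsub>?X\<^esub> v) = ?h u \<oplus>\<^bsub>?Y\<^esub> ?h v" by simp
  next
    fix k u assume k: "k \<in> carrier K" and "u \<in> carrier ?X"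
    then have u: "u \<in> carrier L" by (simp only: cX)
    have "\<eta> k \<otimes>\<^bsub>L\<^esub> (e \<otimes>\<^bsub>L\<^esub> (u \<otimes>\<^bsub>L\<^esub> e)) = e \<otimes>\<^bsub>L\<^esub> (\<eta> k \<otimes>\<^bsub>L\<^esub> (u \<otimes>\<^bsub>L\<^esub> e))"
      using central[OF k, of e] k u by (simp add: L.m_assoc[symmetric])
    then have "?h (\<eta> k \<otimes>\<^bsub>L\<^esub> u) = \<alpha> k \<otimes>\<^bsub>A\<^esub> ?h u"
      using u k h[of u] h[of "\<eta> k \<otimes>\<^bsub>L\<^esub> u"] alpha
      by (intro iota_eqD) (simp_all add: iota(3) L.m_assoc)
    then show "?h (k \<odot>\<^bsub>?X\<^esub> u) = k \<odot>\<^bsub>?Y\<^esub> ?h u" by simp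
  next
    fix u assume "u \<in> carrier ?X"
    then show "?h u \<in> carrier ?Y" unfolding cX cY by (rule h(1))
  qed
  interpret module_map K ?X ?Y ?h
    using hom left_module_restrict[OF RL] left_module_pullback[OF K.ring_axioms RA ring_hom_rng_hom[OF alpha_ring_hom]]
    by (simp add: module_map_def module_map_axioms_def)
  have "?h ` carrier ?X = carrier ?Y"
    unfolding cX cY
  proof
    show "?h ` carrier L \<subseteq> carrier A" using h by auto
    show "carrier A \<subseteq> ?h ` carrier L"
    proof
      fix a assume "a \<in> carrier A"
      then show "a \<in> ?h ` carrier L" using iota(1) by (intro image_eqI[of _ _ "\<iota> a"]) auto
    qed
  qed
  from fg_image[OF finite this] show "fg_module K ?Y" .
qed (rule scalars ring_A alpha_ring_hom)+

text \<open>Over \<open>K\<close>, the corner \<open>eX\<close> is a homomorphic image of \<open>X\<close>.\<close>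

lemma fg_corner:
  assumes fg: "fg_module L X" shows "fg_module A (corner X)"
proof -
  interpret A_alg: finite_algebra K \<alpha> A by (rule finite_algebra_corner)
  have X: "left_module L X" using fg by (simp add: fg_module_def)
  then interpret XL: left_module L X .
  note cX = left_module_corner[OF X]
  let ?h = "\<lambda>x. e \<odot>\<^bsub>X\<^esub> x"
  have hom: "?h \<in> module_hom K (restrict X) (A_alg.restrict (corner X))"
  proof (rule module_homI)
    fix k x assume k: "k \<in> carrier K" and "x \<in> carrier (restrict X)"
    then have x: "x \<in> carrier X" by (simp only: carrier_restrict[OF X])
    have "e \<odot>\<^bsub>X\<^esub> (\<eta> k \<odot>\<^bsub>X\<^esub> x) = (e \<otimes>\<^bsub>L\<^esub> \<eta> k \<otimes>\<^bsub>L\<^esub> e) \<odot>\<^bsub>X\<^esub> x"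
      using k x central[OF k, of e] by (simp add: XL.smult_assoc1[symmetric] L.m_assoc)
    then show "?h (k \<odot>\<^bsub>restrict X\<^esub> x) = k \<odot>\<^bsub>A_alg.restrict (corner X)\<^esub> ?h x"
      using x k by (simp add: alpha XL.smult_assoc1)
  qed (use XL.smult_assoc1[of e e] in \<open>auto simp: carrier_restrict[OF X] A_alg.carrier_restrict[OF cX] carrier_corner XL.smult_r_distr\<close>)
  interpret module_map K "restrict X" "A_alg.restrict (corner X)" ?h
    using hom left_module_restrict[OF X] A_alg.left_module_restrict[OF cX]
    by (simp add: module_map_def module_map_axioms_def)
  have "?h ` carrier (restrict X) = carrier (A_alg.restrict (corner X))"
    unfolding carrier_restrict[OF X] A_alg.carrier_restrict[OF cX] carrier_corner
    using XL.smult_assoc1[of e e] by force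
  from fg_image[OF _ this] show ?thesis
    using fg fg_restrict_iff[OF X] A_alg.fg_restrict_iff[OF cX] by simp
qed

text \<open>The \<open>A\<close>-\<open>L\<close>-bimodule \<open>eL\<close>.\<close>

definition row_bimodule :: "('a, 'l, 'l) bimodule"
  where "row_bimodule = module.extend (corner (regular_module L)) (bimodule.fields (mult L))"

abbreviation E where "E \<equiv> {u \<in> carrier L. e \<otimes>\<^bsub>L\<^esub> u = u}"

lemma row_bimodule_simps [simp]:
  "carrier row_bimodule = E" "\<zero>\<^bsub>row_bimodule\<^esub> = \<zero>\<^bsub>L\<^esub>" "add row_bimodule = add L"
  "a \<odot>\<^bsub>row_bimodule\<^esub> u = \<iota> a \<otimes>\<^bsub>L\<^esub> u" "u \<boxdot>\<^bsub>row_bimodule\<^esub> l = u \<otimes>\<^bsub>L\<^esub> l"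
  by (simp_all add: row_bimodule_def module.defs bimodule.defs carrier_corner[simplified] pullback_def regular_module_def e_def)

lemma row_bimodule: "bimodule A L row_bimodule" and fg_row_bimodule: "fg_module A row_bimodule"
proof -
  have RL: "left_module L (regular_module L)" by (rule left_module_regular[OF ring])
  have "fg_module A (corner (regular_module L))"
    by (rule fg_corner) (use fg_restrict_iff[OF RL] finite in simp)
  then show fg: "fg_module A row_bimodule"
    by (rule fg_module_cong) (auto simp: fun_eq_iff pullback_def regular_module_def e_def)
  show "bimodule A L row_bimodule"
  proof (rule bimodule.intro)
    show "left_module A row_bimodule" using fg by (simp add: fg_module_def)
  qed (auto simp: ring L.r_distr L.l_distr L.m_assoc L.m_assoc[symmetric] iota(1) simp del: L.m_assoc)
qed

end

context corner_ring begin

abbreviation coind :: "('a, 'w, 'g) module_scheme \<Rightarrow> ('l, 'l \<Rightarrow> 'w) module"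
  where "coind I \<equiv> hom_module A row_bimodule I"

lemma left_module_coind: "left_module A I \<Longrightarrow> left_module L (coind I)"
  by (rule left_module_hom_module[OF row_bimodule])

lemma fg_coind:
  assumes "fg_module A I" shows "fg_module L (coind I)"
proof (rule fg_hom_module[OF finite_algebra_corner finite_algebra_axioms row_bimodule fg_row_bimodule assms])
  fix k u assume k: "k \<in> carrier K" and "u \<in> carrier row_bimodule"
  then have u: "u \<in> carrier L" "e \<otimes>\<^bsub>L\<^esub> u = u" by auto
  have "e \<otimes>\<^bsub>L\<^esub> \<eta> k \<otimes>\<^bsub>L\<^esub> u = e \<otimes>\<^bsub>L\<^esub> u \<otimes>\<^bsub>L\<^esub> \<eta> k"
    using central[OF k u(1)] k u(1) by (simp add: L.m_assoc)
  then show "\<alpha> k \<odot>\<^bsub>row_bimodule\<^esub> u = u \<boxdot>\<^bsub>row_bimodule\<^esub> \<eta> k" using k u by (simp add: alpha)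
qed

lemma coindD:
  assumes "h \<in> carrier (coind I)"
  shows "u \<in> carrier L \<Longrightarrow> e \<otimes>\<^bsub>L\<^esub> u = u \<Longrightarrow> h u \<in> carrier I"
    "u \<in> carrier L \<Longrightarrow> e \<otimes>\<^bsub>L\<^esub> u = u \<Longrightarrow> v \<in> carrier L \<Longrightarrow> e \<otimes>\<^bsub>L\<^esub> v = v \<Longrightarrow> h (u \<oplus>\<^bsub>L\<^esub> v) = h u \<oplus>\<^bsub>I\<^esub> h v"
    "a \<in> carrier A \<Longrightarrow> u \<in> carrier L \<Longrightarrow> e \<otimes>\<^bsub>L\<^esub> u = u \<Longrightarrow> h (\<iota> a \<otimes>\<^bsub>L\<^esub> u) = a \<odot>\<^bsub>I\<^esub> h u"
  using assms module_homD[of h A row_bimodule I] by auto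

lemma coindI:
  assumes "\<And>u. u \<in> carrier L \<Longrightarrow> e \<otimes>\<^bsub>L\<^esub> u = u \<Longrightarrow> f u \<in> carrier I"
    "\<And>u v. u \<in> carrier L \<Longrightarrow> e \<otimes>\<^bsub>L\<^esub> u = u \<Longrightarrow> v \<in> carrier L \<Longrightarrow> e \<otimes>\<^bsub>L\<^esub> v = v \<Longrightarrow> f (u \<oplus>\<^bsub>L\<^esub> v) = f u \<oplus>\<^bsub>I\<^esub> f v"
    "\<And>a u. a \<in> carrier A \<Longrightarrow> u \<in> carrier L \<Longrightarrow> e \<otimes>\<^bsub>L\<^esub> u = u \<Longrightarrow> f (\<iota> a \<otimes>\<^bsub>L\<^esub> u) = a \<odot>\<^bsub>I\<^esub> f u"
  shows "(\<lambda>u\<in>E. f u) \<in> carrier (coind I)"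
proof -
  have "e \<otimes>\<^bsub>L\<^esub> (u \<oplus>\<^bsub>L\<^esub> v) = u \<oplus>\<^bsub>L\<^esub> v" "e \<otimes>\<^bsub>L\<^esub> (\<iota> a \<otimes>\<^bsub>L\<^esub> u) = \<iota> a \<otimes>\<^bsub>L\<^esub> u"
    if "u \<in> E" "v \<in> E" "a \<in> carrier A" for u v a
    using that iota(1) by (auto simp: L.r_distr L.m_assoc[symmetric])
  note E = this this[OF _ _ A.one_closed]
  show ?thesis using assms iota(1) E by (auto intro!: module_homI)
qed

lemma coind_eqI:
  assumes "h \<in> carrier (coind I)" "k \<in> carrier (coind I)"
    and "\<And>u. u \<in> carrier L \<Longrightarrow> e \<otimes>\<^bsub>L\<^esub> u = u \<Longrightarrow> h u = k u"
  shows "h = k"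
  using assms by (auto intro: extensionalityI)

lemma E_mult: "u \<in> carrier L \<Longrightarrow> e \<otimes>\<^bsub>L\<^esub> u = u \<Longrightarrow> l \<in> carrier L \<Longrightarrow> e \<otimes>\<^bsub>L\<^esub> (u \<otimes>\<^bsub>L\<^esub> l) = u \<otimes>\<^bsub>L\<^esub> l"
  by (simp add: L.m_assoc[symmetric])

lemma kappa_e: "u \<in> carrier L \<Longrightarrow> e \<otimes>\<^bsub>L\<^esub> u = u \<Longrightarrow> \<kappa> (u \<otimes>\<^bsub>L\<^esub> e) \<in> carrier A"
  "u \<in> carrier L \<Longrightarrow> e \<otimes>\<^bsub>L\<^esub> u = u \<Longrightarrow> \<iota> (\<kappa> (u \<otimes>\<^bsub>L\<^esub> e)) = u \<otimes>\<^bsub>L\<^esub> e"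
  using kappa[of "u \<otimes>\<^bsub>L\<^esub> e"] by (auto simp: E_mult L.m_assoc)

text \<open>The canonical isomorphism of \<open>I\<close> with \<open>e Hom\<^sub>A(eL, I)\<close>, \<open>x \<mapsto> (u \<mapsto> (u e) x)\<close>; its inverse is
  evaluation at \<open>e\<close>.\<close>

definition coind_embed :: "('a, 'w, 'g) module_scheme \<Rightarrow> 'w \<Rightarrow> 'l \<Rightarrow> 'w"
  where "coind_embed I x = (\<lambda>u\<in>E. \<kappa> (u \<otimes>\<^bsub>L\<^esub> e) \<odot>\<^bsub>I\<^esub> x)"

lemma coind_embed_hom:
  assumes I: "left_module A I"
  shows "coind_embed I \<in> module_hom A I (corner (coind I))"
proof -
  interpret I: left_module A I by fact
  have C: "left_module L (coind I)" by (rule left_module_coind[OF I])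
  have closed: "coind_embed I x \<in> carrier (coind I)" if x: "x \<in> carrier I" for x
    unfolding coind_embed_def
  proof (rule coindI)
    fix u v assume uv: "u \<in> carrier L" "e \<otimes>\<^bsub>L\<^esub> u = u" "v \<in> carrier L" "e \<otimes>\<^bsub>L\<^esub> v = v"
    have "\<kappa> ((u \<oplus>\<^bsub>L\<^esub> v) \<otimes>\<^bsub>L\<^esub> e) = \<kappa> (u \<otimes>\<^bsub>L\<^esub> e) \<oplus>\<^bsub>A\<^esub> \<kappa> (v \<otimes>\<^bsub>L\<^esub> e)"
      using uv by (intro kappa_eqI) (simp_all add: kappa_e iota(2) L.l_distr)
    then show "\<kappa> ((u \<oplus>\<^bsub>L\<^esub> v) \<otimes>\<^bsub>L\<^esub> e) \<odot>\<^bsub>I\<^esub> x = \<kappa> (u \<otimes>\<^bsub>L\<^esub> e) \<odot>\<^bsub>I\<^esub> x \<oplus>\<^bsub>I\<^esub> \<kappa> (v \<otimes>\<^bsub>L\<^esub> e) \<odot>\<^bsub>I\<^esub> x"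
      using uv x by (simp add: kappa_e I.smult_l_distr)
  next
    fix a u assume u: "a \<in> carrier A" "u \<in> carrier L" "e \<otimes>\<^bsub>L\<^esub> u = u"
    have "\<kappa> (\<iota> a \<otimes>\<^bsub>L\<^esub> u \<otimes>\<^bsub>L\<^esub> e) = a \<otimes>\<^bsub>A\<^esub> \<kappa> (u \<otimes>\<^bsub>L\<^esub> e)"
      using u by (intro kappa_eqI) (simp_all add: kappa_e iota(1,3) L.m_assoc)
    then show "\<kappa> (\<iota> a \<otimes>\<^bsub>L\<^esub> u \<otimes>\<^bsub>L\<^esub> e) \<odot>\<^bsub>I\<^esub> x = a \<odot>\<^bsub>I\<^esub> (\<kappa> (u \<otimes>\<^bsub>L\<^esub> e) \<odot>\<^bsub>I\<^esub> x)"
      using u x by (simp add: kappa_e I.smult_assoc1)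
  qed (use x kappa_e in auto)
  show ?thesis
  proof (rule module_homI)
    fix x assume x: "x \<in> carrier I"
    have "e \<odot>\<^bsub>coind I\<^esub> coind_embed I x = coind_embed I x"
      by (rule coind_eqI[OF left_module.smult_closed[OF C e_closed closed[OF x]] closed[OF x]])
        (use x in \<open>auto simp: coind_embed_def E_mult L.m_assoc\<close>)
    then show "coind_embed I x \<in> carrier (corner (coind I))" using closed[OF x] by (simp only: carrier_corner) auto
  next
    fix x y assume xy: "x \<in> carrier I" "y \<in> carrier I"
    have "coind_embed I (x \<oplus>\<^bsub>I\<^esub> y) = coind_embed I x \<oplus>\<^bsub>coind I\<^esub> coind_embed I y"
      unfolding coind_embed_def using xy by (auto simp: fun_eq_iff kappa_e I.smult_r_distr restrict_def)
    then show "coind_embed I (x \<oplus>\<^bsub>I\<^esub> y) = coind_embed I x \<oplus>\<^bsub>corner (coind I)\<^esub> coind_embed I y" by simp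
  next
    fix a x assume ax: "a \<in> carrier A" "x \<in> carrier I"
    have "\<kappa> (u \<otimes>\<^bsub>L\<^esub> \<iota> a \<otimes>\<^bsub>L\<^esub> e) = \<kappa> (u \<otimes>\<^bsub>L\<^esub> e) \<otimes>\<^bsub>A\<^esub> a" if u: "u \<in> carrier L" "e \<otimes>\<^bsub>L\<^esub> u = u" for u
      using u ax by (intro kappa_eqI) (simp_all add: kappa_e iota(1,3) L.m_assoc)
    then have "coind_embed I (a \<odot>\<^bsub>I\<^esub> x) = \<iota> a \<odot>\<^bsub>coind I\<^esub> coind_embed I x"
      unfolding coind_embed_def using ax iota(1)
      by (auto simp: fun_eq_iff kappa_e I.smult_assoc1 restrict_def E_mult)
    then show "coind_embed I (a \<odot>\<^bsub>I\<^esub> x) = a \<odot>\<^bsub>corner (coind I)\<^esub> coind_embed I x" by simp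
  qed
qed

lemma coind_embed_at_e:
  assumes "left_module A I" "x \<in> carrier I" shows "coind_embed I x e = x"
proof -
  interpret I: left_module A I by fact
  have "\<kappa> e = \<one>\<^bsub>A\<^esub>" by (rule kappa_eqI) (simp_all add: e_def)
  then show ?thesis using assms(2) by (simp add: coind_embed_def)
qed

lemma corner_coind:
  assumes I: "left_module A I" and h: "h \<in> carrier (coind I)"
  shows "e \<odot>\<^bsub>coind I\<^esub> h = coind_embed I (h e)"
proof (rule coind_eqI)
  have C: "left_module L (coind I)" by (rule left_module_coind[OF I])
  show "e \<odot>\<^bsub>coind I\<^esub> h \<in> carrier (coind I)" by (rule left_module.smult_closed[OF C e_closed h])
  have "h e \<in> carrier I" using coindD(1)[OF h] by simp
  then show "coind_embed I (h e) \<in> carrier (coind I)"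
    using module_homD(1)[OF coind_embed_hom[OF I]] unfolding carrier_corner by blast
  fix u assume u: "u \<in> carrier L" "e \<otimes>\<^bsub>L\<^esub> u = u"
  have "h (\<iota> (\<kappa> (u \<otimes>\<^bsub>L\<^esub> e)) \<otimes>\<^bsub>L\<^esub> e) = \<kappa> (u \<otimes>\<^bsub>L\<^esub> e) \<odot>\<^bsub>I\<^esub> h e"
    using coindD(3)[OF h kappa_e(1)[OF u]] by simp
  then show "(e \<odot>\<^bsub>coind I\<^esub> h) u = coind_embed I (h e) u"
    using u by (simp add: coind_embed_def kappa_e L.m_assoc)
qed

lemma coind_value:
  assumes h: "h \<in> carrier (coind I)" and u: "u \<in> carrier L" "e \<otimes>\<^bsub>L\<^esub> u = u"
  shows "(u \<odot>\<^bsub>coind I\<^esub> h) e = h u"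
  using u by simp

section \<open>Coinduction preserves indecomposable injective modules\<close>

text \<open>By adjunction, a homomorphism \<open>f\<close> into the coinduced module is determined by the \<open>A\<close>-linear map
  \<open>x \<mapsto> f x e\<close> on \<open>eU\<close>. The extension of the latter to \<open>eV\<close> exists by injectivity of \<open>I\<close>, and
  \<open>v \<mapsto> (u \<mapsto> g (u v))\<close> turns it back into an extension of \<open>f\<close>.\<close>

lemma injective_coind:
  assumes I: "left_module A I" and inj: "injective A I"
  shows "injective L (coind I)"
  unfolding injective_def
proof (intro allI impI, elim conjE)
  fix U V :: "('l, (nat \<Rightarrow> 'l) set) module" and i f
  assume U: "fg_module L U" and V: "fg_module L V" and i: "i \<in> module_hom L U V" "inj_on i (carrier U)"
    and f: "f \<in> module_hom L U (coind I)"
  have mU: "left_module L U" and mV: "left_module L V" using U V by (simp_all add: fg_module_def)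
  interpret U: left_module L U by fact
  interpret V: left_module L V by fact
  interpret I: left_module A I by fact
  note cU = carrier_corner[of U] and cV = carrier_corner[of V]
  note iD = module_homD[OF i(1)] and fD = module_homD[OF f]
  have "(\<lambda>x. f x e) \<in> module_hom A (corner U) I"
  proof (rule module_homI)
    fix x assume "x \<in> carrier (corner U)"
    then show "f x e \<in> carrier I" using coindD(1)[OF fD(1)] by (simp add: cU)
  next
    fix x y assume "x \<in> carrier (corner U)" "y \<in> carrier (corner U)"
    then show "f (x \<oplus>\<^bsub>corner U\<^esub> y) e = f x e \<oplus>\<^bsub>I\<^esub> f y e" using fD(2) by (simp add: cU)
  next
    fix a x assume a: "a \<in> carrier A" and "x \<in> carrier (corner U)"
    then have x: "x \<in> carrier U" by (simp add: cU)
    have "f (\<iota> a \<odot>\<^bsub>U\<^esub> x) e = f x (\<iota> a \<otimes>\<^bsub>L\<^esub> e)" using fD(3)[OF iota(1)[OF a] x] a by simp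
    also have "\<dots> = a \<odot>\<^bsub>I\<^esub> f x e" using coindD(3)[OF fD(1)[OF x] a] by simp
    finally show "f (a \<odot>\<^bsub>corner U\<^esub> x) e = a \<odot>\<^bsub>I\<^esub> f x e" by simp
  qed
  moreover have "i \<in> module_hom A (corner U) (corner V)"
    by (rule module_hom_pullback[OF mU mV ring_A embedding i(1)])
  moreover have "inj_on i (carrier (corner U))"
    using i(2) by (rule inj_on_subset) (auto simp: cU)
  ultimately obtain g where g: "g \<in> module_hom A (corner V) I"
    "\<And>x. x \<in> carrier (corner U) \<Longrightarrow> g (i x) = f x e"
    using injective_extension[OF inj fg_corner[OF U] fg_corner[OF V], of i "\<lambda>x. f x e"] by blast
  note gD = module_homD[OF g(1), unfolded cV]
  have uv: "u \<odot>\<^bsub>V\<^esub> v \<in> {x \<in> carrier V. e \<odot>\<^bsub>V\<^esub> x = x}"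
    if "u \<in> carrier L" "e \<otimes>\<^bsub>L\<^esub> u = u" "v \<in> carrier V" for u v
    using that by (simp add: V.smult_assoc1[symmetric])
  have closed: "(\<lambda>u\<in>E. g (u \<odot>\<^bsub>V\<^esub> v)) \<in> carrier (coind I)" if v: "v \<in> carrier V" for v
  proof (rule coindI)
    fix u w assume "u \<in> carrier L" "e \<otimes>\<^bsub>L\<^esub> u = u" "w \<in> carrier L" "e \<otimes>\<^bsub>L\<^esub> w = w"
    then show "g ((u \<oplus>\<^bsub>L\<^esub> w) \<odot>\<^bsub>V\<^esub> v) = g (u \<odot>\<^bsub>V\<^esub> v) \<oplus>\<^bsub>I\<^esub> g (w \<odot>\<^bsub>V\<^esub> v)"
      using gD(2)[OF uv uv, of u v w v] v by (simp add: V.smult_l_distr)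
  next
    fix a u assume "a \<in> carrier A" "u \<in> carrier L" "e \<otimes>\<^bsub>L\<^esub> u = u"
    then show "g ((\<iota> a \<otimes>\<^bsub>L\<^esub> u) \<odot>\<^bsub>V\<^esub> v) = a \<odot>\<^bsub>I\<^esub> g (u \<odot>\<^bsub>V\<^esub> v)"
      using gD(3)[OF _ uv, of a u v] v iota(1) by (simp add: V.smult_assoc1)
  qed (rule gD(1)[OF uv[OF _ _ v]])
  show "\<exists>g\<in>module_hom L V (coind I). \<forall>u\<in>carrier U. g (i u) = f u"
  proof (intro bexI ballI)
    show "(\<lambda>v. \<lambda>u\<in>E. g (u \<odot>\<^bsub>V\<^esub> v)) \<in> module_hom L V (coind I)"
    proof (rule module_homI, rule closed)
      fix v w assume "v \<in> carrier V" "w \<in> carrier V"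
      then show "(\<lambda>u\<in>E. g (u \<odot>\<^bsub>V\<^esub> (v \<oplus>\<^bsub>V\<^esub> w)))
          = (\<lambda>u\<in>E. g (u \<odot>\<^bsub>V\<^esub> v)) \<oplus>\<^bsub>coind I\<^esub> (\<lambda>u\<in>E. g (u \<odot>\<^bsub>V\<^esub> w))"
        using gD(2)[OF uv uv] by (auto simp: fun_eq_iff restrict_def V.smult_r_distr)
    next
      fix l v assume l: "l \<in> carrier L" "v \<in> carrier V"
      then show "(\<lambda>u\<in>E. g (u \<odot>\<^bsub>V\<^esub> (l \<odot>\<^bsub>V\<^esub> v))) = l \<odot>\<^bsub>coind I\<^esub> (\<lambda>u\<in>E. g (u \<odot>\<^bsub>V\<^esub> v))"
        by (auto simp: fun_eq_iff restrict_def V.smult_assoc1 E_mult)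
    qed
    fix x assume x: "x \<in> carrier U"
    show "(\<lambda>u\<in>E. g (u \<odot>\<^bsub>V\<^esub> i x)) = f x"
    proof (rule coind_eqI[OF closed[OF iD(1)[OF x]] fD(1)[OF x]])
      fix u assume u: "u \<in> carrier L" "e \<otimes>\<^bsub>L\<^esub> u = u"
      have "u \<odot>\<^bsub>U\<^esub> x \<in> carrier (corner U)" using u x by (simp add: cU U.smult_assoc1[symmetric])
      from g(2)[OF this] have "g (u \<odot>\<^bsub>V\<^esub> i x) = f (u \<odot>\<^bsub>U\<^esub> x) e" using iD(3)[OF u(1) x] by simp
      also have "\<dots> = f x u" using fD(3)[OF u(1) x] u coind_value[OF fD(1)[OF x] u] by simp
      finally show "(\<lambda>u\<in>E. g (u \<odot>\<^bsub>V\<^esub> i x)) u = f x u" using u by simp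
    qed
  qed
qed

text \<open>A submodule \<open>U\<close> of the coinduced module is zero as soon as \<open>eU\<close> is: for \<open>h\<close> in \<open>U\<close> every value \<open>h u\<close>
  is, under \<open>coind_embed\<close>, the element \<open>e (u h)\<close> of \<open>eU\<close>. A decomposition of the coinduced
  module is thus trivial if the decomposition of \<open>I\<close> that it induces is trivial.\<close>

lemma indecomposable_coind:
  assumes I: "left_module A I" and ind: "indecomposable A I"
  shows "indecomposable L (coind I)"
proof -
  interpret I: left_module A I by fact
  have mC: "left_module L (coind I)" by (rule left_module_coind[OF I])
  interpret C: left_module L "coind I" by (rule mC)
  interpret emb: module_map A I "corner (coind I)" "coind_embed I"
    using I coind_embed_hom[OF I] left_module_corner[OF mC] by (simp add: module_map_def module_map_axioms_def)
  have emb_closed: "coind_embed I x \<in> carrier (coind I)" if "x \<in> carrier I" for x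
    using emb.closed[OF that] unfolding carrier_corner by blast
  have emb_e: "e \<odot>\<^bsub>coind I\<^esub> coind_embed I x = coind_embed I x" if "x \<in> carrier I" for x
    using emb.closed[OF that] unfolding carrier_corner by blast
  have emb0: "coind_embed I \<zero>\<^bsub>I\<^esub> = \<zero>\<^bsub>coind I\<^esub>" using emb.zero by simp
  let ?p = "\<lambda>U. {x \<in> carrier I. coind_embed I x \<in> U}"
  have sub: "submodule (?p U) A I" if "submodule U L (coind I)" for U
    unfolding I.submodule_iff
    using C.submoduleD[OF that] emb0 emb.add emb.smult iota(1) by auto
  have val: "h u \<in> ?p U" if U: "submodule U L (coind I)" and h: "h \<in> U" and u: "u \<in> carrier L" "e \<otimes>\<^bsub>L\<^esub> u = u" for U h u
  proof -
    have hC: "h \<in> carrier (coind I)" by (rule C.submoduleD(3)[OF U h])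
    have uh: "u \<odot>\<^bsub>coind I\<^esub> h \<in> U" by (rule C.submoduleD(5)[OF U u(1) h])
    have "e \<odot>\<^bsub>coind I\<^esub> (u \<odot>\<^bsub>coind I\<^esub> h) = coind_embed I (h u)"
      using corner_coind[OF I C.submoduleD(3)[OF U uh]] coind_value[OF hC u] by simp
    moreover have "e \<odot>\<^bsub>coind I\<^esub> (u \<odot>\<^bsub>coind I\<^esub> h) \<in> U" by (rule C.submoduleD(5)[OF U e_closed uh])
    ultimately show ?thesis using coindD(1)[OF hC u] by simp
  qed
  have zero: "U = {\<zero>\<^bsub>coind I\<^esub>}" if U: "submodule U L (coind I)" and "?p U = {\<zero>\<^bsub>I\<^esub>}" for U
  proof -
    have "h = \<zero>\<^bsub>coind I\<^esub>" if "h \<in> U" for h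
    proof (rule coind_eqI[OF C.submoduleD(3)[OF U that] C.M.zero_closed])
      fix u assume u: "u \<in> carrier L" "e \<otimes>\<^bsub>L\<^esub> u = u"
      show "h u = \<zero>\<^bsub>coind I\<^esub> u" using val[OF U that u] \<open>?p U = {\<zero>\<^bsub>I\<^esub>}\<close> u by auto
    qed
    then show ?thesis using C.submoduleD(2)[OF U] by blast
  qed
  have "carrier (coind I) \<noteq> {\<zero>\<^bsub>coind I\<^esub>}"
  proof
    assume C0: "carrier (coind I) = {\<zero>\<^bsub>coind I\<^esub>}"
    have "x = \<zero>\<^bsub>I\<^esub>" if "x \<in> carrier I" for x
    proof -
      have "coind_embed I x = \<zero>\<^bsub>coind I\<^esub>" using emb_closed[OF that] C0 by blast
      then show ?thesis using coind_embed_at_e[OF I that] by simp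
    qed
    then have "carrier I = {\<zero>\<^bsub>I\<^esub>}" by auto
    then show False using ind by (simp add: indecomposable_def)
  qed
  moreover have "U = {\<zero>\<^bsub>coind I\<^esub>} \<or> V = {\<zero>\<^bsub>coind I\<^esub>}"
    if U: "submodule U L (coind I)" and V: "submodule V L (coind I)"
      and UV: "U <+>\<^bsub>coind I\<^esub> V = carrier (coind I)" "U \<inter> V = {\<zero>\<^bsub>coind I\<^esub>}" for U V
  proof -
    have "?p U \<inter> ?p V = {\<zero>\<^bsub>I\<^esub>}"
    proof
      show "?p U \<inter> ?p V \<subseteq> {\<zero>\<^bsub>I\<^esub>}"
      proof
        fix x assume x: "x \<in> ?p U \<inter> ?p V"
        then have "coind_embed I x = \<zero>\<^bsub>coind I\<^esub>" using UV(2) by blast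
        then show "x \<in> {\<zero>\<^bsub>I\<^esub>}" using coind_embed_at_e[OF I, of x] x by simp
      qed
      show "{\<zero>\<^bsub>I\<^esub>} \<subseteq> ?p U \<inter> ?p V"
        using I.submoduleD(2)[OF sub[OF U]] I.submoduleD(2)[OF sub[OF V]] by blast
    qed
    moreover have "?p U <+>\<^bsub>I\<^esub> ?p V = carrier I"
    proof
      show "?p U <+>\<^bsub>I\<^esub> ?p V \<subseteq> carrier I" by (auto simp: set_add_def')
      show "carrier I \<subseteq> ?p U <+>\<^bsub>I\<^esub> ?p V"
      proof
        fix x assume x: "x \<in> carrier I"
        then obtain u v where uv: "u \<in> U" "v \<in> V" "coind_embed I x = u \<oplus>\<^bsub>coind I\<^esub> v"
          using emb_closed[OF x] unfolding UV(1)[symmetric] set_add_def' by blast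
        have "x = u e \<oplus>\<^bsub>I\<^esub> v e" using coind_embed_at_e[OF I x] uv(3) by simp
        moreover have "u e \<in> ?p U" "v e \<in> ?p V" using val[OF U uv(1)] val[OF V uv(2)] by simp_all
        ultimately show "x \<in> ?p U <+>\<^bsub>I\<^esub> ?p V" unfolding set_add_def' by blast
      qed
    qed
    ultimately have "?p U = {\<zero>\<^bsub>I\<^esub>} \<or> ?p V = {\<zero>\<^bsub>I\<^esub>}"
      using ind sub[OF U] sub[OF V] unfolding indecomposable_def by blast
    then show ?thesis using zero[OF U] zero[OF V] by blast
  qed
  ultimately show ?thesis by (simp add: indecomposable_def)
qed

lemma indecomposable_injective_coind:
  assumes "indecomposable_injective A I" shows "indecomposable_injective L (coind I)"
  using assms fg_coind[of I] injective_coind[of I] indecomposable_coind[of I]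
  by (auto simp: indecomposable_injective_def fg_module_def)

end

section \<open>Indecomposable injective modules are coinduced from a faithful corner\<close>

context corner_ring begin

lemma coind_map:
  assumes U: "left_module A U" and V: "left_module A V" and f: "f \<in> module_hom A U V"
  shows "(\<lambda>h. \<lambda>u\<in>E. f (h u)) \<in> module_hom L (coind U) (coind V)"
proof -
  note fD = module_homD[OF f]
  show ?thesis
  proof (rule module_homI)
    fix h assume h: "h \<in> carrier (coind U)"
    show "(\<lambda>u\<in>E. f (h u)) \<in> carrier (coind V)"
      by (rule coindI) (simp_all add: fD coindD[OF h])
  next
    fix h k assume hk: "h \<in> carrier (coind U)" "k \<in> carrier (coind U)"
    show "(\<lambda>u\<in>E. f ((h \<oplus>\<^bsub>coind U\<^esub> k) u)) = (\<lambda>u\<in>E. f (h u)) \<oplus>\<^bsub>coind V\<^esub> (\<lambda>u\<in>E. f (k u))"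
      using coindD(1)[OF hk(1)] coindD(1)[OF hk(2)] by (auto simp: fun_eq_iff restrict_def fD)
  next
    fix l h assume "l \<in> carrier L" "h \<in> carrier (coind U)"
    then show "(\<lambda>u\<in>E. f ((l \<odot>\<^bsub>coind U\<^esub> h) u)) = l \<odot>\<^bsub>coind V\<^esub> (\<lambda>u\<in>E. f (h u))"
      by (auto simp: fun_eq_iff restrict_def E_mult)
  qed
qed

lemma coind_map_embed:
  assumes f: "f \<in> module_hom A U V" and x: "x \<in> carrier U"
  shows "(\<lambda>u\<in>E. f (coind_embed U x u)) = coind_embed V (f x)"
  using module_homD(3)[OF f _ x] by (auto simp: fun_eq_iff restrict_def coind_embed_def kappa_e)

text \<open>Injectivity of \<open>Z\<close> gives a retraction \<open>r\<close> of the unit, and an element \<open>c\<close> of the kernel of \<open>r\<close>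
  vanishes since \<open>u c = unit (c u)\<close> for every \<open>u\<close> in \<open>eL\<close>, so that \<open>c u = r (unit (c u)) = u (r c) = 0\<close>.
  An extension problem for \<open>eZ\<close> is solved by coinducing it, which preserves injective maps, and
  solving it in \<open>Z\<close>. A pair of submodules \<open>U\<close>, \<open>V\<close> of \<open>eZ\<close> with trivial intersection yields the
  submodules of those \<open>z\<close> with \<open>eL z\<close> contained in \<open>U\<close> and \<open>V\<close> respectively; they also meet trivially,
  and uniformity of \<open>Z\<close> makes one of them zero.\<close>

lemma indecomposable_injective_corner:
  assumes Z: "indecomposable_injective L Z"
    and faithful: "\<And>z. \<lbrakk>z \<in> carrier Z; \<And>u. u \<in> E \<Longrightarrow> u \<odot>\<^bsub>Z\<^esub> z = \<zero>\<^bsub>Z\<^esub>\<rbrakk> \<Longrightarrow> z = \<zero>\<^bsub>Z\<^esub>"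
  shows "indecomposable_injective A (corner Z)" "module_isomorphic L Z (coind (corner Z))"
proof -
  have fg: "fg_module L Z" and inj: "injective L Z" and ind: "indecomposable L Z"
    using Z by (auto simp: indecomposable_injective_def)
  have mZ: "left_module L Z" using fg by (simp add: fg_module_def)
  then interpret Z: left_module L Z .
  let ?I = "corner Z" and ?C = "coind (corner Z)"
  have fgI: "fg_module A ?I" by (rule fg_corner[OF fg])
  have mI: "left_module A ?I" using fgI by (simp add: fg_module_def)
  interpret I: left_module A ?I by (rule mI)
  have fgC: "fg_module L ?C" by (rule fg_coind[OF fgI])
  have mC: "left_module L ?C" using fgC by (simp add: fg_module_def)
  interpret C: left_module L ?C by (rule mC)
  have EZ: "u \<odot>\<^bsub>Z\<^esub> z \<in> carrier ?I" if "u \<in> E" "z \<in> carrier Z" for u z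
    using that by (simp add: carrier_corner Z.smult_assoc1[symmetric])
  define unit where "unit z = (\<lambda>u\<in>E. u \<odot>\<^bsub>Z\<^esub> z)" for z
  have unit_closed: "unit z \<in> carrier ?C" if z: "z \<in> carrier Z" for z
    unfolding unit_def using EZ[OF _ z] z iota(1)
    by (intro coindI) (simp_all add: Z.smult_l_distr Z.smult_assoc1)
  have unit_hom: "unit \<in> module_hom L Z ?C"
  proof (rule module_homI)
    fix z z' assume "z \<in> carrier Z" "z' \<in> carrier Z"
    then show "unit (z \<oplus>\<^bsub>Z\<^esub> z') = unit z \<oplus>\<^bsub>?C\<^esub> unit z'"
      by (auto simp: unit_def fun_eq_iff restrict_def Z.smult_r_distr)
  next
    fix l z assume "l \<in> carrier L" "z \<in> carrier Z"
    then show "unit (l \<odot>\<^bsub>Z\<^esub> z) = l \<odot>\<^bsub>?C\<^esub> unit z"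
      by (auto simp: unit_def fun_eq_iff restrict_def Z.smult_assoc1 E_mult)
  qed (rule unit_closed)
  interpret unit: module_map L Z ?C unit
    using mZ mC unit_hom by (simp add: module_map_def module_map_axioms_def)
  have unit_inj: "inj_on unit (carrier Z)"
    unfolding unit.inj_iff
  proof (intro ballI impI)
    fix z assume z: "z \<in> carrier Z" "unit z = \<zero>\<^bsub>?C\<^esub>"
    then have "unit z u = \<zero>\<^bsub>Z\<^esub>" if "u \<in> E" for u using that by simp
    then show "z = \<zero>\<^bsub>Z\<^esub>" using faithful[OF z(1)] by (simp add: unit_def)
  qed
  have unit_embed: "unit x = coind_embed ?I x" if x: "x \<in> carrier ?I" for x
  proof -
    have x': "x \<in> carrier Z" "e \<odot>\<^bsub>Z\<^esub> x = x" using x by (simp_all add: carrier_corner)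
    have "u \<odot>\<^bsub>Z\<^esub> x = (u \<otimes>\<^bsub>L\<^esub> e) \<odot>\<^bsub>Z\<^esub> x" if "u \<in> E" for u
      using that x' by (simp add: Z.smult_assoc1)
    then show ?thesis by (auto simp: unit_def coind_embed_def fun_eq_iff restrict_def kappa_e)
  qed
  have "id \<in> module_hom L Z Z" by (auto simp: module_hom_def)
  then obtain r where r: "r \<in> module_hom L ?C Z" and r_unit: "\<And>z. z \<in> carrier Z \<Longrightarrow> r (unit z) = z"
    using injective_extension[OF inj fg fgC unit_hom unit_inj, of id] by auto
  interpret r: module_map L ?C Z r
    using mZ mC r by (simp add: module_map_def module_map_axioms_def)
  have ker_r: "c = \<zero>\<^bsub>?C\<^esub>" if c: "c \<in> carrier ?C" "r c = \<zero>\<^bsub>Z\<^esub>" for c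
  proof (rule coind_eqI[OF c(1) C.M.zero_closed])
    fix u assume u: "u \<in> carrier L" "e \<otimes>\<^bsub>L\<^esub> u = u"
    have cu: "c u \<in> carrier ?I" by (rule coindD(1)[OF c(1) u])
    have "u \<odot>\<^bsub>?C\<^esub> c = e \<odot>\<^bsub>?C\<^esub> (u \<odot>\<^bsub>?C\<^esub> c)" using C.smult_assoc1[OF e_closed u(1) c(1)] unfolding u(2) .
    also have "\<dots> = coind_embed ?I (c u)"
      using corner_coind[OF mI C.smult_closed[OF u(1) c(1)]] coind_value[OF c(1) u] by simp
    also have "\<dots> = unit (c u)" using unit_embed[OF cu] by simp
    finally have "r (unit (c u)) = u \<odot>\<^bsub>Z\<^esub> r c" using r.smult[OF u(1) c(1)] by simp
    then show "c u = \<zero>\<^bsub>?C\<^esub> u" using c(2) u r_unit[of "c u"] cu by (simp add: carrier_corner)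
  qed
  have unit_r: "unit (r h) = h" if h: "h \<in> carrier ?C" for h
  proof -
    have rh: "r h \<in> carrier Z" and uh: "unit (r h) \<in> carrier ?C" using r.closed[OF h] unit_closed by auto
    have "r (h \<ominus>\<^bsub>?C\<^esub> unit (r h)) = r h \<ominus>\<^bsub>Z\<^esub> r h" using r.diff[OF h uh] r_unit[OF rh] by simp
    also have "\<dots> = \<zero>\<^bsub>Z\<^esub>" using rh by (simp add: a_minus_def Z.M.r_neg)
    finally have "h \<ominus>\<^bsub>?C\<^esub> unit (r h) = \<zero>\<^bsub>?C\<^esub>" by (rule ker_r[OF C.M.minus_closed[OF h uh]])
    then show ?thesis using C.diff_add_cancel[OF h uh] C.M.l_zero[OF uh] by simp
  qed
  have "unit ` carrier Z = carrier ?C"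
  proof
    show "unit ` carrier Z \<subseteq> carrier ?C" using unit_closed by blast
    show "carrier ?C \<subseteq> unit ` carrier Z"
    proof
      fix h assume "h \<in> carrier ?C"
      then show "h \<in> unit ` carrier Z" using unit_r r.closed by (intro image_eqI[of _ _ "r h"]) simp_all
    qed
  qed
  then show "module_isomorphic L Z ?C"
    using unit_hom unit_inj by (auto simp: module_isomorphic_def bij_betw_def)

  have "injective A ?I"
    unfolding injective_def
  proof (intro allI impI, elim conjE)
    fix U V :: "('a, (nat \<Rightarrow> 'a) set) module" and i f
    assume U: "fg_module A U" and V: "fg_module A V" and i: "i \<in> module_hom A U V" "inj_on i (carrier U)"
      and f: "f \<in> module_hom A U ?I"
    have mU: "left_module A U" and mV: "left_module A V" using U V by (simp_all add: fg_module_def)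
    let ?ci = "\<lambda>h. \<lambda>u\<in>E. i (h u)" and ?cf = "\<lambda>h. \<lambda>u\<in>E. f (h u)"
    have ci: "?ci \<in> module_hom L (coind U) (coind V)" by (rule coind_map[OF mU mV i(1)])
    have cf: "?cf \<in> module_hom L (coind U) ?C" by (rule coind_map[OF mU mI f])
    have ci_inj: "inj_on ?ci (carrier (coind U))"
    proof (rule inj_onI)
      fix h k assume hk: "h \<in> carrier (coind U)" "k \<in> carrier (coind U)" "?ci h = ?ci k"
      show "h = k"
      proof (rule coind_eqI[OF hk(1,2)])
        fix u assume u: "u \<in> carrier L" "e \<otimes>\<^bsub>L\<^esub> u = u"
        have "i (h u) = i (k u)" using fun_cong[OF hk(3), of u] u by simp
        then show "h u = k u"
          using inj_onD[OF i(2)] coindD(1)[OF hk(1) u] coindD(1)[OF hk(2) u] by blast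
      qed
    qed
    obtain G where G: "G \<in> module_hom L (coind V) Z"
      "\<And>h. h \<in> carrier (coind U) \<Longrightarrow> G (?ci h) = (r \<circ> ?cf) h"
      using injective_extension[OF inj fg_coind[OF U] fg_coind[OF V] ci ci_inj module_hom_comp[OF cf r]] by blast
    show "\<exists>g\<in>module_hom A V ?I. \<forall>u\<in>carrier U. g (i u) = f u"
    proof (intro bexI ballI)
      show "G \<circ> coind_embed V \<in> module_hom A V ?I"
        by (rule module_hom_comp[OF coind_embed_hom[OF mV]
            module_hom_pullback[OF left_module_coind[OF mV] mZ ring_A embedding G(1)]])
      fix x assume x: "x \<in> carrier U"
      have ex: "coind_embed U x \<in> carrier (coind U)"
        using module_homD(1)[OF coind_embed_hom[OF mU] x] unfolding carrier_corner by blast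
      have fx: "f x \<in> carrier ?I" by (rule module_homD(1)[OF f x])
      have "(G \<circ> coind_embed V) (i x) = G (?ci (coind_embed U x))"
        using coind_map_embed[OF i(1) x] by simp
      also have "\<dots> = r (?cf (coind_embed U x))" using G(2)[OF ex] by simp
      also have "\<dots> = r (unit (f x))" using coind_map_embed[OF f x] unit_embed[OF fx] by simp
      also have "\<dots> = f x" using fx by (intro r_unit) (simp add: carrier_corner)
      finally show "(G \<circ> coind_embed V) (i x) = f x" .
    qed
  qed

  moreover have "indecomposable A ?I"
  proof -
    have "carrier ?I \<noteq> {\<zero>\<^bsub>?I\<^esub>}"
    proof
      assume I0: "carrier ?I = {\<zero>\<^bsub>?I\<^esub>}"
      have "z = \<zero>\<^bsub>Z\<^esub>" if z: "z \<in> carrier Z" for z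
      proof (rule faithful[OF z])
        fix u assume "u \<in> E"
        from EZ[OF this z] show "u \<odot>\<^bsub>Z\<^esub> z = \<zero>\<^bsub>Z\<^esub>" unfolding I0 by simp
      qed
      then have "carrier Z = {\<zero>\<^bsub>Z\<^esub>}" by auto
      then show False using ind by (simp add: indecomposable_def)
    qed
    moreover have "U = {\<zero>\<^bsub>?I\<^esub>} \<or> V = {\<zero>\<^bsub>?I\<^esub>}"
      if U: "submodule U A ?I" and V: "submodule V A ?I" and UV: "U \<inter> V = {\<zero>\<^bsub>?I\<^esub>}" for U V
    proof -
      define T where "T W = {z \<in> carrier Z. \<forall>u\<in>E. u \<odot>\<^bsub>Z\<^esub> z \<in> W}" for W
      have sub: "submodule (T W) L Z" if W: "submodule W A ?I" for W
        unfolding Z.submodule_iff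
      proof (intro conjI ballI)
        note WD = I.submoduleD[OF W, simplified]
        show "T W \<subseteq> carrier Z" by (auto simp: T_def)
        show "\<zero>\<^bsub>Z\<^esub> \<in> T W" using WD(2) by (auto simp: T_def)
        show "x \<oplus>\<^bsub>Z\<^esub> y \<in> T W" if "x \<in> T W" "y \<in> T W" for x y
          using that WD(4) by (auto simp: T_def Z.smult_r_distr)
        show "l \<odot>\<^bsub>Z\<^esub> x \<in> T W" if "l \<in> carrier L" "x \<in> T W" for l x
          using that by (auto simp: T_def Z.smult_assoc1[symmetric] E_mult)
      qed
      have incl: "W \<subseteq> T W" if W: "submodule W A ?I" for W
      proof
        fix x assume x: "x \<in> W"
        then have x': "x \<in> carrier Z" "e \<odot>\<^bsub>Z\<^esub> x = x"
          using I.submoduleD(3)[OF W] by (simp_all add: carrier_corner)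
        have "u \<odot>\<^bsub>Z\<^esub> x \<in> W" if "u \<in> E" for u
        proof -
          have "u \<odot>\<^bsub>Z\<^esub> x = (u \<otimes>\<^bsub>L\<^esub> e) \<odot>\<^bsub>Z\<^esub> x" using that x' by (simp add: Z.smult_assoc1)
          also have "\<dots> = \<iota> (\<kappa> (u \<otimes>\<^bsub>L\<^esub> e)) \<odot>\<^bsub>Z\<^esub> x" using that by (simp add: kappa_e)
          also have "\<dots> \<in> W" using I.submoduleD(5)[OF W _ x, of "\<kappa> (u \<otimes>\<^bsub>L\<^esub> e)"] that by (simp add: kappa_e)
          finally show ?thesis .
        qed
        then show "x \<in> T W" using x' by (simp add: T_def)
      qed
      have "z = \<zero>\<^bsub>Z\<^esub>" if "z \<in> T U \<inter> T V" for z
      proof (rule faithful)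
        show "z \<in> carrier Z" using that by (simp add: T_def)
        show "u \<odot>\<^bsub>Z\<^esub> z = \<zero>\<^bsub>Z\<^esub>" if "u \<in> E" for u
        proof -
          have "u \<odot>\<^bsub>Z\<^esub> z \<in> U \<inter> V" using \<open>z \<in> T U \<inter> T V\<close> that by (simp add: T_def)
          then show ?thesis unfolding UV by simp
        qed
      qed
      then have "T U \<inter> T V = {\<zero>\<^bsub>Z\<^esub>}" using Z.submoduleD(2)[OF sub[OF U]] Z.submoduleD(2)[OF sub[OF V]] by blast
      then have "T U = {\<zero>\<^bsub>Z\<^esub>} \<or> T V = {\<zero>\<^bsub>Z\<^esub>}"
        by (rule indecomposable_injective_uniform[OF Z sub[OF U] sub[OF V]])
      then show ?thesis
        using incl[OF U] incl[OF V] I.submoduleD(2)[OF U] I.submoduleD(2)[OF V] by auto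
    qed
    ultimately show ?thesis by (simp add: indecomposable_def)
  qed
  ultimately show "indecomposable_injective A ?I" using fgI by (simp add: indecomposable_injective_def)
qed

end

section \<open>Transport along semilinear isomorphisms\<close>

text \<open>One notion serves two purposes: with \<open>\<sigma>\<close> the identity it is an isomorphism of modules, and with
  \<open>\<sigma>\<close> the exchange of the two corners it moves modules between a Morita ring and the Morita ring
  of the exchanged context. It also supplies the module axioms of \<open>Z'\<close>, in particular for modules
  of tuples.\<close>

locale semilinear_iso = Z: left_module L Z + L': ring L'
  for L :: "('l, 'c) ring_scheme" and Z :: "('l, 'z) module" and L' :: "('m, 'd) ring_scheme" +
  fixes Z' :: "('m, 'y) module" and \<sigma> :: "'l \<Rightarrow> 'm" and h :: "'z \<Rightarrow> 'y"
  assumes sigma: "\<sigma> \<in> ring_hom L L'" and sigma_surj: "\<sigma> ` carrier L = carrier L'"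
    and bij: "bij_betw h (carrier Z) (carrier Z')"
    and h_zero: "h \<zero>\<^bsub>Z\<^esub> = \<zero>\<^bsub>Z'\<^esub>"
    and h_add: "\<lbrakk>x \<in> carrier Z; y \<in> carrier Z\<rbrakk> \<Longrightarrow> h (x \<oplus>\<^bsub>Z\<^esub> y) = h x \<oplus>\<^bsub>Z'\<^esub> h y"
    and h_smult: "\<lbrakk>l \<in> carrier L; x \<in> carrier Z\<rbrakk> \<Longrightarrow> h (l \<odot>\<^bsub>Z\<^esub> x) = \<sigma> l \<odot>\<^bsub>Z'\<^esub> h x"
begin

definition h_inv where "h_inv = inv_into (carrier Z) h"

lemma h_inv: "y \<in> carrier Z' \<Longrightarrow> h_inv y \<in> carrier Z" "y \<in> carrier Z' \<Longrightarrow> h (h_inv y) = y" "x \<in> carrier Z \<Longrightarrow> h_inv (h x) = x"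
  using bij by (auto simp: h_inv_def bij_betw_def inv_into_into f_inv_into_f)

lemma h_closed: "x \<in> carrier Z \<Longrightarrow> h x \<in> carrier Z'"
  using bij by (auto simp: bij_betw_def)

lemma sigma_obtain: assumes "l' \<in> carrier L'" obtains l where "l \<in> carrier L" "l' = \<sigma> l"
  using assms sigma_surj by blast

lemma sigma_closed: "l \<in> carrier L \<Longrightarrow> \<sigma> l \<in> carrier L'"
  using sigma_surj by blast

lemma h_obtain: assumes "y \<in> carrier Z'" obtains x where "x \<in> carrier Z" "y = h x"
  using h_inv(1,2)[OF assms] by metis

lemma target_module: "left_module L' Z'"
proof -
  note transfer = h_add[symmetric] h_smult[symmetric] h_zero[symmetric]
  have "abelian_group Z'"
  proof (rule abelian_groupI)
    fix x assume "x \<in> carrier Z'"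
    then obtain z where z: "z \<in> carrier Z" "x = h z" by (rule h_obtain)
    then have "h (\<ominus>\<^bsub>Z\<^esub> z) \<oplus>\<^bsub>Z'\<^esub> x = \<zero>\<^bsub>Z'\<^esub>" by (simp add: transfer Z.M.l_neg)
    then show "\<exists>y\<in>carrier Z'. y \<oplus>\<^bsub>Z'\<^esub> x = \<zero>\<^bsub>Z'\<^esub>" using z h_closed[of "\<ominus>\<^bsub>Z\<^esub> z"] by blast
  qed (auto elim!: h_obtain simp: transfer h_closed Z.M.a_ac)
  then show ?thesis
  proof (intro left_module.intro L'.ring_axioms left_module_axioms.intro)
    fix a b x assume "a \<in> carrier L'" "b \<in> carrier L'" "x \<in> carrier Z'"
    then obtain a0 b0 x0 where *: "a0 \<in> carrier L" "b0 \<in> carrier L" "x0 \<in> carrier Z"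
      "a = \<sigma> a0" "b = \<sigma> b0" "x = h x0" by (metis sigma_obtain h_obtain)
    then show "(a \<oplus>\<^bsub>L'\<^esub> b) \<odot>\<^bsub>Z'\<^esub> x = a \<odot>\<^bsub>Z'\<^esub> x \<oplus>\<^bsub>Z'\<^esub> b \<odot>\<^bsub>Z'\<^esub> x"
      "(a \<otimes>\<^bsub>L'\<^esub> b) \<odot>\<^bsub>Z'\<^esub> x = a \<odot>\<^bsub>Z'\<^esub> (b \<odot>\<^bsub>Z'\<^esub> x)"
      by (simp_all add: transfer ring_hom_add[OF sigma, symmetric] ring_hom_mult[OF sigma, symmetric]
          Z.smult_l_distr Z.smult_assoc1)
  next
    fix a x y assume "a \<in> carrier L'" "x \<in> carrier Z'" "y \<in> carrier Z'"
    then obtain a0 x0 y0 where "a0 \<in> carrier L" "x0 \<in> carrier Z" "y0 \<in> carrier Z"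
      "a = \<sigma> a0" "x = h x0" "y = h y0" by (metis sigma_obtain h_obtain)
    then show "a \<odot>\<^bsub>Z'\<^esub> (x \<oplus>\<^bsub>Z'\<^esub> y) = a \<odot>\<^bsub>Z'\<^esub> x \<oplus>\<^bsub>Z'\<^esub> a \<odot>\<^bsub>Z'\<^esub> y"
      by (simp add: transfer Z.smult_r_distr h_closed)
  next
    fix a x assume "a \<in> carrier L'" "x \<in> carrier Z'"
    then obtain a0 x0 where "a0 \<in> carrier L" "x0 \<in> carrier Z" "a = \<sigma> a0" "x = h x0"
      by (metis sigma_obtain h_obtain)
    then show "a \<odot>\<^bsub>Z'\<^esub> x \<in> carrier Z'" by (simp add: transfer h_closed)
  next
    fix x assume "x \<in> carrier Z'"
    then obtain x0 where "x0 \<in> carrier Z" "x = h x0" by (rule h_obtain)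
    then show "\<one>\<^bsub>L'\<^esub> \<odot>\<^bsub>Z'\<^esub> x = x" by (simp add: transfer ring_hom_one[OF sigma, symmetric])
  qed
qed

sublocale Z': left_module L' Z' by (rule target_module)

lemma submodule_preimage:
  assumes "submodule W L' Z'" shows "submodule {x \<in> carrier Z. h x \<in> W} L Z"
  using Z'.submoduleD[OF assms] by (auto simp: Z.submodule_iff h_zero h_add h_smult sigma_closed)

lemma preimage_image: "W \<subseteq> carrier Z' \<Longrightarrow> h ` {x \<in> carrier Z. h x \<in> W} = W"
proof
  show "h ` {x \<in> carrier Z. h x \<in> W} \<subseteq> W" by auto
  show "W \<subseteq> h ` {x \<in> carrier Z. h x \<in> W}" if "W \<subseteq> carrier Z'"
  proof
    fix y assume "y \<in> W"
    then show "y \<in> h ` {x \<in> carrier Z. h x \<in> W}" using that h_inv by (intro image_eqI[of _ _ "h_inv y"]) auto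
  qed
qed

lemma fg_transfer:
  assumes "fg_module L Z" shows "fg_module L' Z'"
proof -
  have "finitely_spanned L Z (carrier Z)" using assms by (simp add: fg_module_iff)
  then obtain S where S: "finite S" "S \<subseteq> carrier Z" "\<And>W. submodule W L Z \<Longrightarrow> S \<subseteq> W \<Longrightarrow> carrier Z \<subseteq> W"
    by (rule finitely_spannedE) iprover
  have "finitely_spanned L' Z' (carrier Z')"
  proof (rule finitely_spannedI)
    show "finite (h ` S)" "h ` S \<subseteq> carrier Z'" using S h_closed by auto
    fix W assume W: "submodule W L' Z'" "h ` S \<subseteq> W"
    have "S \<subseteq> {x \<in> carrier Z. h x \<in> W}" using S(2) W(2) by auto
    from S(3)[OF submodule_preimage[OF W(1)] this] show "carrier Z' \<subseteq> W" by (auto elim!: h_obtain)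
  qed
  then show ?thesis using target_module by (simp add: fg_module_iff)
qed

lemma fg_pullback:
  assumes U: "fg_module L' (U :: ('m, 'u) module)"
  shows "fg_module L (pullback L \<sigma> U)"
proof -
  have mU: "left_module L' U" using U by (simp add: fg_module_def)
  then interpret U: left_module L' U .
  have mP: "left_module L (pullback L \<sigma> U)"
    by (rule left_module_pullback[OF Z.R.ring_axioms mU ring_hom_rng_hom[OF sigma]])
  interpret P: left_module L "pullback L \<sigma> U" by (rule mP)
  have cP: "carrier (pullback L \<sigma> U) = carrier U" by (rule carrier_restrict_scalars[OF mU sigma])
  have "finitely_spanned L' U (carrier U)" using U by (simp add: fg_module_iff)
  then show ?thesis
    unfolding fg_module_iff cP
  proof (intro conjI mP, elim finitely_spannedE)
    fix S assume S: "finite S" "S \<subseteq> carrier U" "\<And>W. submodule W L' U \<Longrightarrow> S \<subseteq> W \<Longrightarrow> carrier U \<subseteq> W"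
    show "finitely_spanned L (pullback L \<sigma> U) (carrier U)"
    proof (rule finitely_spannedI[OF S(1,2)])
      fix W assume W: "submodule W L (pullback L \<sigma> U)" "S \<subseteq> W"
      have "submodule W L' U"
        using P.submoduleD[OF W(1)] cP by (auto simp: U.submodule_iff elim!: sigma_obtain)
      then show "carrier U \<subseteq> W" using W(2) by (rule S(3))
    qed
  qed
qed

text \<open>An extension problem over \<open>L'\<close> is pulled back along \<open>\<sigma>\<close> and solved in \<open>Z\<close>. The solution is linear
  over \<open>L'\<close> because \<open>\<sigma>\<close> is surjective.\<close>

lemma injective_transfer:
  assumes inj: "injective L Z" shows "injective L' Z'"
  unfolding injective_def
proof (intro allI impI, elim conjE)
  fix U V :: "('m, (nat \<Rightarrow> 'm) set) module" and i f
  assume U: "fg_module L' U" and V: "fg_module L' V" and i: "i \<in> module_hom L' U V" "inj_on i (carrier U)"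
    and f: "f \<in> module_hom L' U Z'"
  have mU: "left_module L' U" and mV: "left_module L' V" using U V by (simp_all add: fg_module_def)
  note cU = carrier_restrict_scalars[OF mU sigma] and cV = carrier_restrict_scalars[OF mV sigma]
  note fD = module_homD[OF f]
  have h_inv_add: "h_inv (x \<oplus>\<^bsub>Z'\<^esub> y) = h_inv x \<oplus>\<^bsub>Z\<^esub> h_inv y" if "x \<in> carrier Z'" "y \<in> carrier Z'" for x y
    using that h_inv(3)[of "h_inv x \<oplus>\<^bsub>Z\<^esub> h_inv y"] by (simp add: h_add h_inv)
  have h_inv_smult: "h_inv (\<sigma> l \<odot>\<^bsub>Z'\<^esub> x) = l \<odot>\<^bsub>Z\<^esub> h_inv x" if "l \<in> carrier L" "x \<in> carrier Z'" for l x
    using that h_inv(3)[of "l \<odot>\<^bsub>Z\<^esub> h_inv x"] by (simp add: h_smult h_inv)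
  have kf: "(\<lambda>x. h_inv (f x)) \<in> module_hom L (pullback L \<sigma> U) Z"
    by (rule module_homI) (simp_all add: cU fD h_inv h_inv_add h_inv_smult sigma_closed)
  have i': "i \<in> module_hom L (pullback L \<sigma> U) (pullback L \<sigma> V)"
    by (rule module_hom_pullback[OF mU mV Z.R.ring_axioms ring_hom_rng_hom[OF sigma] i(1)])
  obtain g where g: "g \<in> module_hom L (pullback L \<sigma> V) Z" "\<And>x. x \<in> carrier U \<Longrightarrow> g (i x) = h_inv (f x)"
    using injective_extension[OF inj fg_pullback[OF U] fg_pullback[OF V] i' _ kf] i(2) unfolding cU by blast
  note gD = module_homD[OF g(1), unfolded cV]
  show "\<exists>g\<in>module_hom L' V Z'. \<forall>u\<in>carrier U. g (i u) = f u"
  proof (intro bexI ballI)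
    show "(\<lambda>v. h (g v)) \<in> module_hom L' V Z'"
    proof (rule module_homI)
      fix l v assume "l \<in> carrier L'" "v \<in> carrier V"
      then obtain l0 where "l0 \<in> carrier L" "l = \<sigma> l0" by (metis sigma_obtain)
      then show "h (g (l \<odot>\<^bsub>V\<^esub> v)) = l \<odot>\<^bsub>Z'\<^esub> h (g v)"
        using gD(3)[of l0 v] gD(1) \<open>v \<in> carrier V\<close> by (simp add: h_smult)
    qed (use gD(1,2) in \<open>simp_all add: h_closed h_add\<close>)
    show "h (g (i u)) = f u" if "u \<in> carrier U" for u
      using that by (simp add: g(2) h_inv fD)
  qed
qed

lemma indecomposable_transfer:
  assumes ind: "indecomposable L Z" shows "indecomposable L' Z'"
proof -
  let ?p = "\<lambda>W. {x \<in> carrier Z. h x \<in> W}"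
  have zero_iff: "x = \<zero>\<^bsub>Z\<^esub>" if "x \<in> carrier Z" "h x = \<zero>\<^bsub>Z'\<^esub>" for x
    using that h_inv(3)[of x] h_inv(3)[of "\<zero>\<^bsub>Z\<^esub>"] h_zero by simp
  have "carrier Z' \<noteq> {\<zero>\<^bsub>Z'\<^esub>}"
  proof
    assume "carrier Z' = {\<zero>\<^bsub>Z'\<^esub>}"
    then have "x = \<zero>\<^bsub>Z\<^esub>" if "x \<in> carrier Z" for x using that h_closed[OF that] zero_iff by blast
    then show False using ind by (auto simp: indecomposable_def)
  qed
  moreover have "U = {\<zero>\<^bsub>Z'\<^esub>} \<or> V = {\<zero>\<^bsub>Z'\<^esub>}"
    if U: "submodule U L' Z'" and V: "submodule V L' Z'" and sum: "U <+>\<^bsub>Z'\<^esub> V = carrier Z'"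
      and UV: "U \<inter> V = {\<zero>\<^bsub>Z'\<^esub>}" for U V
  proof -
    note UD = Z'.submoduleD[OF U] and VD = Z'.submoduleD[OF V]
    have "?p U \<inter> ?p V = {\<zero>\<^bsub>Z\<^esub>}"
    proof
      show "?p U \<inter> ?p V \<subseteq> {\<zero>\<^bsub>Z\<^esub>}" using UV zero_iff by blast
      show "{\<zero>\<^bsub>Z\<^esub>} \<subseteq> ?p U \<inter> ?p V" using UD(2) VD(2) h_zero by simp
    qed
    moreover have "?p U <+>\<^bsub>Z\<^esub> ?p V = carrier Z"
    proof
      show "?p U <+>\<^bsub>Z\<^esub> ?p V \<subseteq> carrier Z" by (auto simp: set_add_def')
      show "carrier Z \<subseteq> ?p U <+>\<^bsub>Z\<^esub> ?p V"
      proof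
        fix x assume x: "x \<in> carrier Z"
        then obtain u v where uv: "u \<in> U" "v \<in> V" "h x = u \<oplus>\<^bsub>Z'\<^esub> v"
          using h_closed[OF x] unfolding sum[symmetric] set_add_def' by blast
        have ku: "h_inv u \<in> carrier Z" and kv: "h_inv v \<in> carrier Z" using h_inv(1) UD(3) VD(3) uv(1,2) by auto
        have "h x = h (h_inv u \<oplus>\<^bsub>Z\<^esub> h_inv v)"
          unfolding h_add[OF ku kv] h_inv(2)[OF UD(3)[OF uv(1)]] h_inv(2)[OF VD(3)[OF uv(2)]] by (rule uv(3))
        then have "x = h_inv u \<oplus>\<^bsub>Z\<^esub> h_inv v"
          using h_inv(3)[OF x] h_inv(3)[OF Z.M.a_closed[OF ku kv]] by metis
        moreover have "h_inv u \<in> ?p U" "h_inv v \<in> ?p V" using uv UD(3) VD(3) h_inv by simp_all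
        ultimately show "x \<in> ?p U <+>\<^bsub>Z\<^esub> ?p V" unfolding set_add_def' by blast
      qed
    qed
    ultimately have "?p U = {\<zero>\<^bsub>Z\<^esub>} \<or> ?p V = {\<zero>\<^bsub>Z\<^esub>}"
      using ind submodule_preimage[OF U] submodule_preimage[OF V] unfolding indecomposable_def by blast
    then have "h ` ?p U = {\<zero>\<^bsub>Z'\<^esub>} \<or> h ` ?p V = {\<zero>\<^bsub>Z'\<^esub>}"
    proof (elim disjE)
      assume *: "?p U = {\<zero>\<^bsub>Z\<^esub>}" show ?thesis unfolding * by (simp add: h_zero)
    next
      assume *: "?p V = {\<zero>\<^bsub>Z\<^esub>}" show ?thesis unfolding * by (simp add: h_zero)
    qed
    then show ?thesis unfolding preimage_image[OF UD(1)] preimage_image[OF VD(1)] .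
  qed
  ultimately show ?thesis by (simp add: indecomposable_def)
qed

lemma indecomposable_injective_transfer:
  "indecomposable_injective L Z \<Longrightarrow> indecomposable_injective L' Z'"
  using fg_transfer injective_transfer indecomposable_transfer by (simp add: indecomposable_injective_def)

end

section \<open>Tensor products as modules\<close>

lemma tensor_elem_closed:
  assumes "p \<in> carrier P" "x \<in> carrier X"
  shows "tensor_elem S P X p x \<in> carrier (tensor S P X)"
  using assms frag_of_in_free_Abelian_group[of "(p, x)" "carrier P \<times> carrier X"]
  unfolding tensor_def Let_def tensor_elem_def FactGroup_def RCOSETS_def
  by (simp del: carrier_free_Abelian_group_iff frag_of_in_free_Abelian_group) blast

locale tensor_product =
  fixes R :: "('r, 'c) ring_scheme" and S :: "('s, 'd) ring_scheme"
    and P :: "('r, 's, 'p) bimodule" and X :: "('s, 'x, 'e) module_scheme"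
  assumes P: "bimodule R S P" and X: "left_module S X"
begin

sublocale P: bimodule R S P by (rule P)
sublocale PM: left_module R P by (rule P.left_module)
sublocale X: left_module S X by (rule X)

abbreviation F where "F \<equiv> tensor_free P X"
abbreviation Q where "Q \<equiv> tensor_subgroup S P X"
abbreviation T where "T \<equiv> tensor S P X"
abbreviation coset where "coset c \<equiv> Q #>\<^bsub>F\<^esub> c"
abbreviation elem where "elem \<equiv> tensor_elem S P X"

sublocale F: comm_group F by (rule abelian_free_Abelian_group)

lemma subgroup_Q: "subgroup Q F" by (rule tensor_subgroup_subgroup[OF P X])
lemma normal_Q: "normal Q F" by (rule F.subgroup_imp_normal[OF subgroup_Q])

lemma carrier_T: "t \<in> carrier T \<longleftrightarrow> (\<exists>c\<in>carrier F. t = coset c)"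
  unfolding tensor_def Let_def FactGroup_def RCOSETS_def
  by (simp del: carrier_free_Abelian_group_iff)

lemma coset_add: "c \<in> carrier F \<Longrightarrow> d \<in> carrier F \<Longrightarrow> coset c \<oplus>\<^bsub>T\<^esub> coset d = coset (c + d)"
  using normal.rcos_sum[OF normal_Q, of c d]
  by (simp add: tensor_def Let_def FactGroup_def del: carrier_free_Abelian_group_iff)

lemma T_zero: "\<zero>\<^bsub>T\<^esub> = coset 0"
  using F.coset_mult_one[OF subgroup.subset[OF subgroup_Q]] by (simp add: tensor_def Let_def FactGroup_def)

lemma coset_eqI:
  assumes "c - d \<in> Q" "d \<in> carrier F" shows "coset c = coset d"
proof -
  have "(c - d) \<otimes>\<^bsub>F\<^esub> d \<in> coset d"
    by (rule F.rcosI[OF assms(1) subgroup.subset[OF subgroup_Q] assms(2)])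
  then have "c \<in> coset d" by simp
  then show ?thesis using F.repr_independence[OF _ assms(2) subgroup_Q] by metis
qed

lemma abelian_T: "abelian_group T"
proof (rule abelian_groupI)
  fix t u assume "t \<in> carrier T" "u \<in> carrier T"
  then obtain c d where c: "c \<in> carrier F" "t = coset c" and d: "d \<in> carrier F" "u = coset d"
    unfolding carrier_T by blast
  have cd: "c + d \<in> carrier F" using F.m_closed[OF c(1) d(1)] by simp
  have tu: "t \<oplus>\<^bsub>T\<^esub> u = coset (c + d)" unfolding c(2) d(2) by (rule coset_add[OF c(1) d(1)])
  show "t \<oplus>\<^bsub>T\<^esub> u \<in> carrier T" unfolding tu carrier_T using cd by blast
  show "t \<oplus>\<^bsub>T\<^esub> u = u \<oplus>\<^bsub>T\<^esub> t"
    unfolding tu unfolding c(2) d(2) coset_add[OF d(1) c(1)] by (simp only: add.commute)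
  fix v assume "v \<in> carrier T"
  then obtain f where f: "f \<in> carrier F" "v = coset f" unfolding carrier_T by blast
  have df: "d + f \<in> carrier F" using F.m_closed[OF d(1) f(1)] by simp
  show "t \<oplus>\<^bsub>T\<^esub> u \<oplus>\<^bsub>T\<^esub> v = t \<oplus>\<^bsub>T\<^esub> (u \<oplus>\<^bsub>T\<^esub> v)"
    unfolding tu
    unfolding c(2) d(2) f(2) coset_add[OF d(1) f(1)] coset_add[OF cd f(1)] coset_add[OF c(1) df]
    by (simp only: add.assoc)
next
  show "\<zero>\<^bsub>T\<^esub> \<in> carrier T" unfolding carrier_T T_zero by (rule bexI[of _ 0]) auto
  fix t assume "t \<in> carrier T"
  then obtain c where c: "c \<in> carrier F" "t = coset c" unfolding carrier_T by blast
  have m: "- c \<in> carrier F" "0 \<in> carrier F" using c(1) by auto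
  show "\<zero>\<^bsub>T\<^esub> \<oplus>\<^bsub>T\<^esub> t = t" unfolding T_zero c(2) coset_add[OF m(2) c(1)] by simp
  have "coset (- c) \<oplus>\<^bsub>T\<^esub> t = \<zero>\<^bsub>T\<^esub>" unfolding T_zero c(2) coset_add[OF m(1) c(1)] by simp
  moreover have "coset (- c) \<in> carrier T" unfolding carrier_T using m(1) by blast
  ultimately show "\<exists>u\<in>carrier T. u \<oplus>\<^bsub>T\<^esub> t = \<zero>\<^bsub>T\<^esub>" by (rule bexI)
qed

sublocale T: abelian_group T by (rule abelian_T)

lemma elem_closed [simp]: "p \<in> carrier P \<Longrightarrow> x \<in> carrier X \<Longrightarrow> elem p x \<in> carrier T"
  by (rule tensor_elem_closed)

text \<open>Every identity between maps out of a tensor product, including the module axioms of the tensor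
  product itself, is reduced by this to elementary tensors.\<close>

lemma additive_eqI:
  assumes W: "abelian_group W"
    and f: "\<And>t. t \<in> carrier T \<Longrightarrow> f t \<in> carrier W"
      "\<And>t u. t \<in> carrier T \<Longrightarrow> u \<in> carrier T \<Longrightarrow> f (t \<oplus>\<^bsub>T\<^esub> u) = f t \<oplus>\<^bsub>W\<^esub> f u"
    and g: "\<And>t. t \<in> carrier T \<Longrightarrow> g t \<in> carrier W"
      "\<And>t u. t \<in> carrier T \<Longrightarrow> u \<in> carrier T \<Longrightarrow> g (t \<oplus>\<^bsub>T\<^esub> u) = g t \<oplus>\<^bsub>W\<^esub> g u"
    and eq: "\<And>p x. p \<in> carrier P \<Longrightarrow> x \<in> carrier X \<Longrightarrow> f (elem p x) = g (elem p x)"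
    and t: "t \<in> carrier T"
  shows "f t = g t"
proof -
  interpret W: abelian_group W by fact
  have zero: "a \<zero>\<^bsub>T\<^esub> = \<zero>\<^bsub>W\<^esub>" if "\<And>t. t \<in> carrier T \<Longrightarrow> a t \<in> carrier W"
      "\<And>t u. t \<in> carrier T \<Longrightarrow> u \<in> carrier T \<Longrightarrow> a (t \<oplus>\<^bsub>T\<^esub> u) = a t \<oplus>\<^bsub>W\<^esub> a u" for a
    using that(2)[of "\<zero>\<^bsub>T\<^esub>" "\<zero>\<^bsub>T\<^esub>"] that(1)[of "\<zero>\<^bsub>T\<^esub>"] by simp
  obtain c where c: "c \<in> carrier F" "t = coset c" using t unfolding carrier_T by blast
  from c(1) have "Poly_Mapping.keys c \<subseteq> carrier P \<times> carrier X" by simp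
  then have "f (coset c) = g (coset c)"
  proof (rule free_Abelian_group_induct[where P = "\<lambda>c. f (coset c) = g (coset c)"])
    show "f (coset 0) = g (coset 0)" using zero[of f, OF f] zero[of g, OF g] by (simp add: T_zero)
  next
    fix c d assume 2: "Poly_Mapping.keys c \<subseteq> carrier P \<times> carrier X" "Poly_Mapping.keys d \<subseteq> carrier P \<times> carrier X"
      "f (coset c) = g (coset c)" "f (coset d) = g (coset d)"
    have cF: "c \<in> carrier F" "d \<in> carrier F" "c - d \<in> carrier F" using 2(1,2) keys_diff[of c d] by auto
    have T: "coset c \<in> carrier T" "coset d \<in> carrier T" "coset (c - d) \<in> carrier T"
      using cF unfolding carrier_T by blast+
    have s: "coset (c - d) \<oplus>\<^bsub>T\<^esub> coset d = coset c" using coset_add[OF cF(3,2)] by simp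
    have "f (coset (c - d)) \<oplus>\<^bsub>W\<^esub> f (coset d) = g (coset (c - d)) \<oplus>\<^bsub>W\<^esub> f (coset d)"
      using f(2)[OF T(3,2)] g(2)[OF T(3,2)] 2(3,4) s by simp
    then show "f (coset (c - d)) = g (coset (c - d))" using f(1) g(1) T by simp
  next
    fix a assume "a \<in> carrier P \<times> carrier X"
    then show "f (coset (frag_of a)) = g (coset (frag_of a))" using eq by (auto simp: tensor_elem_def)
  qed
  then show ?thesis using c(2) by simp
qed

lemma relation_in_Q: "c \<in> tensor_relations S P X \<Longrightarrow> c \<in> Q"
  unfolding tensor_subgroup_def by (rule generate.incl)

lemma frag_closed: "p \<in> carrier P \<Longrightarrow> x \<in> carrier X \<Longrightarrow> frag_of (p, x) \<in> carrier F"
  by simp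

lemma elem_add_l:
  assumes "p \<in> carrier P" "q \<in> carrier P" "x \<in> carrier X"
  shows "elem (p \<oplus>\<^bsub>P\<^esub> q) x = elem p x \<oplus>\<^bsub>T\<^esub> elem q x"
proof -
  have "frag_of (p \<oplus>\<^bsub>P\<^esub> q, x) - (frag_of (p, x) + frag_of (q, x)) \<in> Q"
    by (rule relation_in_Q) (use assms in \<open>unfold tensor_relations_def diff_diff_eq[symmetric], blast\<close>)
  then have "coset (frag_of (p \<oplus>\<^bsub>P\<^esub> q, x)) = coset (frag_of (p, x) + frag_of (q, x))"
    by (rule coset_eqI) (use F.m_closed[OF frag_closed[OF assms(1,3)] frag_closed[OF assms(2,3)]] in simp)
  then show ?thesis
    unfolding tensor_elem_def coset_add[OF frag_closed[OF assms(1,3)] frag_closed[OF assms(2,3)]] .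
qed

lemma elem_add_r:
  assumes "p \<in> carrier P" "x \<in> carrier X" "y \<in> carrier X"
  shows "elem p (x \<oplus>\<^bsub>X\<^esub> y) = elem p x \<oplus>\<^bsub>T\<^esub> elem p y"
proof -
  have "frag_of (p, x \<oplus>\<^bsub>X\<^esub> y) - (frag_of (p, x) + frag_of (p, y)) \<in> Q"
    by (rule relation_in_Q) (use assms in \<open>unfold tensor_relations_def diff_diff_eq[symmetric], blast\<close>)
  then have "coset (frag_of (p, x \<oplus>\<^bsub>X\<^esub> y)) = coset (frag_of (p, x) + frag_of (p, y))"
    by (rule coset_eqI) (use F.m_closed[OF frag_closed[OF assms(1,2)] frag_closed[OF assms(1,3)]] in simp)
  then show ?thesis
    unfolding tensor_elem_def coset_add[OF frag_closed[OF assms(1,2)] frag_closed[OF assms(1,3)]] .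
qed

lemma elem_rsmult:
  assumes "p \<in> carrier P" "s \<in> carrier S" "x \<in> carrier X"
  shows "elem (p \<boxdot>\<^bsub>P\<^esub> s) x = elem p (s \<odot>\<^bsub>X\<^esub> x)"
  unfolding tensor_elem_def
proof (rule coset_eqI)
  show "frag_of (p \<boxdot>\<^bsub>P\<^esub> s, x) - frag_of (p, s \<odot>\<^bsub>X\<^esub> x) \<in> Q"
    by (rule relation_in_Q) (use assms in \<open>unfold tensor_relations_def, blast\<close>)
qed (use assms in simp)

abbreviation scale where "scale r \<equiv> frag_extend (frag_of \<circ> (\<lambda>(p, x). (r \<odot>\<^bsub>P\<^esub> p, x)))"

lemma scale_closed: "r \<in> carrier R \<Longrightarrow> c \<in> carrier F \<Longrightarrow> scale r c \<in> carrier F"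
  using keys_frag_extend[of "frag_of \<circ> (\<lambda>(p, x). (r \<odot>\<^bsub>P\<^esub> p, x))" c] by fastforce

lemma scale_relation:
  assumes r: "r \<in> carrier R" and d: "d \<in> tensor_relations S P X"
  shows "scale r d \<in> tensor_relations S P X"
proof -
  from d consider
    (l) p q x where "d = frag_of (p \<oplus>\<^bsub>P\<^esub> q, x) - frag_of (p, x) - frag_of (q, x)"
      "p \<in> carrier P" "q \<in> carrier P" "x \<in> carrier X"
  | (r) p x y where "d = frag_of (p, x \<oplus>\<^bsub>X\<^esub> y) - frag_of (p, x) - frag_of (p, y)"
      "p \<in> carrier P" "x \<in> carrier X" "y \<in> carrier X"
  | (s) p s x where "d = frag_of (p \<boxdot>\<^bsub>P\<^esub> s, x) - frag_of (p, s \<odot>\<^bsub>X\<^esub> x)"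
      "p \<in> carrier P" "s \<in> carrier S" "x \<in> carrier X"
    unfolding tensor_relations_def by blast
  then show ?thesis
  proof cases
    case l
    then have "scale r d = frag_of (r \<odot>\<^bsub>P\<^esub> p \<oplus>\<^bsub>P\<^esub> r \<odot>\<^bsub>P\<^esub> q, x) - frag_of (r \<odot>\<^bsub>P\<^esub> p, x) - frag_of (r \<odot>\<^bsub>P\<^esub> q, x)"
      "r \<odot>\<^bsub>P\<^esub> p \<in> carrier P" "r \<odot>\<^bsub>P\<^esub> q \<in> carrier P"
      using assms(1) by (simp_all add: frag_extend_diff PM.smult_r_distr)
    with l(4) show ?thesis unfolding tensor_relations_def by blast
  next
    case r
    then have "scale r d = frag_of (r \<odot>\<^bsub>P\<^esub> p, x \<oplus>\<^bsub>X\<^esub> y) - frag_of (r \<odot>\<^bsub>P\<^esub> p, x) - frag_of (r \<odot>\<^bsub>P\<^esub> p, y)"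
      "r \<odot>\<^bsub>P\<^esub> p \<in> carrier P"
      using assms(1) by (simp_all add: frag_extend_diff)
    with r(3,4) show ?thesis unfolding tensor_relations_def by blast
  next
    case s
    then have "scale r d = frag_of ((r \<odot>\<^bsub>P\<^esub> p) \<boxdot>\<^bsub>P\<^esub> s, x) - frag_of (r \<odot>\<^bsub>P\<^esub> p, s \<odot>\<^bsub>X\<^esub> x)"
      "r \<odot>\<^bsub>P\<^esub> p \<in> carrier P"
      using assms(1) by (simp_all add: frag_extend_diff P.smult_rsmult)
    with s(3,4) show ?thesis unfolding tensor_relations_def by blast
  qed
qed

lemma scale_Q:
  assumes r: "r \<in> carrier R" and c: "c \<in> Q" shows "scale r c \<in> Q"
proof -
  let ?H = "{c \<in> carrier F. scale r c \<in> Q}"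
  note Qd = subgroup.m_closed[OF subgroup_Q] subgroup.m_inv_closed[OF subgroup_Q] subgroup.one_closed[OF subgroup_Q]
  have "tensor_relations S P X \<subseteq> ?H"
    using tensor_relations_carrier[OF P X] relation_in_Q scale_relation[OF r] by blast
  moreover have "subgroup ?H F"
  proof (rule F.subgroupI)
    show "?H \<noteq> {}" using Qd(3) by (auto intro!: exI[of _ 0])
    fix c assume c: "c \<in> ?H"
    then have "inv\<^bsub>F\<^esub> (scale r c) \<in> Q" using Qd(2) by blast
    then show "inv\<^bsub>F\<^esub> c \<in> ?H"
      using c scale_closed[OF r, of c] F.inv_closed[of c] by (simp add: frag_extend_minus)
    fix d assume d: "d \<in> ?H"
    then have "scale r c \<otimes>\<^bsub>F\<^esub> scale r d \<in> Q" using c Qd(1) by blast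
    then show "c \<otimes>\<^bsub>F\<^esub> d \<in> ?H"
      using c d F.m_closed[of c d] by (simp add: frag_extend_add)
  qed auto
  ultimately have "Q \<subseteq> ?H"
    unfolding tensor_subgroup_def by (rule F.generate_subgroup_incl)
  then show ?thesis using c by blast
qed

text \<open>Scalar multiplication is defined on whole cosets; \<open>scale_Q\<close> makes it computable on representatives.\<close>

lemma smult_coset:
  assumes r: "r \<in> carrier R" and c: "c \<in> carrier F"
  shows "r \<odot>\<^bsub>T\<^esub> coset c = coset (scale r c)"
proof -
  have "Q <#>\<^bsub>F\<^esub> (scale r ` coset c) = coset (scale r c)"
  proof
    show "Q <#>\<^bsub>F\<^esub> (scale r ` coset c) \<subseteq> coset (scale r c)"
    proof
      fix y assume "y \<in> Q <#>\<^bsub>F\<^esub> (scale r ` coset c)"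
      then obtain k k' where k: "k \<in> Q" "k' \<in> Q" "y = k + scale r (k' + c)"
        by (auto simp: set_mult_def r_coset_def)
      have "k + scale r k' \<in> Q"
        using subgroup.m_closed[OF subgroup_Q k(1) scale_Q[OF r k(2)]] by simp
      moreover have "y = (k + scale r k') + scale r c"
        unfolding k(3) frag_extend_add by (simp only: add.assoc)
      ultimately show "y \<in> coset (scale r c)" unfolding r_coset_def by auto
    qed
    show "coset (scale r c) \<subseteq> Q <#>\<^bsub>F\<^esub> (scale r ` coset c)"
    proof
      fix y assume "y \<in> coset (scale r c)"
      then obtain k where k: "k \<in> Q" "y = k \<otimes>\<^bsub>F\<^esub> scale r c" by (auto simp: r_coset_def)
      have "c \<in> coset c" by (rule F.rcos_self[OF c subgroup_Q])
      then show "y \<in> Q <#>\<^bsub>F\<^esub> (scale r ` coset c)" using k unfolding set_mult_def by blast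
    qed
  qed
  then show ?thesis by (simp add: tensor_def Let_def tensor_map_def)
qed

lemma smult_elem:
  "r \<in> carrier R \<Longrightarrow> p \<in> carrier P \<Longrightarrow> x \<in> carrier X \<Longrightarrow> r \<odot>\<^bsub>T\<^esub> elem p x = elem (r \<odot>\<^bsub>P\<^esub> p) x"
  unfolding tensor_elem_def using smult_coset[OF _ frag_closed, of r p x] by simp

lemma smult_closed: "r \<in> carrier R \<Longrightarrow> t \<in> carrier T \<Longrightarrow> r \<odot>\<^bsub>T\<^esub> t \<in> carrier T"
  unfolding carrier_T using scale_closed smult_coset by blast

lemma smult_add:
  assumes "r \<in> carrier R" "t \<in> carrier T" "u \<in> carrier T"
  shows "r \<odot>\<^bsub>T\<^esub> (t \<oplus>\<^bsub>T\<^esub> u) = r \<odot>\<^bsub>T\<^esub> t \<oplus>\<^bsub>T\<^esub> r \<odot>\<^bsub>T\<^esub> u"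
proof -
  obtain c d where c: "c \<in> carrier F" "t = coset c" and d: "d \<in> carrier F" "u = coset d"
    using assms unfolding carrier_T by blast
  have cd: "c + d \<in> carrier F" using F.m_closed[OF c(1) d(1)] by simp
  show ?thesis
    unfolding c(2) d(2) coset_add[OF c(1) d(1)] smult_coset[OF assms(1) c(1)]
      smult_coset[OF assms(1) d(1)] smult_coset[OF assms(1) cd]
      coset_add[OF scale_closed[OF assms(1) c(1)] scale_closed[OF assms(1) d(1)]] frag_extend_add ..
qed

lemma left_module_T: "left_module R T"
proof (intro left_module.intro PM.R.ring_axioms abelian_T left_module_axioms.intro smult_closed smult_add)
  fix a b t assume a: "a \<in> carrier R" and b: "b \<in> carrier R" and t: "t \<in> carrier T"
  note lin = a b smult_closed smult_add T.a_ac
  show "(a \<oplus>\<^bsub>R\<^esub> b) \<odot>\<^bsub>T\<^esub> t = a \<odot>\<^bsub>T\<^esub> t \<oplus>\<^bsub>T\<^esub> b \<odot>\<^bsub>T\<^esub> t"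
    by (rule additive_eqI[OF abelian_T _ _ _ _ _ t, of "\<lambda>t. (a \<oplus>\<^bsub>R\<^esub> b) \<odot>\<^bsub>T\<^esub> t" "\<lambda>t. a \<odot>\<^bsub>T\<^esub> t \<oplus>\<^bsub>T\<^esub> b \<odot>\<^bsub>T\<^esub> t"])
      (simp_all add: lin smult_elem PM.smult_l_distr elem_add_l)
  show "(a \<otimes>\<^bsub>R\<^esub> b) \<odot>\<^bsub>T\<^esub> t = a \<odot>\<^bsub>T\<^esub> (b \<odot>\<^bsub>T\<^esub> t)"
    by (rule additive_eqI[OF abelian_T _ _ _ _ _ t, of "\<lambda>t. (a \<otimes>\<^bsub>R\<^esub> b) \<odot>\<^bsub>T\<^esub> t" "\<lambda>t. a \<odot>\<^bsub>T\<^esub> (b \<odot>\<^bsub>T\<^esub> t)"])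
      (simp_all add: lin smult_elem PM.smult_assoc1)
next
  fix t assume t: "t \<in> carrier T"
  show "\<one>\<^bsub>R\<^esub> \<odot>\<^bsub>T\<^esub> t = t"
    by (rule additive_eqI[OF abelian_T _ _ _ _ _ t, of "\<lambda>t. \<one>\<^bsub>R\<^esub> \<odot>\<^bsub>T\<^esub> t" "\<lambda>t. t"])
      (simp_all add: smult_closed smult_add smult_elem)
qed

lemma lift_elem:
  assumes "abelian_group W" "balanced S P X W \<beta>" "p \<in> carrier P" "x \<in> carrier X"
  shows "tensor_lift W \<beta> (elem p x) = \<beta> (p, x)"
  by (rule tensor_lift_elem[OF P X assms])

lemma lift_module_hom:
  assumes W: "left_module R W" and \<beta>: "balanced S P X W \<beta>"
    and lin: "\<And>r p x. \<lbrakk>r \<in> carrier R; p \<in> carrier P; x \<in> carrier X\<rbrakk> \<Longrightarrow> \<beta> (r \<odot>\<^bsub>P\<^esub> p, x) = r \<odot>\<^bsub>W\<^esub> \<beta> (p, x)"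
  shows "tensor_lift W \<beta> \<in> module_hom R T W"
proof -
  interpret W: left_module R W by fact
  note la' = tensor_lift_add[OF P X W.M.abelian_group_axioms \<beta>]
  have la: "tensor_lift W \<beta> t \<in> carrier W" if "t \<in> carrier T" for t
    by (rule la'(1)[OF that that])
  note la = this la'(2)
  show ?thesis
  proof (rule module_homI, erule la(1), erule (1) la(2))
    fix r t assume r: "r \<in> carrier R" and t: "t \<in> carrier T"
    show "tensor_lift W \<beta> (r \<odot>\<^bsub>T\<^esub> t) = r \<odot>\<^bsub>W\<^esub> tensor_lift W \<beta> t"
    proof (rule additive_eqI[OF W.M.abelian_group_axioms _ _ _ _ _ t])
      fix p x assume "p \<in> carrier P" "x \<in> carrier X"
      then show "tensor_lift W \<beta> (r \<odot>\<^bsub>T\<^esub> elem p x) = r \<odot>\<^bsub>W\<^esub> tensor_lift W \<beta> (elem p x)"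
        using r lin by (simp add: smult_elem lift_elem[OF W.M.abelian_group_axioms \<beta>])
    qed (simp_all add: la r smult_closed smult_add W.smult_r_distr)
  qed
qed

end

section \<open>The Morita ring and its two corners\<close>

lemma (in bimodule) rsmult_zero_right:
  assumes "x \<in> carrier P" shows "x \<boxdot>\<^bsub>P\<^esub> \<zero>\<^bsub>S\<^esub> = \<zero>\<^bsub>P\<^esub>"
proof -
  interpret left_module R P by (rule left_module)
  interpret S: ring S by (rule right_ring)
  show ?thesis
    using rsmult_r_distr[OF assms S.zero_closed S.zero_closed] rsmult_closed[OF assms S.zero_closed] by simp
qed

lemma (in bimodule) rsmult_zero_left:
  assumes "s \<in> carrier S" shows "\<zero>\<^bsub>P\<^esub> \<boxdot>\<^bsub>P\<^esub> s = \<zero>\<^bsub>P\<^esub>"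
proof -
  interpret left_module R P by (rule left_module)
  show ?thesis
    using rsmult_l_distr[OF M.zero_closed M.zero_closed assms] rsmult_closed[OF M.zero_closed assms] by simp
qed

text \<open>The biadditive maps underlying \<open>\<phi>\<close> and \<open>\<psi>\<close>.\<close>

locale tensor_pairing = tensor_product R S P Q
  for R :: "'r ring" and S :: "('s, 'd) ring_scheme"
    and P :: "('r, 's, 'p) bimodule" and Q :: "('s, 'r, 'q) bimodule" +
  fixes \<theta> :: "(('p \<times> 'q) \<Rightarrow>\<^sub>0 int) set \<Rightarrow> 'r"
  assumes theta: "\<theta> \<in> bimodule_hom R R (bitensor S P Q) (regular_bimodule R)"
begin

abbreviation pair where "pair p q \<equiv> \<theta> (elem p q)"

lemma theta_hom:
  "t \<in> carrier T \<Longrightarrow> \<theta> t \<in> carrier R"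
  "t \<in> carrier T \<Longrightarrow> u \<in> carrier T \<Longrightarrow> \<theta> (t \<oplus>\<^bsub>T\<^esub> u) = \<theta> t \<oplus>\<^bsub>R\<^esub> \<theta> u"
  "r \<in> carrier R \<Longrightarrow> t \<in> carrier T \<Longrightarrow> \<theta> (r \<odot>\<^bsub>T\<^esub> t) = r \<otimes>\<^bsub>R\<^esub> \<theta> t"
  using theta
  by (auto simp: bimodule_hom_def module_hom_def bitensor_def regular_bimodule_def module.defs bimodule.defs)

lemma pair_closed [simp]: "p \<in> carrier P \<Longrightarrow> q \<in> carrier Q \<Longrightarrow> pair p q \<in> carrier R"
  by (simp add: theta_hom)

lemma pair_add_l:
  "p \<in> carrier P \<Longrightarrow> p' \<in> carrier P \<Longrightarrow> q \<in> carrier Q \<Longrightarrow> pair (p \<oplus>\<^bsub>P\<^esub> p') q = pair p q \<oplus>\<^bsub>R\<^esub> pair p' q"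
  by (simp add: elem_add_l theta_hom)

lemma pair_add_r:
  "p \<in> carrier P \<Longrightarrow> q \<in> carrier Q \<Longrightarrow> q' \<in> carrier Q \<Longrightarrow> pair p (q \<oplus>\<^bsub>Q\<^esub> q') = pair p q \<oplus>\<^bsub>R\<^esub> pair p q'"
  by (simp add: elem_add_r theta_hom)

lemma pair_smult:
  "r \<in> carrier R \<Longrightarrow> p \<in> carrier P \<Longrightarrow> q \<in> carrier Q \<Longrightarrow> pair (r \<odot>\<^bsub>P\<^esub> p) q = r \<otimes>\<^bsub>R\<^esub> pair p q"
  by (simp add: smult_elem[symmetric] theta_hom)

lemma pair_balanced:
  "s \<in> carrier S \<Longrightarrow> p \<in> carrier P \<Longrightarrow> q \<in> carrier Q \<Longrightarrow> pair (p \<boxdot>\<^bsub>P\<^esub> s) q = pair p (s \<odot>\<^bsub>Q\<^esub> q)"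
  by (simp add: elem_rsmult)

lemma pair_zero_l [simp]: "q \<in> carrier Q \<Longrightarrow> pair \<zero>\<^bsub>P\<^esub> q = \<zero>\<^bsub>R\<^esub>"
  using pair_add_l[of "\<zero>\<^bsub>P\<^esub>" "\<zero>\<^bsub>P\<^esub>" q] pair_closed[of "\<zero>\<^bsub>P\<^esub>" q] by simp

lemma pair_zero_r [simp]: "p \<in> carrier P \<Longrightarrow> pair p \<zero>\<^bsub>Q\<^esub> = \<zero>\<^bsub>R\<^esub>"
  using pair_add_r[of p "\<zero>\<^bsub>Q\<^esub>" "\<zero>\<^bsub>Q\<^esub>"] pair_closed[of p "\<zero>\<^bsub>Q\<^esub>"] by simp

end

locale morita_artin =
  fixes A :: "'a ring" and B :: "'b ring"
    and N :: "('a, 'b, 'n) bimodule" and M :: "('b, 'a, 'm) bimodule"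
    and \<phi> :: "(('m \<times> 'n) \<Rightarrow>\<^sub>0 int) set \<Rightarrow> 'b" and \<psi> :: "(('n \<times> 'm) \<Rightarrow>\<^sub>0 int) set \<Rightarrow> 'a"
    and K :: "'k ring" and \<eta> :: "'k \<Rightarrow> 'a \<times> 'n \<times> 'm \<times> 'b"
  assumes morita: "morita_context A B N M \<phi> \<psi>"
    and artin: "artin_algebra K \<eta> (morita_ring A B N M \<phi> \<psi>)"
begin

sublocale morita_context A B N M \<phi> \<psi> by (rule morita)

abbreviation \<Lambda> where "\<Lambda> \<equiv> morita_ring A B N M \<phi> \<psi>"

sublocale Nb: bimodule A B N by (rule bimodule_N)
sublocale Mb: bimodule B A M by (rule bimodule_M)
sublocale N: left_module A N by (rule Nb.left_module)
sublocale M: left_module B M by (rule Mb.left_module)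
sublocale A: ring A by (rule N.R.ring_axioms)
sublocale B: ring B by (rule M.R.ring_axioms)
sublocale \<Lambda>: ring \<Lambda> using artin by (simp add: artin_algebra_def)

sublocale psi: tensor_pairing A B N M \<psi>
  by unfold_locales (rule bimodule_N psi_hom Mb.left_module)+
sublocale phi: tensor_pairing B A M N \<phi>
  by unfold_locales (rule bimodule_M phi_hom Nb.left_module)+

lemma carrier_\<Lambda> [simp]: "(a, n, m, b) \<in> carrier \<Lambda> \<longleftrightarrow> a \<in> carrier A \<and> n \<in> carrier N \<and> m \<in> carrier M \<and> b \<in> carrier B"
  by (simp add: morita_ring_def)

lemma \<Lambda>_simps [simp]:
  "(a, n, m, b) \<otimes>\<^bsub>\<Lambda>\<^esub> (a', n', m', b') =
     (a \<otimes>\<^bsub>A\<^esub> a' \<oplus>\<^bsub>A\<^esub> psi.pair n m', a \<odot>\<^bsub>N\<^esub> n' \<oplus>\<^bsub>N\<^esub> n \<boxdot>\<^bsub>N\<^esub> b',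
      m \<boxdot>\<^bsub>M\<^esub> a' \<oplus>\<^bsub>M\<^esub> b \<odot>\<^bsub>M\<^esub> m', b \<otimes>\<^bsub>B\<^esub> b' \<oplus>\<^bsub>B\<^esub> phi.pair m n')"
  "(a, n, m, b) \<oplus>\<^bsub>\<Lambda>\<^esub> (a', n', m', b') = (a \<oplus>\<^bsub>A\<^esub> a', n \<oplus>\<^bsub>N\<^esub> n', m \<oplus>\<^bsub>M\<^esub> m', b \<oplus>\<^bsub>B\<^esub> b')"
  "\<one>\<^bsub>\<Lambda>\<^esub> = (\<one>\<^bsub>A\<^esub>, \<zero>\<^bsub>N\<^esub>, \<zero>\<^bsub>M\<^esub>, \<one>\<^bsub>B\<^esub>)" "\<zero>\<^bsub>\<Lambda>\<^esub> = (\<zero>\<^bsub>A\<^esub>, \<zero>\<^bsub>N\<^esub>, \<zero>\<^bsub>M\<^esub>, \<zero>\<^bsub>B\<^esub>)"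
  by (simp_all add: morita_ring_def)

lemmas zero_laws [simp] = Nb.rsmult_zero_right Nb.rsmult_zero_left Mb.rsmult_zero_right Mb.rsmult_zero_left
lemmas closed_laws [simp] = Nb.rsmult_closed Mb.rsmult_closed

text \<open>Linearity in the second argument is read off from associativity of \<open>\<Lambda>\<close>.\<close>

lemma psi_rsmult:
  assumes "n \<in> carrier N" "m \<in> carrier M" "a \<in> carrier A"
  shows "psi.pair n (m \<boxdot>\<^bsub>M\<^esub> a) = psi.pair n m \<otimes>\<^bsub>A\<^esub> a"
  using \<Lambda>.m_assoc[of "(\<zero>\<^bsub>A\<^esub>, n, \<zero>\<^bsub>M\<^esub>, \<zero>\<^bsub>B\<^esub>)" "(\<zero>\<^bsub>A\<^esub>, \<zero>\<^bsub>N\<^esub>, m, \<zero>\<^bsub>B\<^esub>)" "(a, \<zero>\<^bsub>N\<^esub>, \<zero>\<^bsub>M\<^esub>, \<zero>\<^bsub>B\<^esub>)"] assms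
  by simp

definition \<iota>A where "\<iota>A a = (a, \<zero>\<^bsub>N\<^esub>, \<zero>\<^bsub>M\<^esub>, \<zero>\<^bsub>B\<^esub>)"
definition \<iota>B where "\<iota>B b = (\<zero>\<^bsub>A\<^esub>, \<zero>\<^bsub>N\<^esub>, \<zero>\<^bsub>M\<^esub>, b)"

abbreviation \<Lambda>_over_K where "\<Lambda>_over_K \<equiv>
  \<lparr>carrier = carrier \<Lambda>, mult = mult \<Lambda>, one = one \<Lambda>, zero = zero \<Lambda>, add = add \<Lambda>,
    smult = (\<lambda>k x. \<eta> k \<otimes>\<^bsub>\<Lambda>\<^esub> x)\<rparr>"

lemma artinian_K: "artinian_cring K" and eta_hom: "\<eta> \<in> ring_hom K \<Lambda>"
  using artin by (simp_all add: artin_algebra_def)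

lemma carrier_restrict_\<Lambda>: "carrier (pullback K \<eta> (regular_module \<Lambda>)) = carrier \<Lambda>"
  using carrier_restrict_scalars[OF left_module_regular[OF \<Lambda>.ring_axioms] eta_hom] by simp

lemma fg_\<Lambda>_over_K: "fg_module K \<Lambda>_over_K"
proof -
  have "cring K" using artinian_K by (simp add: artinian_cring_def)
  then have K: "ring K" by (rule cring.axioms(1))
  have "left_module K \<Lambda>_over_K"
    by (rule left_module_cong[OF left_module_pullback[OF K left_module_regular[OF \<Lambda>.ring_axioms]
        ring_hom_rng_hom[OF eta_hom]]])
      (simp_all add: carrier_restrict_\<Lambda>, simp_all add: pullback_def regular_module_def)
  then show ?thesis using artin by (simp add: fg_module_def artin_algebra_def)
qed

lemma finite_algebra_\<Lambda>: "finite_algebra K \<eta> \<Lambda>"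
proof (rule finite_algebra.intro[OF artinian_K \<Lambda>.ring_axioms eta_hom])
  show "fg_module K (pullback K \<eta> (regular_module \<Lambda>))"
    by (rule fg_module_cong[OF fg_\<Lambda>_over_K])
      (simp_all add: carrier_restrict_\<Lambda>, simp_all add: pullback_def regular_module_def)
qed

lemma central:
  "k \<in> carrier K \<Longrightarrow> u \<in> carrier \<Lambda> \<Longrightarrow> \<eta> k \<otimes>\<^bsub>\<Lambda>\<^esub> u = u \<otimes>\<^bsub>\<Lambda>\<^esub> \<eta> k"
  using artin unfolding artin_algebra_def by blast

sublocale CA: corner_ring K \<eta> \<Lambda> A \<iota>A
proof (intro corner_ring.intro corner_ring_axioms.intro finite_algebra_\<Lambda> central N.R.ring_axioms)
  show "\<iota>A \<in> rng_hom A \<Lambda>" by (auto simp: rng_hom_def \<iota>A_def)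
  show "inj_on \<iota>A (carrier A)" by (auto simp: inj_on_def \<iota>A_def)
  fix u assume "u \<in> carrier \<Lambda>" "\<iota>A \<one>\<^bsub>A\<^esub> \<otimes>\<^bsub>\<Lambda>\<^esub> u \<otimes>\<^bsub>\<Lambda>\<^esub> \<iota>A \<one>\<^bsub>A\<^esub> = u"
  then show "u \<in> \<iota>A ` carrier A" by (cases u) (auto simp: \<iota>A_def)
qed

sublocale CB: corner_ring K \<eta> \<Lambda> B \<iota>B
proof (intro corner_ring.intro corner_ring_axioms.intro finite_algebra_\<Lambda> central M.R.ring_axioms)
  show "\<iota>B \<in> rng_hom B \<Lambda>" by (auto simp: rng_hom_def \<iota>B_def)
  show "inj_on \<iota>B (carrier B)" by (auto simp: inj_on_def \<iota>B_def)
  fix u assume "u \<in> carrier \<Lambda>" "\<iota>B \<one>\<^bsub>B\<^esub> \<otimes>\<^bsub>\<Lambda>\<^esub> u \<otimes>\<^bsub>\<Lambda>\<^esub> \<iota>B \<one>\<^bsub>B\<^esub> = u"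
  then show "u \<in> \<iota>B ` carrier B" by (cases u) (auto simp: \<iota>B_def)
qed

lemma CA_e: "CA.e = (\<one>\<^bsub>A\<^esub>, \<zero>\<^bsub>N\<^esub>, \<zero>\<^bsub>M\<^esub>, \<zero>\<^bsub>B\<^esub>)" and CB_e: "CB.e = (\<zero>\<^bsub>A\<^esub>, \<zero>\<^bsub>N\<^esub>, \<zero>\<^bsub>M\<^esub>, \<one>\<^bsub>B\<^esub>)"
  by (simp_all add: CA.e_def CB.e_def \<iota>A_def \<iota>B_def)

lemma CA_E: "u \<in> CA.E \<longleftrightarrow> (\<exists>a\<in>carrier A. \<exists>n\<in>carrier N. u = (a, n, \<zero>\<^bsub>M\<^esub>, \<zero>\<^bsub>B\<^esub>))"
  by (cases u) (auto simp: CA_e)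

lemma CB_E: "u \<in> CB.E \<longleftrightarrow> (\<exists>m\<in>carrier M. \<exists>b\<in>carrier B. u = (\<zero>\<^bsub>A\<^esub>, \<zero>\<^bsub>N\<^esub>, m, b))"
  by (cases u) (auto simp: CB_e)

text \<open>\<open>N\<close> is a homomorphic image of \<open>e\<Lambda> = A \<oplus> N\<close>.\<close>

lemma fg_N: "fg_module A N"
proof -
  have "(\<lambda>(a, n, m, b). n) \<in> module_hom A CA.row_bimodule N"
    by (rule module_homI) (auto simp: CA_e \<iota>A_def split_def)
  then interpret module_map A CA.row_bimodule N "\<lambda>(a, n, m, b). n"
    using bimodule.left_module[OF CA.row_bimodule] Nb.left_module
    by (simp add: module_map_def module_map_axioms_def)
  have "(\<lambda>(a, n, m, b). n) ` carrier CA.row_bimodule = carrier N"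
  proof
    show "carrier N \<subseteq> (\<lambda>(a, n, m, b). n) ` carrier CA.row_bimodule"
    proof
      fix n assume "n \<in> carrier N"
      then show "n \<in> (\<lambda>(a, n, m, b). n) ` carrier CA.row_bimodule"
        by (intro image_eqI[of _ _ "(\<zero>\<^bsub>A\<^esub>, n, \<zero>\<^bsub>M\<^esub>, \<zero>\<^bsub>B\<^esub>)"]) (auto simp: CA_e)
    qed
  qed auto
  from fg_image[OF CA.fg_row_bimodule this] show ?thesis .
qed

text \<open>A central element of \<open>\<Lambda>\<close> commutes with both idempotents, hence is a diagonal matrix, and commuting
  with the matrices supported in \<open>N\<close> it acts on \<open>N\<close> in the same way from both sides.\<close>

lemma central_N:
  assumes k: "k \<in> carrier K" and n: "n \<in> carrier N"
  shows "CA.\<alpha> k \<odot>\<^bsub>N\<^esub> n = n \<boxdot>\<^bsub>N\<^esub> CB.\<alpha> k"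
proof -
  obtain a n1 m1 b where eta: "\<eta> k = (a, n1, m1, b)" by (cases "\<eta> k") auto
  have c: "(a, n1, m1, b) \<in> carrier \<Lambda>" using CA.eta_closed[OF k] eta by simp
  have "a = CA.\<alpha> k" "b = CB.\<alpha> k" "n1 = \<zero>\<^bsub>N\<^esub>" "m1 = \<zero>\<^bsub>M\<^esub>"
    using CA.alpha(2)[OF k] CB.alpha(2)[OF k] c by (simp_all add: eta CA_e CB_e \<iota>A_def \<iota>B_def)
  then show ?thesis
    using central[OF k, of "(\<zero>\<^bsub>A\<^esub>, n, \<zero>\<^bsub>M\<^esub>, \<zero>\<^bsub>B\<^esub>)"] c n by (simp add: eta)
qed

lemma fg_Hom_N: "fg_module A I \<Longrightarrow> fg_module B (hom_module A N I)"
  by (rule fg_hom_module[OF CA.finite_algebra_corner CB.finite_algebra_corner bimodule_N fg_N _ central_N])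

section \<open>The tuple \<open>H\<^sub>A(I)\<close> as a coinduced module\<close>

context
  fixes I :: "('a, 'x) module" assumes I: "left_module A I"
begin

interpretation I: left_module A I by (rule I)
interpretation MI: tensor_product B A M I by unfold_locales
interpretation T: left_module B "tensor A M I" by (rule MI.left_module_T)
interpretation NMI: tensor_product A B N "tensor A M I" by unfold_locales
interpretation H: left_module B "hom_module A N I" by (rule left_module_hom_module[OF bimodule_N I])
interpretation NH: tensor_product A B N "hom_module A N I" by unfold_locales

text \<open>For fixed \<open>n\<close>, the inner map \<open>m \<otimes> x \<mapsto> \<psi>(n \<otimes> m) x\<close> of \<open>contraction\<close>; then \<open>\<mu>\<^sub>I t\<close> is \<open>n \<mapsto> act n t\<close>
  (\<open>hom_contraction_eq\<close>).\<close>

abbreviation act where "act n \<equiv> tensor_lift I (\<lambda>(m, x). psi.pair n m \<odot>\<^bsub>I\<^esub> x)"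

lemma act_balanced: "n \<in> carrier N \<Longrightarrow> balanced A M I I (\<lambda>(m, x). psi.pair n m \<odot>\<^bsub>I\<^esub> x)"
  by (auto simp: balanced_def psi.pair_add_r I.smult_l_distr I.smult_r_distr psi_rsmult I.smult_assoc1)

lemma act_elem:
  "n \<in> carrier N \<Longrightarrow> m \<in> carrier M \<Longrightarrow> x \<in> carrier I \<Longrightarrow> act n (MI.elem m x) = psi.pair n m \<odot>\<^bsub>I\<^esub> x"
  by (simp add: MI.lift_elem[OF I.M.abelian_group_axioms act_balanced])

lemma act_closed: "n \<in> carrier N \<Longrightarrow> t \<in> carrier MI.T \<Longrightarrow> act n t \<in> carrier I"
  using tensor_lift_add(1)[OF bimodule_M I I.M.abelian_group_axioms act_balanced] by blast

lemma act_add: "n \<in> carrier N \<Longrightarrow> t \<in> carrier MI.T \<Longrightarrow> u \<in> carrier MI.T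
    \<Longrightarrow> act n (t \<oplus>\<^bsub>MI.T\<^esub> u) = act n t \<oplus>\<^bsub>I\<^esub> act n u"
  by (rule tensor_lift_add(2)[OF bimodule_M I I.M.abelian_group_axioms act_balanced])

lemmas act = act_elem act_closed act_add

lemma act_add_N:
  assumes "n \<in> carrier N" "n' \<in> carrier N" and t: "t \<in> carrier MI.T"
  shows "act (n \<oplus>\<^bsub>N\<^esub> n') t = act n t \<oplus>\<^bsub>I\<^esub> act n' t"
  by (rule MI.additive_eqI[OF I.M.abelian_group_axioms _ _ _ _ _ t])
    (use assms(1,2) in \<open>simp_all add: act psi.pair_add_l I.smult_l_distr I.a_ac\<close>)

lemma act_smult_N:
  assumes "a \<in> carrier A" "n \<in> carrier N" and t: "t \<in> carrier MI.T"
  shows "act (a \<odot>\<^bsub>N\<^esub> n) t = a \<odot>\<^bsub>I\<^esub> act n t"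
  by (rule MI.additive_eqI[OF I.M.abelian_group_axioms _ _ _ _ _ t])
    (use assms(1,2) in \<open>simp_all add: act psi.pair_smult I.smult_assoc1 I.smult_r_distr\<close>)

lemma act_rsmult_N:
  assumes "n \<in> carrier N" "b \<in> carrier B" and t: "t \<in> carrier MI.T"
  shows "act (n \<boxdot>\<^bsub>N\<^esub> b) t = act n (b \<odot>\<^bsub>MI.T\<^esub> t)"
  by (rule MI.additive_eqI[OF I.M.abelian_group_axioms _ _ _ _ _ t])
    (use assms(1,2) in \<open>simp_all add: act psi.pair_balanced MI.smult_elem MI.smult_add\<close>)

lemma contraction_elem:
  assumes n: "n \<in> carrier N" and t: "t \<in> carrier MI.T"
  shows "contraction B N M \<psi> I (NMI.elem n t) = act n t"
proof -
  have "balanced B N MI.T I (\<lambda>(n, t). act n t)"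
    by (auto simp: balanced_def act act_add_N act_rsmult_N)
  then show ?thesis
    using NMI.lift_elem[OF I.M.abelian_group_axioms _ n t] by (simp add: contraction_def)
qed

lemma hom_contraction_eq:
  assumes t: "t \<in> carrier MI.T"
  shows "hom_contraction B A N M \<psi> I t = (\<lambda>n\<in>carrier N. act n t)"
  using contraction_elem[OF _ t] by (auto simp: hom_contraction_def compose_def adj_unit_def fun_eq_iff)

lemma hom_contraction_hom: "hom_contraction B A N M \<psi> I \<in> module_hom B MI.T (hom_module A N I)"
proof (rule module_homI)
  fix t assume t: "t \<in> carrier MI.T"
  show "hom_contraction B A N M \<psi> I t \<in> carrier (hom_module A N I)"
    unfolding hom_contraction_eq[OF t]
    using t by (auto intro!: module_homI simp: act act_add_N act_smult_N)
next
  fix t u assume "t \<in> carrier MI.T" "u \<in> carrier MI.T"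
  then show "hom_contraction B A N M \<psi> I (t \<oplus>\<^bsub>MI.T\<^esub> u)
      = hom_contraction B A N M \<psi> I t \<oplus>\<^bsub>hom_module A N I\<^esub> hom_contraction B A N M \<psi> I u"
    by (auto simp: hom_contraction_eq act fun_eq_iff)
next
  fix b t assume "b \<in> carrier B" "t \<in> carrier MI.T"
  then show "hom_contraction B A N M \<psi> I (b \<odot>\<^bsub>MI.T\<^esub> t)
      = b \<odot>\<^bsub>hom_module A N I\<^esub> hom_contraction B A N M \<psi> I t"
    by (auto simp: hom_contraction_eq act_rsmult_N MI.smult_closed fun_eq_iff)
qed

lemma counit_balanced: "balanced B N (hom_module A N I) I (\<lambda>(n, h). h n)"
  by (auto simp: balanced_def module_hom_def)

lemma counit_elem:
  "n \<in> carrier N \<Longrightarrow> h \<in> carrier (hom_module A N I) \<Longrightarrow> adj_counit I (NH.elem n h) = h n"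
  using NH.lift_elem[OF I.M.abelian_group_axioms counit_balanced, of n h] by (simp add: adj_counit_def)

lemma counit_hom: "adj_counit I \<in> module_hom A NH.T I"
  unfolding adj_counit_def
  by (rule NH.lift_module_hom[OF I counit_balanced]) (auto simp: module_hom_def)

lemma hom_contraction_elem:
  "m \<in> carrier M \<Longrightarrow> x \<in> carrier I
    \<Longrightarrow> hom_contraction B A N M \<psi> I (MI.elem m x) = (\<lambda>n\<in>carrier N. psi.pair n m \<odot>\<^bsub>I\<^esub> x)"
  by (auto simp: hom_contraction_eq act fun_eq_iff)

lemma is_morita_tuple_H_A:
  assumes fg: "fg_module A I"
  shows "is_morita_tuple A B N M \<phi> \<psi> (H_A A B N M \<phi> \<psi> I)"
proof -
  note hc = module_homD(1)[OF hom_contraction_hom]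
  have "adj_counit I (NH.elem n (hom_contraction B A N M \<psi> I (MI.elem m x))) = psi.pair n m \<odot>\<^bsub>I\<^esub> x"
    if "n \<in> carrier N" "m \<in> carrier M" "x \<in> carrier I" for n m x
    using that counit_elem[OF _ hc[OF MI.elem_closed]] by (simp add: hom_contraction_elem)
  moreover have "hom_contraction B A N M \<psi> I (MI.elem m (adj_counit I (NH.elem n h)))
      = phi.pair m n \<odot>\<^bsub>hom_module A N I\<^esub> h"
    if "m \<in> carrier M" "n \<in> carrier N" and h: "h \<in> carrier (hom_module A N I)" for m n h
  proof -
    have h': "h \<in> module_hom A N I" using h by simp
    have "h (n' \<boxdot>\<^bsub>N\<^esub> phi.pair m n) = psi.pair n' m \<odot>\<^bsub>I\<^esub> h n" if "n' \<in> carrier N" for n'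
      using psi_phi[OF that \<open>m \<in> carrier M\<close> \<open>n \<in> carrier N\<close>] module_homD(3)[OF h'] that \<open>m \<in> carrier M\<close> \<open>n \<in> carrier N\<close>
      by simp
    then show ?thesis
      using that module_homD(1)[OF h'] by (auto simp: counit_elem hom_contraction_elem fun_eq_iff)
  qed
  ultimately show ?thesis
    unfolding is_morita_tuple_def H_A_def using fg fg_Hom_N[OF fg] hom_contraction_hom counit_hom by simp
qed

abbreviation HA where "HA \<equiv> tuple_module A B N M (H_A A B N M \<phi> \<psi> I)"

lemma HA_simps:
  "carrier HA = carrier I \<times> carrier (hom_module A N I)"
  "\<zero>\<^bsub>HA\<^esub> = (\<zero>\<^bsub>I\<^esub>, \<zero>\<^bsub>hom_module A N I\<^esub>)"
  "(x, h) \<oplus>\<^bsub>HA\<^esub> (x', h') = (x \<oplus>\<^bsub>I\<^esub> x', h \<oplus>\<^bsub>hom_module A N I\<^esub> h')"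
  by (simp_all add: tuple_module_def H_A_def del: hom_module_simps)

lemma HA_smult:
  assumes "(a, n, m, b) \<in> carrier \<Lambda>" "x \<in> carrier I" "h \<in> carrier (hom_module A N I)"
  shows "(a, n, m, b) \<odot>\<^bsub>HA\<^esub> (x, h) = (a \<odot>\<^bsub>I\<^esub> x \<oplus>\<^bsub>I\<^esub> h n,
    \<lambda>n'\<in>carrier N. h (n' \<boxdot>\<^bsub>N\<^esub> b) \<oplus>\<^bsub>I\<^esub> psi.pair n' m \<odot>\<^bsub>I\<^esub> x)"
  using assms counit_elem[of n h]
  by (auto simp: tuple_module_def H_A_def hom_contraction_elem fun_eq_iff)

definition HA_of_coind :: "('a \<times> 'n \<times> 'm \<times> 'b \<Rightarrow> 'x) \<Rightarrow> 'x \<times> ('n \<Rightarrow> 'x)"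
  where "HA_of_coind h = (h CA.e, \<lambda>n\<in>carrier N. h (\<zero>\<^bsub>A\<^esub>, n, \<zero>\<^bsub>M\<^esub>, \<zero>\<^bsub>B\<^esub>))"

definition coind_of_HA :: "'x \<times> ('n \<Rightarrow> 'x) \<Rightarrow> 'a \<times> 'n \<times> 'm \<times> 'b \<Rightarrow> 'x"
  where "coind_of_HA = (\<lambda>(x, k). \<lambda>u\<in>CA.E. case u of (a, n, m, b) \<Rightarrow> a \<odot>\<^bsub>I\<^esub> x \<oplus>\<^bsub>I\<^esub> k n)"

text \<open>The matrix with first row \<open>(a, n)\<close> and second row zero is \<open>a e\<close> plus its part in \<open>N\<close>.\<close>

lemma coind_split:
  assumes h: "h \<in> carrier (CA.coind I)" and "a \<in> carrier A" "n \<in> carrier N"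
  shows "h (a, n, \<zero>\<^bsub>M\<^esub>, \<zero>\<^bsub>B\<^esub>) = a \<odot>\<^bsub>I\<^esub> h CA.e \<oplus>\<^bsub>I\<^esub> h (\<zero>\<^bsub>A\<^esub>, n, \<zero>\<^bsub>M\<^esub>, \<zero>\<^bsub>B\<^esub>)"
  using CA.coindD(2)[OF h, of "\<iota>A a" "(\<zero>\<^bsub>A\<^esub>, n, \<zero>\<^bsub>M\<^esub>, \<zero>\<^bsub>B\<^esub>)"] CA.coindD(3)[OF h, of a CA.e] assms(2,3)
  by (simp add: CA_e \<iota>A_def)

text \<open>Expanding \<open>h(u l)\<close> for \<open>u = e\<close> and for \<open>u\<close> in \<open>N\<close> by \<open>coind_split\<close> gives precisely the two components of
  the action on the tuple module.\<close>

lemma HA_of_coind_iso: "semilinear_iso \<Lambda> (CA.coind I) \<Lambda> HA id HA_of_coind"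
proof (intro semilinear_iso.intro semilinear_iso_axioms.intro CA.left_module_coind[OF I] \<Lambda>.ring_axioms)
  note coindD = CA.coindD[where I = I]
  have cl: "h CA.e \<in> carrier I" "n \<in> carrier N \<Longrightarrow> h (\<zero>\<^bsub>A\<^esub>, n, \<zero>\<^bsub>M\<^esub>, \<zero>\<^bsub>B\<^esub>) \<in> carrier I"
    if "h \<in> carrier (CA.coind I)" for h n
    using coindD(1)[OF that] by (auto simp: CA_e)
  show "id \<in> ring_hom \<Lambda> \<Lambda>" by (auto simp: ring_hom_def)
  show "id ` carrier \<Lambda> = carrier \<Lambda>" by simp
  show "bij_betw HA_of_coind (carrier (CA.coind I)) (carrier HA)"
  proof (rule bij_betwI[of _ _ _ coind_of_HA])
    show "HA_of_coind \<in> carrier (CA.coind I) \<rightarrow> carrier HA"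
    proof
      fix h assume h: "h \<in> carrier (CA.coind I)"
      have "(\<lambda>n\<in>carrier N. h (\<zero>\<^bsub>A\<^esub>, n, \<zero>\<^bsub>M\<^esub>, \<zero>\<^bsub>B\<^esub>)) \<in> module_hom A N I"
      proof (rule module_homI)
        fix n n' assume "n \<in> carrier N" "n' \<in> carrier N"
        then show "(\<lambda>n\<in>carrier N. h (\<zero>\<^bsub>A\<^esub>, n, \<zero>\<^bsub>M\<^esub>, \<zero>\<^bsub>B\<^esub>)) (n \<oplus>\<^bsub>N\<^esub> n')
          = (\<lambda>n\<in>carrier N. h (\<zero>\<^bsub>A\<^esub>, n, \<zero>\<^bsub>M\<^esub>, \<zero>\<^bsub>B\<^esub>)) n \<oplus>\<^bsub>I\<^esub> (\<lambda>n\<in>carrier N. h (\<zero>\<^bsub>A\<^esub>, n, \<zero>\<^bsub>M\<^esub>, \<zero>\<^bsub>B\<^esub>)) n'"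
          using coindD(2)[OF h, of "(\<zero>\<^bsub>A\<^esub>, n, \<zero>\<^bsub>M\<^esub>, \<zero>\<^bsub>B\<^esub>)" "(\<zero>\<^bsub>A\<^esub>, n', \<zero>\<^bsub>M\<^esub>, \<zero>\<^bsub>B\<^esub>)"] by (simp add: CA_e)
      next
        fix a n assume "a \<in> carrier A" "n \<in> carrier N"
        then show "(\<lambda>n\<in>carrier N. h (\<zero>\<^bsub>A\<^esub>, n, \<zero>\<^bsub>M\<^esub>, \<zero>\<^bsub>B\<^esub>)) (a \<odot>\<^bsub>N\<^esub> n)
          = a \<odot>\<^bsub>I\<^esub> (\<lambda>n\<in>carrier N. h (\<zero>\<^bsub>A\<^esub>, n, \<zero>\<^bsub>M\<^esub>, \<zero>\<^bsub>B\<^esub>)) n"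
          using coindD(3)[OF h, of a "(\<zero>\<^bsub>A\<^esub>, n, \<zero>\<^bsub>M\<^esub>, \<zero>\<^bsub>B\<^esub>)"] by (simp add: CA_e \<iota>A_def)
      qed (use cl[OF h] in simp)
      then show "HA_of_coind h \<in> carrier HA" using cl(1)[OF h] by (simp add: HA_of_coind_def HA_simps)
    qed
    show "coind_of_HA \<in> carrier HA \<rightarrow> carrier (CA.coind I)"
    proof
      fix y assume "y \<in> carrier HA"
      then obtain x k where y: "y = (x, k)" "x \<in> carrier I" "k \<in> module_hom A N I" by (auto simp: HA_simps)
      note kD = module_homD[OF y(3)]
      have E: "\<exists>a\<in>carrier A. \<exists>n\<in>carrier N. u = (a, n, \<zero>\<^bsub>M\<^esub>, \<zero>\<^bsub>B\<^esub>)"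
        if "u \<in> carrier \<Lambda>" "CA.e \<otimes>\<^bsub>\<Lambda>\<^esub> u = u" for u using that CA_E[of u] by blast
      show "coind_of_HA y \<in> carrier (CA.coind I)"
        unfolding coind_of_HA_def y(1) prod.case
      proof (rule CA.coindI)
        fix u assume "u \<in> carrier \<Lambda>" "CA.e \<otimes>\<^bsub>\<Lambda>\<^esub> u = u"
        from E[OF this] show "(case u of (a, n, m, b) \<Rightarrow> a \<odot>\<^bsub>I\<^esub> x \<oplus>\<^bsub>I\<^esub> k n) \<in> carrier I"
          using y(2) kD(1) by auto
      next
        fix u v assume u: "u \<in> carrier \<Lambda>" "CA.e \<otimes>\<^bsub>\<Lambda>\<^esub> u = u" and v: "v \<in> carrier \<Lambda>" "CA.e \<otimes>\<^bsub>\<Lambda>\<^esub> v = v"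
        show "(case u \<oplus>\<^bsub>\<Lambda>\<^esub> v of (a, n, m, b) \<Rightarrow> a \<odot>\<^bsub>I\<^esub> x \<oplus>\<^bsub>I\<^esub> k n) =
          (case u of (a, n, m, b) \<Rightarrow> a \<odot>\<^bsub>I\<^esub> x \<oplus>\<^bsub>I\<^esub> k n) \<oplus>\<^bsub>I\<^esub> (case v of (a, n, m, b) \<Rightarrow> a \<odot>\<^bsub>I\<^esub> x \<oplus>\<^bsub>I\<^esub> k n)"
          using E[OF u] E[OF v] y(2) kD(1,2) by (auto simp: I.smult_l_distr I.M.a_ac)
      next
        fix a u assume a: "a \<in> carrier A" and u: "u \<in> carrier \<Lambda>" "CA.e \<otimes>\<^bsub>\<Lambda>\<^esub> u = u"
        show "(case \<iota>A a \<otimes>\<^bsub>\<Lambda>\<^esub> u of (a, n, m, b) \<Rightarrow> a \<odot>\<^bsub>I\<^esub> x \<oplus>\<^bsub>I\<^esub> k n) =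
          a \<odot>\<^bsub>I\<^esub> (case u of (a, n, m, b) \<Rightarrow> a \<odot>\<^bsub>I\<^esub> x \<oplus>\<^bsub>I\<^esub> k n)"
          using a E[OF u] y(2) kD(1,3) by (auto simp: \<iota>A_def I.smult_assoc1 I.smult_r_distr)
      qed
    qed
    then have HC: "coind_of_HA y \<in> carrier (CA.coind I)" if "y \<in> carrier HA" for y using that by blast
    show "HA_of_coind (coind_of_HA y) = y" if yHA: "y \<in> carrier HA" for y
    proof -
      obtain x k where y: "y = (x, k)" "x \<in> carrier I" "k \<in> module_hom A N I" "k \<in> extensional (carrier N)"
        using yHA by (auto simp: HA_simps)
      have k0: "k \<zero>\<^bsub>N\<^esub> = \<zero>\<^bsub>I\<^esub>"
        using module_homD(3)[OF y(3), of "\<zero>\<^bsub>A\<^esub>" "\<zero>\<^bsub>N\<^esub>"] module_homD(1)[OF y(3), of "\<zero>\<^bsub>N\<^esub>"] by simp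
      have "(\<lambda>n\<in>carrier N. coind_of_HA y (\<zero>\<^bsub>A\<^esub>, n, \<zero>\<^bsub>M\<^esub>, \<zero>\<^bsub>B\<^esub>)) = k"
        by (rule extensionalityI[OF _ y(4)]) (use y module_homD(1)[OF y(3)] in \<open>auto simp: coind_of_HA_def CA_e\<close>)
      moreover have "coind_of_HA y CA.e = x"
        using y k0 by (simp add: coind_of_HA_def CA_e)
      ultimately show ?thesis using y(1) by (simp add: HA_of_coind_def)
    qed
    show "coind_of_HA (HA_of_coind h) = h" if h: "h \<in> carrier (CA.coind I)" for h
    proof (rule CA.coind_eqI[OF _ h])
      show "coind_of_HA (HA_of_coind h) \<in> carrier (CA.coind I)"
        by (rule HC) (use \<open>HA_of_coind \<in> carrier (CA.coind I) \<rightarrow> carrier HA\<close> h in blast)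
      fix u assume u: "u \<in> carrier \<Lambda>" "CA.e \<otimes>\<^bsub>\<Lambda>\<^esub> u = u"
      then have uE: "u \<in> CA.E" by simp
      then obtain a n where an: "a \<in> carrier A" "n \<in> carrier N" "u = (a, n, \<zero>\<^bsub>M\<^esub>, \<zero>\<^bsub>B\<^esub>)" unfolding CA_E by blast
      show "coind_of_HA (HA_of_coind h) u = h u"
        using uE an coind_split[OF h an(1,2)] by (simp add: coind_of_HA_def HA_of_coind_def)
    qed
  qed
  show "HA_of_coind \<zero>\<^bsub>CA.coind I\<^esub> = \<zero>\<^bsub>HA\<^esub>"
    by (auto simp: HA_of_coind_def HA_simps CA_e fun_eq_iff)
  show "HA_of_coind (h \<oplus>\<^bsub>CA.coind I\<^esub> k) = HA_of_coind h \<oplus>\<^bsub>HA\<^esub> HA_of_coind k"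
    if "h \<in> carrier (CA.coind I)" "k \<in> carrier (CA.coind I)" for h k
    by (auto simp: HA_of_coind_def HA_simps CA_e fun_eq_iff)
  show "HA_of_coind (l \<odot>\<^bsub>CA.coind I\<^esub> h) = id l \<odot>\<^bsub>HA\<^esub> HA_of_coind h"
    if l: "l \<in> carrier \<Lambda>" and h: "h \<in> carrier (CA.coind I)" for l h
  proof -
    obtain a n m b where l': "l = (a, n, m, b)" "a \<in> carrier A" "n \<in> carrier N" "m \<in> carrier M" "b \<in> carrier B"
      using l by (cases l) auto
    have Hh: "h CA.e \<in> carrier I" "(\<lambda>n\<in>carrier N. h (\<zero>\<^bsub>A\<^esub>, n, \<zero>\<^bsub>M\<^esub>, \<zero>\<^bsub>B\<^esub>)) \<in> carrier (hom_module A N I)"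
      using \<open>bij_betw HA_of_coind (carrier (CA.coind I)) (carrier HA)\<close> h
      unfolding bij_betw_def HA_of_coind_def HA_simps by blast+
    have "(l \<odot>\<^bsub>CA.coind I\<^esub> h) CA.e = a \<odot>\<^bsub>I\<^esub> h CA.e \<oplus>\<^bsub>I\<^esub> h (\<zero>\<^bsub>A\<^esub>, n, \<zero>\<^bsub>M\<^esub>, \<zero>\<^bsub>B\<^esub>)"
      using l' coind_split[OF h, of a n] by (simp add: CA_e)
    moreover have "(l \<odot>\<^bsub>CA.coind I\<^esub> h) (\<zero>\<^bsub>A\<^esub>, n', \<zero>\<^bsub>M\<^esub>, \<zero>\<^bsub>B\<^esub>)
        = h (\<zero>\<^bsub>A\<^esub>, n' \<boxdot>\<^bsub>N\<^esub> b, \<zero>\<^bsub>M\<^esub>, \<zero>\<^bsub>B\<^esub>) \<oplus>\<^bsub>I\<^esub> psi.pair n' m \<odot>\<^bsub>I\<^esub> h CA.e" if "n' \<in> carrier N" for n'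
      using l' that coind_split[OF h, of "psi.pair n' m" "n' \<boxdot>\<^bsub>N\<^esub> b"] cl(1)[OF h] cl(2)[OF h, of "n' \<boxdot>\<^bsub>N\<^esub> b"]
      by (simp add: CA_e I.M.a_comm)
    ultimately show ?thesis
      unfolding HA_of_coind_def id_apply using l' HA_smult[OF _ Hh, of a n m b]
      by (auto simp: fun_eq_iff simp del: hom_module_simps)
  qed
qed

lemma module_isomorphic_HA: "module_isomorphic \<Lambda> (CA.coind I) HA"
  using semilinear_iso.bij[OF HA_of_coind_iso] semilinear_iso.h_add[OF HA_of_coind_iso]
    semilinear_iso.h_smult[OF HA_of_coind_iso] semilinear_iso.h_closed[OF HA_of_coind_iso]
  unfolding module_isomorphic_def by (intro bexI[of _ HA_of_coind] module_homI) simp_all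

end

end

section \<open>Indecomposable injective modules over the Morita ring\<close>

context morita_artin begin

lemma H_A_indecomposable_injective:
  fixes I :: "('a, 'x) module"
  assumes I: "indecomposable_injective A I"
  shows "is_morita_tuple A B N M \<phi> \<psi> (H_A A B N M \<phi> \<psi> I)"
    "indecomposable_injective \<Lambda> (tuple_module A B N M (H_A A B N M \<phi> \<psi> I))"
proof -
  have fg: "fg_module A I" using I by (simp add: indecomposable_injective_def)
  then have mI: "left_module A I" by (simp add: fg_module_def)
  show "is_morita_tuple A B N M \<phi> \<psi> (H_A A B N M \<phi> \<psi> I)" by (rule is_morita_tuple_H_A[OF mI fg])
  show "indecomposable_injective \<Lambda> (tuple_module A B N M (H_A A B N M \<phi> \<psi> I))"
    by (rule semilinear_iso.indecomposable_injective_transfer[OF HA_of_coind_iso[OF mI]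
        CA.indecomposable_injective_coind[OF I]])
qed

lemma indecomposable_injective_is_H_A:
  fixes Z :: "('a \<times> 'n \<times> 'm \<times> 'b, 'z) module"
  assumes Z: "indecomposable_injective \<Lambda> Z"
    and faithful: "\<And>z. \<lbrakk>z \<in> carrier Z; \<And>u. u \<in> CA.E \<Longrightarrow> u \<odot>\<^bsub>Z\<^esub> z = \<zero>\<^bsub>Z\<^esub>\<rbrakk> \<Longrightarrow> z = \<zero>\<^bsub>Z\<^esub>"
  shows "\<exists>I :: ('a, 'z) module. indecomposable_injective A I \<and>
    module_isomorphic \<Lambda> Z (tuple_module A B N M (H_A A B N M \<phi> \<psi> I))"
proof (intro exI[of _ "CA.corner Z"] conjI)
  show I: "indecomposable_injective A (CA.corner Z)"
    by (rule CA.indecomposable_injective_corner(1)[OF Z faithful])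
  then have mI: "left_module A (CA.corner Z)" by (simp add: indecomposable_injective_def fg_module_def)
  obtain h where h: "h \<in> module_hom \<Lambda> Z (CA.coind (CA.corner Z))"
    "bij_betw h (carrier Z) (carrier (CA.coind (CA.corner Z)))"
    using CA.indecomposable_injective_corner(2)[OF Z faithful] unfolding module_isomorphic_def by blast
  obtain k where k: "k \<in> module_hom \<Lambda> (CA.coind (CA.corner Z)) (HA (CA.corner Z))"
    "bij_betw k (carrier (CA.coind (CA.corner Z))) (carrier (HA (CA.corner Z)))"
    using module_isomorphic_HA[OF mI] unfolding module_isomorphic_def by blast
  show "module_isomorphic \<Lambda> Z (HA (CA.corner Z))"
    unfolding module_isomorphic_def
    by (intro bexI[of _ "k \<circ> h"] bij_betw_trans[OF h(2) k(2)] module_hom_comp[OF h(1) k(1)])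
qed

text \<open>An element annihilated by both rows of \<open>\<Lambda>\<close> is annihilated by \<open>1\<close>. So the submodules of elements
  annihilated by one row meet trivially, and one of them is zero by uniformity.\<close>

lemma faithful_corner:
  assumes Z: "indecomposable_injective \<Lambda> Z"
  shows "(\<forall>z\<in>carrier Z. (\<forall>u\<in>CA.E. u \<odot>\<^bsub>Z\<^esub> z = \<zero>\<^bsub>Z\<^esub>) \<longrightarrow> z = \<zero>\<^bsub>Z\<^esub>)
    \<or> (\<forall>z\<in>carrier Z. (\<forall>u\<in>CB.E. u \<odot>\<^bsub>Z\<^esub> z = \<zero>\<^bsub>Z\<^esub>) \<longrightarrow> z = \<zero>\<^bsub>Z\<^esub>)"
proof -
  have "left_module \<Lambda> Z" using Z by (simp add: indecomposable_injective_def fg_module_def)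
  then interpret Z: left_module \<Lambda> Z .
  let ?LA = "{z \<in> carrier Z. \<forall>u\<in>CA.E. u \<odot>\<^bsub>Z\<^esub> z = \<zero>\<^bsub>Z\<^esub>}"
    and ?LB = "{z \<in> carrier Z. \<forall>u\<in>CB.E. u \<odot>\<^bsub>Z\<^esub> z = \<zero>\<^bsub>Z\<^esub>}"
  have "submodule ?LA \<Lambda> Z"
    unfolding Z.submodule_iff
  proof (intro conjI ballI)
    show "l \<odot>\<^bsub>Z\<^esub> z \<in> ?LA" if "l \<in> carrier \<Lambda>" "z \<in> ?LA" for l z
    proof -
      have "u \<odot>\<^bsub>Z\<^esub> (l \<odot>\<^bsub>Z\<^esub> z) = \<zero>\<^bsub>Z\<^esub>" if "u \<in> CA.E" for u
      proof -
        have "u \<otimes>\<^bsub>\<Lambda>\<^esub> l \<in> CA.E" using that \<open>l \<in> carrier \<Lambda>\<close> CA.E_mult by blast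
        then have "(u \<otimes>\<^bsub>\<Lambda>\<^esub> l) \<odot>\<^bsub>Z\<^esub> z = \<zero>\<^bsub>Z\<^esub>" using \<open>z \<in> ?LA\<close> by blast
        then show ?thesis using Z.smult_assoc1[of u l z] that \<open>l \<in> carrier \<Lambda>\<close> \<open>z \<in> ?LA\<close> by simp
      qed
      then show ?thesis using that by simp
    qed
  qed (auto simp: Z.smult_r_distr)
  moreover have "submodule ?LB \<Lambda> Z"
    unfolding Z.submodule_iff
  proof (intro conjI ballI)
    show "l \<odot>\<^bsub>Z\<^esub> z \<in> ?LB" if "l \<in> carrier \<Lambda>" "z \<in> ?LB" for l z
    proof -
      have "u \<odot>\<^bsub>Z\<^esub> (l \<odot>\<^bsub>Z\<^esub> z) = \<zero>\<^bsub>Z\<^esub>" if "u \<in> CB.E" for u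
      proof -
        have "u \<otimes>\<^bsub>\<Lambda>\<^esub> l \<in> CB.E" using that \<open>l \<in> carrier \<Lambda>\<close> CB.E_mult by blast
        then have "(u \<otimes>\<^bsub>\<Lambda>\<^esub> l) \<odot>\<^bsub>Z\<^esub> z = \<zero>\<^bsub>Z\<^esub>" using \<open>z \<in> ?LB\<close> by blast
        then show ?thesis using Z.smult_assoc1[of u l z] that \<open>l \<in> carrier \<Lambda>\<close> \<open>z \<in> ?LB\<close> by simp
      qed
      then show ?thesis using that by simp
    qed
  qed (auto simp: Z.smult_r_distr)
  moreover have "?LA \<inter> ?LB = {\<zero>\<^bsub>Z\<^esub>}"
  proof
    show "?LA \<inter> ?LB \<subseteq> {\<zero>\<^bsub>Z\<^esub>}"
    proof
      fix z assume z: "z \<in> ?LA \<inter> ?LB"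
      have sum: "\<one>\<^bsub>\<Lambda>\<^esub> = CA.e \<oplus>\<^bsub>\<Lambda>\<^esub> CB.e" by (simp add: CA_e CB_e)
      have "CA.e \<odot>\<^bsub>Z\<^esub> z = \<zero>\<^bsub>Z\<^esub>" "CB.e \<odot>\<^bsub>Z\<^esub> z = \<zero>\<^bsub>Z\<^esub>"
      proof -
        have "CA.e \<in> CA.E" "CB.e \<in> CB.E" by simp_all
        then show "CA.e \<odot>\<^bsub>Z\<^esub> z = \<zero>\<^bsub>Z\<^esub>" "CB.e \<odot>\<^bsub>Z\<^esub> z = \<zero>\<^bsub>Z\<^esub>" using z by blast+
      qed
      then have "\<one>\<^bsub>\<Lambda>\<^esub> \<odot>\<^bsub>Z\<^esub> z = \<zero>\<^bsub>Z\<^esub>"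
        unfolding sum using z Z.smult_l_distr[OF CA.e_closed CB.e_closed, of z] by simp
      then show "z \<in> {\<zero>\<^bsub>Z\<^esub>}" using z Z.smult_one[of z] by simp
    qed
  qed auto
  ultimately have "?LA = {\<zero>\<^bsub>Z\<^esub>} \<or> ?LB = {\<zero>\<^bsub>Z\<^esub>}"
    by (rule CA.indecomposable_injective_uniform[OF Z])
  then show ?thesis by blast
qed

end

section \<open>Exchanging the two corners\<close>

text \<open>The isomorphism of the Morita ring with the one of the context \<open>(B, A, M, N, \<psi>, \<phi>)\<close>. It carries
  \<open>H\<^sub>B\<close> for the first context to \<open>H\<^sub>A\<close> for the second.\<close>

definition morita_swap :: "'a \<times> 'n \<times> 'm \<times> 'b \<Rightarrow> 'b \<times> 'm \<times> 'n \<times> 'a"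
  where "morita_swap = (\<lambda>(a, n, m, b). (b, m, n, a))"

lemma morita_swap_simps [simp]:
  "morita_swap (a, n, m, b) = (b, m, n, a)" "morita_swap (morita_swap u) = u"
  by (simp_all add: morita_swap_def split_def)

lemma morita_context_swap:
  assumes "morita_context A B N M \<phi> \<psi>" shows "morita_context B A M N \<psi> \<phi>"
proof -
  interpret morita_context A B N M \<phi> \<psi> by fact
  show ?thesis
    by (intro morita_context.intro bimodule_N bimodule_M phi_hom psi_hom)
      (simp_all add: phi_psi psi_phi)
qed

context morita_artin begin

abbreviation \<Lambda>' where "\<Lambda>' \<equiv> morita_ring B A M N \<psi> \<phi>"

lemma swap_carrier: "morita_swap u \<in> carrier \<Lambda>' \<longleftrightarrow> u \<in> carrier \<Lambda>"
  by (cases u) (auto simp: morita_ring_def)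

lemma swap_image: "morita_swap ` carrier \<Lambda> = carrier \<Lambda>'"
proof
  show "morita_swap ` carrier \<Lambda> \<subseteq> carrier \<Lambda>'" using swap_carrier by auto
  show "carrier \<Lambda>' \<subseteq> morita_swap ` carrier \<Lambda>"
  proof
    fix v assume "v \<in> carrier \<Lambda>'"
    then show "v \<in> morita_swap ` carrier \<Lambda>"
      using swap_carrier[of "morita_swap v"] by (intro image_eqI[of _ _ "morita_swap v"]) simp_all
  qed
qed

lemma swap_ops:
  "u \<in> carrier \<Lambda> \<Longrightarrow> v \<in> carrier \<Lambda> \<Longrightarrow> morita_swap (u \<oplus>\<^bsub>\<Lambda>\<^esub> v) = morita_swap u \<oplus>\<^bsub>\<Lambda>'\<^esub> morita_swap v"
  "u \<in> carrier \<Lambda> \<Longrightarrow> v \<in> carrier \<Lambda> \<Longrightarrow> morita_swap (u \<otimes>\<^bsub>\<Lambda>\<^esub> v) = morita_swap u \<otimes>\<^bsub>\<Lambda>'\<^esub> morita_swap v"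
  by (cases u; cases v; simp add: morita_ring_def N.a_comm M.a_comm)+

lemma swap_consts [simp]:
  "\<one>\<^bsub>\<Lambda>'\<^esub> = (\<one>\<^bsub>B\<^esub>, \<zero>\<^bsub>M\<^esub>, \<zero>\<^bsub>N\<^esub>, \<one>\<^bsub>A\<^esub>)" "\<zero>\<^bsub>\<Lambda>'\<^esub> = (\<zero>\<^bsub>B\<^esub>, \<zero>\<^bsub>M\<^esub>, \<zero>\<^bsub>N\<^esub>, \<zero>\<^bsub>A\<^esub>)"
  by (simp_all add: morita_ring_def)

lemma swap_ring_iso: "morita_swap \<in> ring_iso \<Lambda> \<Lambda>'"
proof (rule ring_iso_memI)
  show "bij_betw morita_swap (carrier \<Lambda>) (carrier \<Lambda>')"
    unfolding bij_betw_def swap_image by (simp add: inj_on_inverseI[of _ morita_swap])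
qed (simp_all add: swap_carrier swap_ops)

lemma swap_ring_hom: "morita_swap \<in> ring_hom \<Lambda> \<Lambda>'"
  using swap_ring_iso by (simp add: ring_iso_def)

lemma ring_\<Lambda>': "ring \<Lambda>'"
  using \<Lambda>.ring_iso_imp_img_ring[OF swap_ring_iso] by (simp flip: swap_consts(2))

lemma swap_ring_hom': "morita_swap \<in> ring_hom \<Lambda>' \<Lambda>"
proof (rule ring_hom_memI)
  fix u v assume u: "u \<in> carrier \<Lambda>'" and v: "v \<in> carrier \<Lambda>'"
  have uv: "morita_swap u \<in> carrier \<Lambda>" "morita_swap v \<in> carrier \<Lambda>"
    using u v swap_carrier[of "morita_swap u"] swap_carrier[of "morita_swap v"] by simp_all
  show "morita_swap u \<in> carrier \<Lambda>" by (rule uv)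
  show "morita_swap (u \<oplus>\<^bsub>\<Lambda>'\<^esub> v) = morita_swap u \<oplus>\<^bsub>\<Lambda>\<^esub> morita_swap v"
    "morita_swap (u \<otimes>\<^bsub>\<Lambda>'\<^esub> v) = morita_swap u \<otimes>\<^bsub>\<Lambda>\<^esub> morita_swap v"
    using swap_ops(1)[OF uv] swap_ops(2)[OF uv] by (metis morita_swap_simps(2))+
next
  show "morita_swap \<one>\<^bsub>\<Lambda>'\<^esub> = \<one>\<^bsub>\<Lambda>\<^esub>" by simp
qed

lemma swap_image': "morita_swap ` carrier \<Lambda>' = carrier \<Lambda>"
  unfolding swap_image[symmetric] by (simp add: image_image)

lemma morita_artin_swap: "morita_artin B A M N \<psi> \<phi> K (morita_swap \<circ> \<eta>)"
proof (rule morita_artin.intro)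
  show "morita_context B A M N \<psi> \<phi>" by (rule morita_context_swap[OF morita])
  let ?\<Lambda>'_over_K = "\<lparr>carrier = carrier \<Lambda>', mult = mult \<Lambda>', one = one \<Lambda>', zero = zero \<Lambda>', add = add \<Lambda>',
    smult = (\<lambda>k x. (morita_swap \<circ> \<eta>) k \<otimes>\<^bsub>\<Lambda>'\<^esub> x)\<rparr>"
  have eta: "\<eta> k \<in> carrier \<Lambda>" if "k \<in> carrier K" for k by (rule ring_hom_closed[OF eta_hom that])
  have mK: "left_module K \<Lambda>_over_K" using fg_\<Lambda>_over_K by (simp add: fg_module_def)
  have "semilinear_iso K \<Lambda>_over_K K ?\<Lambda>'_over_K id morita_swap"
  proof (intro semilinear_iso.intro semilinear_iso_axioms.intro mK left_module.axioms(1)[OF mK])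
    show "id \<in> ring_hom K K" by (auto simp: ring_hom_def)
    show "bij_betw morita_swap (carrier \<Lambda>_over_K) (carrier ?\<Lambda>'_over_K)"
      using swap_ring_iso by (simp add: ring_iso_def)
  qed (simp_all add: swap_ops eta)
  from semilinear_iso.fg_transfer[OF this fg_\<Lambda>_over_K]
  have fg: "finitely_generated K ?\<Lambda>'_over_K" by (simp add: fg_module_def)
  have hom: "morita_swap \<circ> \<eta> \<in> ring_hom K \<Lambda>'" by (rule ring_hom_trans[OF eta_hom swap_ring_hom])
  have "(morita_swap \<circ> \<eta>) k \<otimes>\<^bsub>\<Lambda>'\<^esub> v = v \<otimes>\<^bsub>\<Lambda>'\<^esub> (morita_swap \<circ> \<eta>) k"
    if k: "k \<in> carrier K" and v: "v \<in> carrier \<Lambda>'" for k v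
  proof -
    obtain u where u: "u \<in> carrier \<Lambda>" "v = morita_swap u" using v swap_image by blast
    show ?thesis
      unfolding u(2) o_apply swap_ops(2)[OF eta[OF k] u(1), symmetric] swap_ops(2)[OF u(1) eta[OF k], symmetric]
      by (simp only: central[OF k u(1)])
  qed
  then show "artin_algebra K (morita_swap \<circ> \<eta>) \<Lambda>'"
    using artinian_K ring_\<Lambda>' hom fg by (simp add: artin_algebra_def)
qed

lemma swap_module:
  fixes Z :: "('a \<times> 'n \<times> 'm \<times> 'b, 'z) module"
  assumes Z: "left_module \<Lambda> Z"
  shows "semilinear_iso \<Lambda> Z \<Lambda>' (pullback \<Lambda>' morita_swap Z) morita_swap id"
  using carrier_restrict_scalars[OF Z swap_ring_hom']
  by (intro semilinear_iso.intro semilinear_iso_axioms.intro Z ring_\<Lambda>' swap_ring_hom swap_image) simp_all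

lemma tuple_module_swap:
  assumes T: "t = (X, Y, f, g)" "t' = (Y, X, g, f)"
  shows "carrier (tuple_module A B N M t) = prod.swap ` carrier (tuple_module B A M N t')"
    "\<zero>\<^bsub>tuple_module A B N M t\<^esub> = prod.swap \<zero>\<^bsub>tuple_module B A M N t'\<^esub>"
    "prod.swap (p \<oplus>\<^bsub>tuple_module B A M N t'\<^esub> q) = prod.swap p \<oplus>\<^bsub>tuple_module A B N M t\<^esub> prod.swap q"
    "prod.swap (v \<odot>\<^bsub>tuple_module B A M N t'\<^esub> p) = morita_swap v \<odot>\<^bsub>tuple_module A B N M t\<^esub> prod.swap p"
  unfolding T by (simp_all add: tuple_module_def product_swap split_def morita_swap_def)

lemma swap_tuple_module_iso:
  fixes J :: "('b, 'y) module"
  assumes mod: "left_module \<Lambda>' (tuple_module B A M N (H_A B A M N \<psi> \<phi> J))"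
  shows "semilinear_iso \<Lambda>' (tuple_module B A M N (H_A B A M N \<psi> \<phi> J)) \<Lambda>
    (tuple_module A B N M (H_B A B N M \<phi> \<psi> J)) morita_swap prod.swap"
proof -
  note sw = tuple_module_swap[OF H_B_def[of A B N M \<phi> \<psi> J] H_A_def[of B A M N \<psi> \<phi> J]]
  show ?thesis
    by (intro semilinear_iso.intro semilinear_iso_axioms.intro mod \<Lambda>.ring_axioms swap_ring_hom' swap_image')
      (simp_all add: sw bij_betw_def)
qed

lemma H_B_indecomposable_injective:
  fixes J :: "('b, 'y) module"
  assumes J: "indecomposable_injective B J"
  shows "is_morita_tuple A B N M \<phi> \<psi> (H_B A B N M \<phi> \<psi> J)"
    "indecomposable_injective \<Lambda> (tuple_module A B N M (H_B A B N M \<phi> \<psi> J))"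
proof -
  interpret sw: morita_artin B A M N \<psi> \<phi> K "morita_swap \<circ> \<eta>" by (rule morita_artin_swap)
  note HA = sw.H_A_indecomposable_injective[OF J]
  show "is_morita_tuple A B N M \<phi> \<psi> (H_B A B N M \<phi> \<psi> J)"
    using HA(1) unfolding is_morita_tuple_def H_A_def H_B_def by simp
  have "left_module \<Lambda>' (tuple_module B A M N (H_A B A M N \<psi> \<phi> J))"
    using HA(2) by (simp add: indecomposable_injective_def fg_module_def)
  from semilinear_iso.indecomposable_injective_transfer[OF swap_tuple_module_iso[OF this] HA(2)]
  show "indecomposable_injective \<Lambda> (tuple_module A B N M (H_B A B N M \<phi> \<psi> J))" .
qed

lemma indecomposable_injective_is_H_B:
  fixes Z :: "('a \<times> 'n \<times> 'm \<times> 'b, 'z) module"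
  assumes Z: "indecomposable_injective \<Lambda> Z"
    and faithful: "\<And>z. \<lbrakk>z \<in> carrier Z; \<And>u. u \<in> CB.E \<Longrightarrow> u \<odot>\<^bsub>Z\<^esub> z = \<zero>\<^bsub>Z\<^esub>\<rbrakk> \<Longrightarrow> z = \<zero>\<^bsub>Z\<^esub>"
  shows "\<exists>J :: ('b, 'z) module. indecomposable_injective B J \<and>
    module_isomorphic \<Lambda> Z (tuple_module A B N M (H_B A B N M \<phi> \<psi> J))"
proof -
  interpret sw: morita_artin B A M N \<psi> \<phi> K "morita_swap \<circ> \<eta>" by (rule morita_artin_swap)
  have mZ: "left_module \<Lambda> Z" using Z by (simp add: indecomposable_injective_def fg_module_def)
  let ?Z = "pullback \<Lambda>' morita_swap Z"
  have cZ: "carrier ?Z = carrier Z" by (rule carrier_restrict_scalars[OF mZ swap_ring_hom'])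
  have Z': "indecomposable_injective \<Lambda>' ?Z"
    by (rule semilinear_iso.indecomposable_injective_transfer[OF swap_module[OF mZ] Z])
  have "\<exists>J :: ('b, 'z) module. indecomposable_injective B J \<and>
    module_isomorphic \<Lambda>' ?Z (tuple_module B A M N (H_A B A M N \<psi> \<phi> J))"
  proof (rule sw.indecomposable_injective_is_H_A[OF Z'])
    fix z assume z: "z \<in> carrier ?Z" and van: "\<And>u. u \<in> sw.CA.E \<Longrightarrow> u \<odot>\<^bsub>?Z\<^esub> z = \<zero>\<^bsub>?Z\<^esub>"
    have "u \<odot>\<^bsub>Z\<^esub> z = \<zero>\<^bsub>Z\<^esub>" if "u \<in> CB.E" for u
    proof -
      have "morita_swap u \<in> sw.CA.E" using that unfolding CB_E sw.CA_E by auto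
      from van[OF this] show ?thesis by simp
    qed
    then show "z = \<zero>\<^bsub>?Z\<^esub>" using faithful[of z] z by (simp add: cZ)
  qed
  then obtain J :: "('b, 'z) module" and h where J: "indecomposable_injective B J"
    and h: "h \<in> module_hom \<Lambda>' ?Z (tuple_module B A M N (H_A B A M N \<psi> \<phi> J))"
      "bij_betw h (carrier ?Z) (carrier (tuple_module B A M N (H_A B A M N \<psi> \<phi> J)))"
    unfolding module_isomorphic_def by blast
  note sw = tuple_module_swap[OF H_B_def[of A B N M \<phi> \<psi> J] H_A_def[of B A M N \<psi> \<phi> J]]
  note hD = module_homD[OF h(1), unfolded cZ]
  have "prod.swap \<circ> h \<in> module_hom \<Lambda> Z (tuple_module A B N M (H_B A B N M \<phi> \<psi> J))"
  proof (rule module_homI)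
    fix u z assume u: "u \<in> carrier \<Lambda>" and z: "z \<in> carrier Z"
    show "(prod.swap \<circ> h) (u \<odot>\<^bsub>Z\<^esub> z) = u \<odot>\<^bsub>tuple_module A B N M (H_B A B N M \<phi> \<psi> J)\<^esub> (prod.swap \<circ> h) z"
      using hD(3)[of "morita_swap u" z] u z swap_carrier[of u] by (simp add: sw)
  qed (use hD(1,2) in \<open>simp_all add: sw\<close>)
  moreover have "bij_betw (prod.swap \<circ> h) (carrier Z) (carrier (tuple_module A B N M (H_B A B N M \<phi> \<psi> J)))"
    by (rule bij_betw_trans[OF h(2)[unfolded cZ]]) (simp add: bij_betw_def sw(1))
  ultimately show ?thesis using J unfolding module_isomorphic_def by blast
qed

end

section \<open>Classification of the indecomposable injective modules\<close>

theorem proposition3p2: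
  fixes A :: "'a ring" and B :: "'b ring"
    and N :: "('a, 'b, 'n) bimodule" and M :: "('b, 'a, 'm) bimodule"
    and \<phi> :: "(('m \<times> 'n) \<Rightarrow>\<^sub>0 int) set \<Rightarrow> 'b" and \<psi> :: "(('n \<times> 'm) \<Rightarrow>\<^sub>0 int) set \<Rightarrow> 'a"
    and K :: "'k ring" and \<eta> :: "'k \<Rightarrow> 'a \<times> 'n \<times> 'm \<times> 'b"
  assumes "morita_context A B N M \<phi> \<psi>"
    and "artin_algebra K \<eta> (morita_ring A B N M \<phi> \<psi>)"
  shows "(\<forall>I :: ('a, 'x) module. indecomposable_injective A I \<longrightarrow>
        is_morita_tuple A B N M \<phi> \<psi> (H_A A B N M \<phi> \<psi> I) \<and>
        indecomposable_injective (morita_ring A B N M \<phi> \<psi>)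
          (tuple_module A B N M (H_A A B N M \<phi> \<psi> I)))
    \<and> (\<forall>J :: ('b, 'y) module. indecomposable_injective B J \<longrightarrow>
        is_morita_tuple A B N M \<phi> \<psi> (H_B A B N M \<phi> \<psi> J) \<and>
        indecomposable_injective (morita_ring A B N M \<phi> \<psi>)
          (tuple_module A B N M (H_B A B N M \<phi> \<psi> J)))
    \<and> (\<forall>Z :: ('a \<times> 'n \<times> 'm \<times> 'b, 'z) module.
        indecomposable_injective (morita_ring A B N M \<phi> \<psi>) Z \<longrightarrow>
        (\<exists>I :: ('a, 'z) module. indecomposable_injective A I \<and>
          module_isomorphic (morita_ring A B N M \<phi> \<psi>) Z
            (tuple_module A B N M (H_A A B N M \<phi> \<psi> I))) \<or>
        (\<exists>J :: ('b, 'z) module. indecomposable_injective B J \<and>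
          module_isomorphic (morita_ring A B N M \<phi> \<psi>) Z
            (tuple_module A B N M (H_B A B N M \<phi> \<psi> J))))"
proof -
  interpret morita_artin A B N M \<phi> \<psi> K \<eta> using assms by (rule morita_artin.intro)
  have "(\<exists>I :: ('a, 'z) module. indecomposable_injective A I \<and>
          module_isomorphic \<Lambda> Z (tuple_module A B N M (H_A A B N M \<phi> \<psi> I))) \<or>
        (\<exists>J :: ('b, 'z) module. indecomposable_injective B J \<and>
          module_isomorphic \<Lambda> Z (tuple_module A B N M (H_B A B N M \<phi> \<psi> J)))"
    if Z: "indecomposable_injective \<Lambda> Z" for Z :: "('a \<times> 'n \<times> 'm \<times> 'b, 'z) module"
    using faithful_corner[OF Z]
  proof
    assume *: "\<forall>z\<in>carrier Z. (\<forall>u\<in>CA.E. u \<odot>\<^bsub>Z\<^esub> z = \<zero>\<^bsub>Z\<^esub>) \<longrightarrow> z = \<zero>\<^bsub>Z\<^esub>"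
    show ?thesis
      by (rule disjI1, rule indecomposable_injective_is_H_A[OF Z]) (use * in blast)
  next
    assume *: "\<forall>z\<in>carrier Z. (\<forall>u\<in>CB.E. u \<odot>\<^bsub>Z\<^esub> z = \<zero>\<^bsub>Z\<^esub>) \<longrightarrow> z = \<zero>\<^bsub>Z\<^esub>"
    show ?thesis
      by (rule disjI2, rule indecomposable_injective_is_H_B[OF Z]) (use * in blast)
  qed
  then show ?thesis
    using H_A_indecomposable_injective H_B_indecomposable_injective by blast
qed

end
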